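(* Let $G(s)$ and $\bar G(s)$ be $m\times m$ transfer function matrices. Suppose that $\bar G(s)$ is strictly negative imaginary (SNI) and that $G(s)$ is strictly proper and negative imaginary (NI) with either ($G_2=0$ and $G_1$ invertible) or ($G_1=0$ and $G_2>0$). Then the positive-feedback interconnection $[G(s),\bar G(s)]$ is internally stable if and only if $\bar G(0)<0$.
   Context: Conventions. Transfer function matrices are square, real, rational and proper, $G(s)=C(sI-A)^{-1}B+D$ with real $A,B,C,D$; $G$ is strictly proper if $G(\infty)=D=0$. $M^*$ is the conjugate transpose; $>0,\ \ge 0,\ <0$ denote (Hermitian/symmetric) positive definiteness, positive semidefiniteness, negative definiteness. NI. A square $G(s)$ is NI if: (1) $G(s)$ has no pole in $\mathrm{Re}[s]>0$; (2) for all $\omega>0$ such that $j\omega$ is not a pole of $G(s)$, $j(G(j\omega)-G(j\omega)^* )\ge 0$; (3) if $s=j\omega_0$ with $\omega_0>0$ is a pole of $G(s)$, it is a simple pole and $K=\lim_{s\to j\omega_0}(s-j\omega_0)jG(s)$ is Hermitian and positive semidefinite; (4) if $s=0$ is a pole of $G(s)$, then $\lim_{s\to0}s^kG(s)=0$ for all $k\ge 3$ and $\lim_{s\to 0}s^2G(s)$ is Hermitian and positive semidefinite. SNI. A square $\bar G(s)$ is SNI if it has no pole in $\mathrm{Re}[s]\ge 0$ and $j(\bar G(j\omega)-\bar G(j\omega)^* )>0$ for all $\omega>0$. Internal stability. Let $G$ have minimal realization $(A,B,C,D)$ and $\bar G$ minimal realization $(\bar A,\bar B,\bar C,\bar D)$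 with $I-D\bar D$ nonsingular. The positive feedback interconnection $[G(s),\bar G(s)]$ is internally stable if $$\breve A=\begin{bmatrix}A+B\bar D(I-D\bar D)^{-1}C & B\bar C+B\bar D(I-D\bar D)^{-1}D\bar C\\ \bar B(I-D\bar D)^{-1}C & \bar A+\bar B(I-D\bar D)^{-1}D\bar C\end{bmatrix}$$ is Hurwitz (all eigenvalues in the open left half plane). Matrices attached to an NI $G$: $G_2=\lim_{s\to0}s^2G(s)$, $G_1=\lim_{s\to0}s\left(G(s)-\frac{G_2}{s^2}\right)$. *)

theory Defs
  imports
    "HOL-Complex_Analysis.Complex_Analysis"
    "Jordan_Normal_Form.Gauss_Jordan_Elimination"
    "Jordan_Normal_Form.Schur_Decomposition"
    "Jordan_Normal_Form.Char_Poly"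
begin

(* Matrices are those of Jordan_Normal_Form, whose dimensions are natural numbers: minimality of a
   realization compares state dimensions, so these have to be quantified over. *)

section \<open>Hermitian definiteness\<close>

definition hermitian_mat :: "complex mat \<Rightarrow> bool" where
  "hermitian_mat M \<longleftrightarrow> mat_adjoint M = M"

definition pos_semidef :: "complex mat \<Rightarrow> bool" where
  "pos_semidef M \<longleftrightarrow> hermitian_mat M \<and>
     (\<forall>v \<in> carrier_vec (dim_row M). Re ((M *\<^sub>v v) \<bullet>c v) \<ge> 0)"

definition pos_def :: "complex mat \<Rightarrow> bool" where
  "pos_def M \<longleftrightarrow> hermitian_mat M \<and>
     (\<forall>v \<in> carrier_vec (dim_row M). v \<noteq> 0\<^sub>v (dim_row M) \<longrightarrow> Re ((M *\<^sub>v v) \<bullet>c v) > 0)"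

definition neg_def :: "complex mat \<Rightarrow> bool" where
  "neg_def M \<longleftrightarrow> hermitian_mat M \<and>
     (\<forall>v \<in> carrier_vec (dim_row M). v \<noteq> 0\<^sub>v (dim_row M) \<longrightarrow> Re ((M *\<^sub>v v) \<bullet>c v) < 0)"


section \<open>Real rational proper transfer functions\<close>

abbreviation cmat :: "real mat \<Rightarrow> complex mat" where
  "cmat \<equiv> map_mat complex_of_real"

(* Only meaningful when the argument is invertible. *)
definition inv_mat :: "'a :: field mat \<Rightarrow> 'a mat" where
  "inv_mat M = the (mat_inverse M)"

definition state_space_eval ::
  "real mat \<Rightarrow> real mat \<Rightarrow> real mat \<Rightarrow> real mat \<Rightarrow> complex \<Rightarrow> complex mat" where
  "state_space_eval A B C D s =
     cmat C * inv_mat (s \<cdot>\<^sub>m 1\<^sub>m (dim_row A) - cmat A) * cmat B + cmat D"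

(* The rational matrix C (sI - A)^{-1} B + D as a function on the whole complex plane. The formula
   itself is unusable at eigenvalues of A; there remove_sings gives each entry its continuous
   extension if it has one, and the dummy value 0 at a genuine pole. *)
definition transfer_function ::
  "real mat \<Rightarrow> real mat \<Rightarrow> real mat \<Rightarrow> real mat \<Rightarrow> complex \<Rightarrow> complex mat" where
  "transfer_function A B C D s =
     Matrix.mat (dim_row D) (dim_col D)
       (\<lambda>(i, j). remove_sings (\<lambda>z. state_space_eval A B C D z $$ (i, j)) s)"

definition realization ::
  "nat \<Rightarrow> nat \<Rightarrow> real mat \<Rightarrow> real mat \<Rightarrow> real mat \<Rightarrow> real mat \<Rightarrow> (complex \<Rightarrow> complex mat) \<Rightarrow> bool" where
  "realization m n A B C D G \<longleftrightarrow>
     A \<in> carrier_mat n n \<and> B \<in> carrier_mat n m \<and> C \<in> carrier_mat m n \<and> D \<in> carrier_mat m m \<and>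
     G = transfer_function A B C D"

definition minimal_realization ::
  "nat \<Rightarrow> nat \<Rightarrow> real mat \<Rightarrow> real mat \<Rightarrow> real mat \<Rightarrow> real mat \<Rightarrow> (complex \<Rightarrow> complex mat) \<Rightarrow> bool" where
  "minimal_realization m n A B C D G \<longleftrightarrow>
     realization m n A B C D G \<and>
     (\<forall>n' A' B' C' D'. realization m n' A' B' C' D' G \<longrightarrow> n \<le> n')"

lemma minimal_realization_exists:
  assumes "realization m n A B C D G"
  shows "\<exists>n' A' B' C' D'. minimal_realization m n' A' B' C' D' G"
proof -
  let ?P = "\<lambda>k. \<exists>A' B' C' D'. realization m k A' B' C' D' G"
  have "?P n" using assms by blast
  then have "?P (LEAST k. ?P k)" by (rule LeastI)
  moreover have "\<And>k. ?P k \<Longrightarrow> (LEAST k. ?P k) \<le> k" by (rule Least_le)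
  ultimately show ?thesis unfolding minimal_realization_def by blast
qed

definition mat_tendsto ::
  "nat \<Rightarrow> (complex \<Rightarrow> complex mat) \<Rightarrow> complex mat \<Rightarrow> complex filter \<Rightarrow> bool" where
  "mat_tendsto m F L Fl \<longleftrightarrow> L \<in> carrier_mat m m \<and>
     (\<forall>i<m. \<forall>j<m. ((\<lambda>s. F s $$ (i, j)) \<longlongrightarrow> L $$ (i, j)) Fl)"

definition mat_lim :: "nat \<Rightarrow> (complex \<Rightarrow> complex mat) \<Rightarrow> complex filter \<Rightarrow> complex mat" where
  "mat_lim m F Fl = Matrix.mat m m (\<lambda>(i, j). Lim Fl (\<lambda>s. F s $$ (i, j)))"

definition strictly_proper :: "nat \<Rightarrow> (complex \<Rightarrow> complex mat) \<Rightarrow> bool" where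
  "strictly_proper m G \<longleftrightarrow> mat_tendsto m G (0\<^sub>m m m) at_infinity"

definition has_pole :: "nat \<Rightarrow> (complex \<Rightarrow> complex mat) \<Rightarrow> complex \<Rightarrow> bool" where
  "has_pole m G s \<longleftrightarrow> (\<exists>i<m. \<exists>j<m. is_pole (\<lambda>z. G z $$ (i, j)) s)"

definition has_simple_pole :: "nat \<Rightarrow> (complex \<Rightarrow> complex mat) \<Rightarrow> complex \<Rightarrow> bool" where
  "has_simple_pole m G s \<longleftrightarrow> has_pole m G s \<and>
     (\<forall>i<m. \<forall>j<m. is_pole (\<lambda>z. G z $$ (i, j)) s \<longrightarrow> zorder (\<lambda>z. G z $$ (i, j)) s = -1)"


section \<open>Negative imaginary transfer functions\<close>

definition imag_herm :: "complex mat \<Rightarrow> complex mat" where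
  "imag_herm M = \<i> \<cdot>\<^sub>m (M - mat_adjoint M)"

definition negative_imaginary :: "nat \<Rightarrow> (complex \<Rightarrow> complex mat) \<Rightarrow> bool" where
  "negative_imaginary m G \<longleftrightarrow>
     (\<forall>s. Re s > 0 \<longrightarrow> \<not> has_pole m G s) \<and>
     (\<forall>\<omega>::real. \<omega> > 0 \<and> \<not> has_pole m G (\<i> * of_real \<omega>) \<longrightarrow>
        pos_semidef (imag_herm (G (\<i> * of_real \<omega>)))) \<and>
     (\<forall>\<omega>\<^sub>0::real. \<omega>\<^sub>0 > 0 \<and> has_pole m G (\<i> * of_real \<omega>\<^sub>0) \<longrightarrow>
        has_simple_pole m G (\<i> * of_real \<omega>\<^sub>0) \<and>
        (\<exists>K. mat_tendsto m (\<lambda>s. ((s - \<i> * of_real \<omega>\<^sub>0) * \<i>) \<cdot>\<^sub>m G s) K (at (\<i> * of_real \<omega>\<^sub>0)) \<and>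
             pos_semidef K)) \<and>
     (has_pole m G 0 \<longrightarrow>
        (\<forall>k\<ge>3. mat_tendsto m (\<lambda>s. s ^ k \<cdot>\<^sub>m G s) (0\<^sub>m m m) (at 0)) \<and>
        (\<exists>L. mat_tendsto m (\<lambda>s. s ^ 2 \<cdot>\<^sub>m G s) L (at 0) \<and> pos_semidef L))"

definition strictly_negative_imaginary :: "nat \<Rightarrow> (complex \<Rightarrow> complex mat) \<Rightarrow> bool" where
  "strictly_negative_imaginary m G \<longleftrightarrow>
     (\<forall>s. Re s \<ge> 0 \<longrightarrow> \<not> has_pole m G s) \<and>
     (\<forall>\<omega>::real. \<omega> > 0 \<longrightarrow> pos_def (imag_herm (G (\<i> * of_real \<omega>))))"

(* The limits below exist whenever G is a negative imaginary transfer function: it then has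
   a pole of order at most 2 at the origin. *)
definition G2 :: "nat \<Rightarrow> (complex \<Rightarrow> complex mat) \<Rightarrow> complex mat" where
  "G2 m G = mat_lim m (\<lambda>s. s ^ 2 \<cdot>\<^sub>m G s) (at 0)"

definition G1 :: "nat \<Rightarrow> (complex \<Rightarrow> complex mat) \<Rightarrow> complex mat" where
  "G1 m G = mat_lim m (\<lambda>s. s \<cdot>\<^sub>m (G s - (1 / s ^ 2) \<cdot>\<^sub>m G2 m G)) (at 0)"


section \<open>Internal stability of the positive feedback interconnection\<close>

definition hurwitz :: "real mat \<Rightarrow> bool" where
  "hurwitz A \<longleftrightarrow> (\<forall>z. eigenvalue (cmat A) z \<longrightarrow> Re z < 0)"

definition closed_loop_mat ::
  "real mat \<Rightarrow> real mat \<Rightarrow> real mat \<Rightarrow> real mat \<Rightarrow>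
   real mat \<Rightarrow> real mat \<Rightarrow> real mat \<Rightarrow> real mat \<Rightarrow> real mat" where
  "closed_loop_mat A B C D A' B' C' D' =
     (let E = inv_mat (1\<^sub>m (dim_row D) - D * D') in
      four_block_mat
        (A + B * D' * E * C)  (B * C' + B * D' * E * D * C')
        (B' * E * C)          (A' + B' * E * D * C'))"

(* To be applied to minimal realizations of the two transfer functions. *)
definition internally_stable ::
  "real mat \<Rightarrow> real mat \<Rightarrow> real mat \<Rightarrow> real mat \<Rightarrow>
   real mat \<Rightarrow> real mat \<Rightarrow> real mat \<Rightarrow> real mat \<Rightarrow> bool" where
  "internally_stable A B C D A' B' C' D' \<longleftrightarrow>
     invertible_mat (1\<^sub>m (dim_row D) - D * D') \<and> hurwitz (closed_loop_mat A B C D A' B' C' D')"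

end

theory Submission
  imports Defs
begin

text \<open>
  Write \<open>G'\<close> for the SNI system. Let \<open>(x, x')\<close> be an eigenvector of the closed loop at \<open>s\<close> and put
  \<open>u = C x\<close>, \<open>y = G'(s) u\<close>, \<open>p = y\<^sup>* u\<close>, so that \<open>u = G(s) y\<close> away from the poles of \<open>G\<close>.
  If \<open>Re s > 0\<close>, then \<open>Re (s p) \<ge> 0\<close>, because \<open>s G(s)\<close> is positive real. Also
  \<open>(G'(0) - G'(s)) / s\<close> is positive real, so \<open>G'(0) < 0\<close> gives
  \<open>Re (cnj p / s) \<le> Re (u\<^sup>* G'(0) u / s) < 0\<close>, which contradicts \<open>Re (s p) \<ge> 0\<close>.
  For \<open>s = i w\<close> with \<open>w > 0\<close> the signs of \<open>Im (y\<^sup>* G y)\<close> and \<open>Im (u\<^sup>* G' u)\<close> clash, and at \<open>s = 0\<close> the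
  condition on \<open>G1\<close>, \<open>G2\<close> forces \<open>y = 0\<close>.

  Conversely, if the loop is Hurwitz, then \<open>K = (I - G G')\<^sup>-\<^sup>1 G\<close> is stable, strictly proper and
  negative imaginary, so \<open>K(0) \<ge> 0\<close>; the condition at the origin gives \<open>G'(0) K(0) = - I\<close>, hence
  \<open>G'(0) < 0\<close>.

  Minimality is used in two forms: \<open>C x = 0\<close> for no eigenvector \<open>x\<close> of \<open>A\<close>, and for every vector \<open>x\<close>
  one has \<open>C (s I - A)\<^sup>-\<^sup>1 x = G(s) b(s) + r(s)\<close> with continuous \<open>b\<close>, \<open>r\<close>, so that the left side has no
  worse poles than \<open>G\<close>.
\<close>

text \<open>Poles of \<open>G\<close> on the imaginary axis are the obstacle: a closed-loop
  eigenvalue may sit exactly at such a pole, where \<open>u = G(s) y\<close> makes no sense. The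
  state equation s x - A x = B y is kept in its place. Rewritten at a nearby regular z it reads C x
  = G(z) y + (z - s) C (z I - A)^-1 x, and z tends to s; the second form of minimality controls the
  last term. The two auxiliary functions are chosen for their poles. \<open>G\<close> may have a
  double pole at 0, which the factor s turns into a simple one with coefficient \<open>G2\<close>,
  while strict properness keeps s G(s) bounded at infinity. Subtracting the value at 0 before
  dividing by s removes the pole that the division would create. Quadratic forms make both functions
  scalar, so a single half-plane theorem serves plant, controller and closed loop. Real coefficients
  supply the lower half of the imaginary axis, with the vector conjugated; they also force the
  quadratic form of \<open>G'(0)\<close> to be real.\<close>

unbundle no vec_syntax
unbundle no fps_syntax

section \<open>Positivity in the right half plane\<close>

text \<open>A minimum principle for the harmonic function Re f on an unbounded domain. If Re f were
  negative somewhere, a sublevel set would be compact, so Re f would attain a minimum at an interior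
  point. Only lower bounds are demanded near the boundary and near infinity, because f may blow up
  there with positive real part.\<close>

lemma half_plane_Re_nonneg_aux:
  fixes f :: "complex \<Rightarrow> complex"
  assumes hol: "f holomorphic_on {z. Re z > 0}"
    and bd: "\<And>p e. Re p = 0 \<Longrightarrow> e > 0 \<Longrightarrow> eventually (\<lambda>z. Re (f z) > - e) (at p within {z. Re z > 0})"
    and inf: "\<And>e. e > 0 \<Longrightarrow> eventually (\<lambda>z. Re z > 0 \<longrightarrow> Re (f z) > - e) at_infinity"
    and s: "Re s > 0"
  shows "Re (f s) \<ge> 0"
proof (rule ccontr)
  define H where "H = {z. Re z > 0}"
  have H: "open H" "convex H" "connected H"
    unfolding H_def using open_halfspace_Re_gt convex_halfspace_Re_gt
    by (auto intro: convex_connected)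
  assume neg: "\<not> Re (f s) \<ge> 0"
  define e where "e = - Re (f s) / 2"
  have e: "e > 0" "Re (f s) \<le> - e" using neg by (auto simp: e_def)
  define T where "T = {z \<in> H. Re (f z) \<le> - e}"
  have contf: "continuous_on H f" using hol holomorphic_on_imp_continuous_on H_def by blast
  \<comment> \<open>Closedness is meant in the whole plane: a limit point on the imaginary axis
    would contradict \<open>bd\<close>, so limit points of \<open>T\<close> stay in the open half
    plane.\<close>
  have "x \<in> T" if x: "x islimpt T" for x
  proof -
    have nt: "at x within T \<noteq> bot" using x by (simp add: trivial_limit_within)
    have le: "at x within T \<le> at x within H" by (rule at_le) (auto simp: T_def)
    have inT: "eventually (\<lambda>z. z \<in> T) (at x within T)" by (simp add: eventually_at_filter)
    have "Re x \<ge> 0"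
    proof (rule tendsto_lowerbound[OF _ _ nt])
      show "((\<lambda>z. Re z) \<longlongrightarrow> Re x) (at x within T)" by (intro tendsto_intros)
      show "\<forall>\<^sub>F z in at x within T. 0 \<le> Re z"
        using inT by eventually_elim (auto simp: T_def H_def)
    qed
    moreover have "Re x \<noteq> 0"
    proof
      assume "Re x = 0"
      from bd[OF this e(1)] have "eventually (\<lambda>z. Re (f z) > - e) (at x within T)"
        using le unfolding H_def by (simp add: filter_leD)
      with inT have "eventually (\<lambda>z. False) (at x within T)"
        by eventually_elim (auto simp: T_def)
      then show False using nt by simp
    qed
    ultimately have xH: "x \<in> H" by (auto simp: H_def)
    have "(f \<longlongrightarrow> f x) (at x within T)"
      using contf xH le by (meson continuous_on_def tendsto_mono)
    then have "Re (f x) \<le> - e"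
      by (intro tendsto_upperbound[OF tendsto_Re _ nt]) (use inT in \<open>auto elim!: eventually_mono simp: T_def\<close>)
    with xH show ?thesis by (auto simp: T_def)
  qed
  then have "closed T" by (simp add: closed_limpt)
  moreover have "bounded T"
  proof -
    obtain b where "\<And>z. norm z \<ge> b \<Longrightarrow> Re z > 0 \<longrightarrow> Re (f z) > - e"
      using inf[OF e(1)] by (auto simp: eventually_at_infinity)
    then have "T \<subseteq> cball 0 b" by (force simp: T_def H_def)
    then show ?thesis using bounded_subset bounded_cball by blast
  qed
  ultimately have "compact T" by (simp add: compact_eq_bounded_closed)
  moreover have "s \<in> T" using s e by (auto simp: T_def H_def)
  moreover have "continuous_on T (\<lambda>z. Re (f z))"
    by (intro continuous_intros continuous_on_subset[OF contf]) (auto simp: T_def)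
  ultimately obtain x where x: "x \<in> T" "\<And>z. z \<in> T \<Longrightarrow> Re (f x) \<le> Re (f z)"
    using continuous_attains_inf[of T "\<lambda>z. Re (f z)"] by blast
  have min: "Re (f x) \<le> Re (f z)" if "z \<in> H" for z
    using x that by (cases "z \<in> T") (auto simp: T_def)
  \<comment> \<open>The modulus of exp (- f) is exp (- Re f), so an interior minimum of Re f is an
    interior maximum of the modulus of a holomorphic function.\<close>
  have "(\<lambda>z. exp (- f z)) constant_on H"
  proof (rule maximum_modulus_principle[OF _ H(1,3) H(1) order_refl])
    show "(\<lambda>z. exp (- f z)) holomorphic_on H" using hol unfolding H_def by (intro holomorphic_intros)
    show "x \<in> H" using x by (auto simp: T_def)
    show "\<And>z. z \<in> H \<Longrightarrow> cmod (exp (- f z)) \<le> cmod (exp (- f x))" using min by simp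
  qed
  then obtain c where c: "\<And>z. z \<in> H \<Longrightarrow> exp (- f z) = c" unfolding constant_on_def by blast
  have le: "Re (f z) = Re (f s)" if "z \<in> H" for z
  proof -
    have "exp (- f z) = exp (- f s)" using c that s by (auto simp: H_def)
    then have "norm (exp (- f z)) = norm (exp (- f s))" by simp
    then show ?thesis by simp
  qed
  obtain b where b: "\<And>z. norm z \<ge> b \<Longrightarrow> Re z > 0 \<longrightarrow> Re (f z) > - e"
    using inf[OF e(1)] by (auto simp: eventually_at_infinity)
  \<comment> \<open>Constancy carries the value Re (f s) \<le> - e far out along the positive real
    axis, where \<open>inf\<close> forbids it.\<close>
  have "Re (f (of_real (\<bar>b\<bar> + 1))) > - e" using b[of "of_real (\<bar>b\<bar> + 1)"] by auto
  with le[of "of_real (\<bar>b\<bar> + 1)"] e show False by (auto simp: H_def)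
qed

text \<open>For an axis pole p with residue k \<ge> 0, the principal part k / (s - p) has
  nonnegative real part in the half plane and zero real part on the axis. The remainder extends
  continuously to p and inherits nonnegative real part from the axis, which yields the one-sided
  bound needed near p. The limit at infinity gets its sign along the axis, which leaves the finite
  set \<open>P\<close> eventually.\<close>

lemma half_plane_Re_nonneg:
  fixes f :: "complex \<Rightarrow> complex"
  assumes P: "finite P" "\<And>p. p \<in> P \<Longrightarrow> Re p \<le> 0"
    and hol: "f holomorphic_on - P"
    and axis: "\<And>w::real. \<i> * of_real w \<notin> P \<Longrightarrow> Re (f (\<i> * of_real w)) \<ge> 0"
    and pole: "\<And>p. p \<in> P \<Longrightarrow> Re p = 0 \<Longrightarrow>
      \<exists>k\<ge>0. ((\<lambda>s. (s - p) * f s) \<longlongrightarrow> of_real k) (at p)"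
    and inf: "(f \<longlongrightarrow> L) at_infinity"
    and s: "Re s > 0"
  shows "Re (f s) \<ge> 0"
proof (rule half_plane_Re_nonneg_aux[OF _ _ _ s])
  show "f holomorphic_on {z. Re z > 0}"
    by (rule holomorphic_on_subset[OF hol]) (use P in force)
next
  fix e :: real assume e: "e > 0"
  have "((\<lambda>w::real. Re (f (\<i> * of_real w))) \<longlongrightarrow> Re L) at_top"
  proof (intro tendsto_intros filterlim_compose[OF inf])
    have "filterlim (\<lambda>w::real. norm (\<i> * complex_of_real w)) at_top at_top"
      by (simp add: norm_mult filterlim_abs_real)
    then show "filterlim (\<lambda>w::real. \<i> * complex_of_real w) at_infinity at_top"
      by (rule filterlim_norm_at_top_imp_at_infinity)
  qed
  moreover have "eventually (\<lambda>w::real. Re (f (\<i> * of_real w)) \<ge> 0) at_top"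
  proof -
    have "finite (Im ` P)" using P by simp
    then have "eventually (\<lambda>w. w \<notin> Im ` P) at_top"
      by (metis (no_types, lifting) eventually_at_top_dense bdd_above_finite bdd_above_def not_le)
    then show ?thesis
      by eventually_elim (rule axis, force)
  qed
  ultimately have L: "Re L \<ge> 0" by (intro tendsto_lowerbound[where F = "at_top :: real filter"]) auto
  have "eventually (\<lambda>z. Re (f z) > - e) at_infinity"
    by (rule order_tendstoD(1)[OF tendsto_Re[OF inf]]) (use L e in auto)
  then show "eventually (\<lambda>z. Re z > 0 \<longrightarrow> Re (f z) > - e) at_infinity"
    by eventually_elim auto
next
  fix p :: complex and e :: real assume p: "Re p = 0" and e: "e > 0"
  \<comment> \<open>Regular boundary points are treated as poles with residue 0, so that one
    argument covers both.\<close>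
  have "\<exists>k\<ge>0. ((\<lambda>s. (s - p) * f s) \<longlongrightarrow> of_real k) (at p)"
  proof (cases "p \<in> P")
    case False
    have "open (- P)" using P by (simp add: finite_imp_closed open_Compl)
    then have "isCont f p"
      using False hol by (metis ComplI continuous_on_eq_continuous_at holomorphic_on_imp_continuous_on)
    then have "((\<lambda>s. (s - p) * f s) \<longlongrightarrow> (p - p) * f p) (at p)"
      by (intro tendsto_intros) (auto simp: isCont_def)
    then show ?thesis by (intro exI[of _ 0]) auto
  qed (use pole p in auto)
  then obtain k where k: "k \<ge> 0" "((\<lambda>s. (s - p) * f s) \<longlongrightarrow> of_real k) (at p)" by blast
  define h where "h = (\<lambda>z. f z - of_real k / (z - p))"
  define S where "S = - (P - {p})"
  have "closed (P - {p})" using P by (intro finite_imp_closed) auto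
  then have S: "open S" "p \<in> S" by (auto simp only: S_def open_Compl)
  have "(\<exists>g. g holomorphic_on S \<and> (\<forall>z \<in> S - {p}. g z = h z)) \<longleftrightarrow>
           ((\<lambda>z. (z - p) * h z) \<longlongrightarrow> 0) (at p)"
  proof (rule holomorphic_on_extend_lim)
    show "h holomorphic_on S - {p}"
      unfolding h_def by (intro holomorphic_intros holomorphic_on_subset[OF hol]) (auto simp: S_def)
    show "p \<in> interior S" using S by (simp add: interior_open)
  qed
  moreover have "((\<lambda>z. (z - p) * h z) \<longlongrightarrow> 0) (at p)"
  proof -
    have "((\<lambda>z. (z - p) * f z - of_real k) \<longlongrightarrow> of_real k - of_real k) (at p)"
      by (intro tendsto_intros k)
    moreover have "eventually (\<lambda>z. (z - p) * f z - of_real k = (z - p) * h z) (at p)"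
      by (auto simp: eventually_at_filter h_def right_diff_distrib)
    ultimately show ?thesis by (simp add: tendsto_cong)
  qed
  ultimately obtain g where g: "g holomorphic_on S" "\<And>z. z \<in> S - {p} \<Longrightarrow> g z = h z" by blast
  have gc: "isCont g p"
    using g S by (metis continuous_on_eq_continuous_at holomorphic_on_imp_continuous_on)
  have Sev: "eventually (\<lambda>z. z \<in> S - {p}) (at p)"
    by (rule eventually_at_in_open[OF S])
  have peq: "p = \<i> * of_real (Im p)" using p by (simp add: complex_eq_iff)
  have "Re (g p) \<ge> 0"
  proof -
    have lim: "filterlim (\<lambda>w::real. \<i> * complex_of_real w) (at p) (at (Im p))"
      unfolding filterlim_at
    proof
      have "((\<lambda>w::real. \<i> * complex_of_real w) \<longlongrightarrow> \<i> * complex_of_real (Im p)) (at (Im p))"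
        by (intro tendsto_intros)
      then show "((\<lambda>w::real. \<i> * complex_of_real w) \<longlongrightarrow> p) (at (Im p))" using peq by simp
      show "\<forall>\<^sub>F x in at (Im p). \<i> * complex_of_real x \<in> UNIV \<and> \<i> * complex_of_real x \<noteq> p"
        unfolding eventually_at_filter by (intro always_eventually allI impI conjI) (use peq in auto)
    qed
    have "((\<lambda>w. Re (g (\<i> * of_real w))) \<longlongrightarrow> Re (g p)) (at (Im p))"
      by (intro tendsto_intros filterlim_compose[OF _ lim]) (use gc in \<open>simp add: isCont_def\<close>)
    moreover have "eventually (\<lambda>w. Re (g (\<i> * of_real w)) \<ge> 0) (at (Im p))"
      using filterlim_iff[THEN iffD1, OF lim, rule_format, OF Sev]
    proof eventually_elim
      case (elim w)
      define d where "d = w - Im p"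
      have d: "\<i> * of_real w - p = \<i> * of_real d"
        by (subst peq) (simp add: d_def algebra_simps)
      have "Re (complex_of_real k / (\<i> * complex_of_real w - p)) = 0"
        unfolding d by (simp add: Re_divide)
      moreover have "Re (f (\<i> * of_real w)) \<ge> 0" by (rule axis) (use elim in \<open>auto simp: S_def\<close>)
      ultimately show ?case using g(2)[OF elim] by (simp add: h_def)
    qed
    ultimately show ?thesis by (intro tendsto_lowerbound[where F = "at (Im p)"]) auto
  qed
  then have "eventually (\<lambda>z. Re (g z) > - e) (at p)"
    using gc e by (intro order_tendstoD(1)[OF tendsto_Re]) (auto simp: isCont_def)
  with Sev have "eventually (\<lambda>z. z \<in> {z. Re z > 0} \<longrightarrow> Re (f z) > - e) (at p)"
  proof eventually_elim
    case (elim z)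
    have "Re (of_real k / (z - p)) \<ge> 0" if "Re z > 0"
      using k(1) p that by (simp add: Re_divide)
    then show ?case using elim g(2)[OF elim(1)] by (auto simp: h_def)
  qed
  then show "eventually (\<lambda>z. Re (f z) > - e) (at p within {z. Re z > 0})"
    unfolding eventually_at_filter by (auto elim: eventually_mono)
qed

section \<open>Resolvents and state space formulas\<close>

lemma inv_mat_det:
  fixes M :: "'a :: field mat"
  assumes M: "M \<in> carrier_mat n n" and d: "det M \<noteq> 0"
  shows "inv_mat M \<in> carrier_mat n n" "M * inv_mat M = 1\<^sub>m n" "inv_mat M * M = 1\<^sub>m n"
proof -
  have "mat_inverse M \<noteq> None"
    using mat_inverse(1)[OF M, where b = "()"] det_non_zero_imp_unit[OF M d, where b = "()"] by blast
  then obtain N where "mat_inverse M = Some N" by auto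
  then show "inv_mat M \<in> carrier_mat n n" "M * inv_mat M = 1\<^sub>m n" "inv_mat M * M = 1\<^sub>m n"
    using mat_inverse(2)[OF M] by (auto simp: inv_mat_def)
qed

definition resolvent :: "complex mat \<Rightarrow> complex \<Rightarrow> complex mat" where
  "resolvent A z = inv_mat (z \<cdot>\<^sub>m 1\<^sub>m (dim_row A) - A)"

lemma det_char_poly:
  assumes A: "(A :: 'a :: field mat) \<in> carrier_mat n n"
  shows "det (z \<cdot>\<^sub>m 1\<^sub>m n - A) = poly (char_poly A) z"
proof -
  have "- char_matrix A z = z \<cdot>\<^sub>m 1\<^sub>m n - A"
    using A by (intro eq_matI) (auto simp: char_matrix_def)
  then show ?thesis using char_poly_matrix[OF A] by simp
qed

lemma char_poly_nonzero:
  assumes A: "(A :: 'a :: field mat) \<in> carrier_mat n n"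
  shows "char_poly A \<noteq> 0"
  using degree_monic_char_poly[OF A] by auto

lemma finite_eigenvalues:
  assumes A: "(A :: 'a :: field mat) \<in> carrier_mat n n"
  shows "finite {z. eigenvalue A z}"
  unfolding eigenvalue_root_char_poly[OF A] using poly_roots_finite char_poly_nonzero[OF A] .

lemma resolvent:
  assumes A: "A \<in> carrier_mat n n" and z: "\<not> eigenvalue A z"
  shows "resolvent A z \<in> carrier_mat n n"
    "(z \<cdot>\<^sub>m 1\<^sub>m n - A) * resolvent A z = 1\<^sub>m n" "resolvent A z * (z \<cdot>\<^sub>m 1\<^sub>m n - A) = 1\<^sub>m n"
proof -
  have M: "z \<cdot>\<^sub>m 1\<^sub>m n - A \<in> carrier_mat n n" using A by auto
  have "det (z \<cdot>\<^sub>m 1\<^sub>m n - A) \<noteq> 0"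
    using z unfolding det_char_poly[OF A] eigenvalue_root_char_poly[OF A] .
  from inv_mat_det[OF M this] show "resolvent A z \<in> carrier_mat n n"
    "(z \<cdot>\<^sub>m 1\<^sub>m n - A) * resolvent A z = 1\<^sub>m n" "resolvent A z * (z \<cdot>\<^sub>m 1\<^sub>m n - A) = 1\<^sub>m n"
    using A by (auto simp: resolvent_def)
qed

lemma shift_mult_vec:
  assumes "A \<in> carrier_mat n n" "x \<in> carrier_vec n"
  shows "(z \<cdot>\<^sub>m 1\<^sub>m n - A) *\<^sub>v x = z \<cdot>\<^sub>v x - A *\<^sub>v (x :: 'a :: comm_ring_1 vec)"
proof -
  have "(z \<cdot>\<^sub>m 1\<^sub>m n) *\<^sub>v x = z \<cdot>\<^sub>v x" using assms by (intro eq_vecI) auto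
  then show ?thesis using assms by (subst minus_mult_distrib_mat_vec[of _ n n]) auto
qed

text \<open>The standard way to identify a resolvent below: a candidate x is checked against (z I -
  A) x = b, without manipulating the inverse matrix.\<close>

lemma resolvent_unique:
  assumes A: "A \<in> carrier_mat n n" and z: "\<not> eigenvalue A z"
    and x: "x \<in> carrier_vec n" and eq: "z \<cdot>\<^sub>v x - A *\<^sub>v x = b"
  shows "resolvent A z *\<^sub>v b = x"
proof -
  note R = resolvent[OF A z]
  have "resolvent A z *\<^sub>v b = resolvent A z *\<^sub>v ((z \<cdot>\<^sub>m 1\<^sub>m n - A) *\<^sub>v x)"
    unfolding shift_mult_vec[OF A x] eq ..
  also have "\<dots> = (resolvent A z * (z \<cdot>\<^sub>m 1\<^sub>m n - A)) *\<^sub>v x"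
    using R A x by (intro assoc_mult_mat_vec[symmetric]) auto
  also have "\<dots> = x" using R x by simp
  finally show ?thesis .
qed

lemma resolvent_solves:
  assumes A: "A \<in> carrier_mat n n" and z: "\<not> eigenvalue A z" and b: "b \<in> carrier_vec n"
  shows "resolvent A z *\<^sub>v b \<in> carrier_vec n"
    "z \<cdot>\<^sub>v (resolvent A z *\<^sub>v b) - A *\<^sub>v (resolvent A z *\<^sub>v b) = b"
proof -
  note R = resolvent[OF A z]
  show c: "resolvent A z *\<^sub>v b \<in> carrier_vec n" using R b by auto
  have "(z \<cdot>\<^sub>m 1\<^sub>m n - A) *\<^sub>v (resolvent A z *\<^sub>v b) = ((z \<cdot>\<^sub>m 1\<^sub>m n - A) * resolvent A z) *\<^sub>v b"
    using R A b by (intro assoc_mult_mat_vec[symmetric]) auto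
  also have "\<dots> = b" using R b by simp
  finally show "z \<cdot>\<^sub>v (resolvent A z *\<^sub>v b) - A *\<^sub>v (resolvent A z *\<^sub>v b) = b"
    unfolding shift_mult_vec[OF A c] .
qed

text \<open>Cramer's rule: the numerators are the entries of the adjugate of the polynomial matrix X
  I - A. The common denominator then gives both holomorphy off the spectrum and meromorphy on the
  plane.\<close>

lemma resolvent_rational:
  assumes A: "A \<in> carrier_mat n n"
  obtains P where "\<And>z i j. \<not> eigenvalue A z \<Longrightarrow> i < n \<Longrightarrow> j < n \<Longrightarrow>
    resolvent A z $$ (i, j) = poly (P i j) z / poly (char_poly A) z"
proof
  let ?Q = "adj_mat (char_poly_matrix A)"
  have cA: "char_poly_matrix A \<in> carrier_mat n n" using A by simp
  note Q = adj_mat[OF cA]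
  fix z i j assume z: "\<not> eigenvalue A z" and ij: "i < n" "j < n"
  have hom: "semiring_hom (\<lambda>p. poly p z)" by unfold_locales auto
  let ?e = "\<lambda>M. map_mat (\<lambda>p. poly p z) M"
  note R = resolvent[OF A z]
  have e: "?e (char_poly_matrix A) = z \<cdot>\<^sub>m 1\<^sub>m n - A"
    using A by (intro eq_matI) (auto simp: char_poly_matrix_def)
  have c: "?e ?Q \<in> carrier_mat n n" using Q by auto
  have "(z \<cdot>\<^sub>m 1\<^sub>m n - A) * ?e ?Q = ?e (char_poly_matrix A * ?Q)"
    unfolding e[symmetric] using cA Q by (intro semiring_hom.mat_hom_mult[OF hom, symmetric]) auto
  also have "\<dots> = poly (char_poly A) z \<cdot>\<^sub>m 1\<^sub>m n"
    unfolding Q char_poly_def by (intro eq_matI) auto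
  finally have "resolvent A z * ((z \<cdot>\<^sub>m 1\<^sub>m n - A) * ?e ?Q) = resolvent A z * (poly (char_poly A) z \<cdot>\<^sub>m 1\<^sub>m n)"
    by simp
  moreover have "resolvent A z * ((z \<cdot>\<^sub>m 1\<^sub>m n - A) * ?e ?Q) = ?e ?Q"
    using R A c by (subst assoc_mult_mat[symmetric, of _ n n _ n _ n]) auto
  moreover have "resolvent A z * (poly (char_poly A) z \<cdot>\<^sub>m 1\<^sub>m n) = poly (char_poly A) z \<cdot>\<^sub>m resolvent A z"
    using R by (subst mult_smult_distrib[of _ n n _ n]) auto
  ultimately have "?e ?Q = poly (char_poly A) z \<cdot>\<^sub>m resolvent A z" by simp
  then have "?e ?Q $$ (i, j) = (poly (char_poly A) z \<cdot>\<^sub>m resolvent A z) $$ (i, j)" by simp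
  then have "poly (?Q $$ (i, j)) z = poly (char_poly A) z * resolvent A z $$ (i, j)"
    using ij R(1) Q(1) by simp
  moreover have "poly (char_poly A) z \<noteq> 0" using z eigenvalue_root_char_poly[OF A] by simp
  ultimately show "resolvent A z $$ (i, j) = poly (?Q $$ (i, j)) z / poly (char_poly A) z"
    by (simp add: field_simps)
qed

lemma eventually_at_not_mem_finite:
  fixes s :: "'a :: t1_space"
  assumes "finite S" shows "eventually (\<lambda>z. z \<notin> S) (at s)"
proof -
  have "open (- (S - {s}))" by (intro open_Compl finite_imp_closed) (use assms in simp)
  then have "eventually (\<lambda>z. z \<in> - (S - {s}) - {s}) (at s)" by (intro eventually_at_in_open) auto
  then show ?thesis by eventually_elim auto
qed

lemma eventually_not_eigenvalue:
  assumes A: "A \<in> carrier_mat n n"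
  shows "eventually (\<lambda>z::complex. \<not> eigenvalue A z) (at s)" "eventually (\<lambda>z. \<not> eigenvalue A z) at_infinity"
proof -
  show "eventually (\<lambda>z. \<not> eigenvalue A z) (at s)"
    using eventually_at_not_mem_finite[OF finite_eigenvalues[OF A]] by auto
  have "bounded {z. eigenvalue A z}" using finite_eigenvalues[OF A] by (rule finite_imp_bounded)
  then obtain b where b: "\<And>z. eigenvalue A z \<Longrightarrow> norm z \<le> b" by (auto simp: bounded_iff)
  show "eventually (\<lambda>z. \<not> eigenvalue A z) at_infinity"
    unfolding eventually_at_infinity by (rule exI[of _ "b + 1"]) (use b in force)
qed

lemma resolvent_holomorphic:
  assumes A: "A \<in> carrier_mat n n" and ij: "i < n" "j < n"
  shows "(\<lambda>z. resolvent A z $$ (i, j)) holomorphic_on - {z. eigenvalue A z}"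
proof -
  obtain P where P: "\<And>z i j. \<not> eigenvalue A z \<Longrightarrow> i < n \<Longrightarrow> j < n \<Longrightarrow>
    resolvent A z $$ (i, j) = poly (P i j) z / poly (char_poly A) z"
    using resolvent_rational[OF A] by blast
  have "(\<lambda>z. poly (P i j) z / poly (char_poly A) z) holomorphic_on - {z. eigenvalue A z}"
    by (intro holomorphic_intros) (auto simp: eigenvalue_root_char_poly[OF A])
  then show ?thesis by (rule holomorphic_transform) (use P ij in auto)
qed

lemma resolvent_meromorphic:
  assumes A: "A \<in> carrier_mat n n" and ij: "i < n" "j < n"
  shows "(\<lambda>z. resolvent A z $$ (i, j)) meromorphic_on UNIV"
proof -
  obtain P where P: "\<And>z i j. \<not> eigenvalue A z \<Longrightarrow> i < n \<Longrightarrow> j < n \<Longrightarrow>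
    resolvent A z $$ (i, j) = poly (P i j) z / poly (char_poly A) z"
    using resolvent_rational[OF A] by blast
  have "(\<lambda>z. poly p z) analytic_on UNIV" for p :: "complex poly"
    unfolding analytic_on_open[OF open_UNIV] by (intro holomorphic_intros)
  then have mer: "(\<lambda>z. poly (P i j) z / poly (char_poly A) z) meromorphic_on UNIV"
    by (intro meromorphic_on_divide analytic_on_imp_meromorphic_on)
  \<comment> \<open>At an eigenvalue \<open>resolvent\<close> takes whatever value
    \<open>inv_mat\<close> has on a singular matrix; meromorphy depends only on punctured
    neighbourhoods, so this does no harm.\<close>
  have ev: "eventually (\<lambda>z. resolvent A z $$ (i, j) = poly (P i j) z / poly (char_poly A) z) (at s)" for s
    using eventually_not_eigenvalue(1)[OF A, of s] by eventually_elim (use P ij in auto)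
  show ?thesis by (subst meromorphic_on_cong[OF ev refl]) (rule mer)
qed

text \<open>From (z I - A) R = I one gets z R = I + A R, so it remains to see that R tends to 0. The
  column sum \<open>rho\<close> of absolute values satisfies |z| rho \<le> n (1 + a rho), where
  \<open>a\<close> bounds every absolute row sum of A; solving for \<open>rho\<close> gives a bound
  that decays like 1 / |z|.\<close>

lemma resolvent_at_infinity:
  assumes A: "A \<in> carrier_mat n n" and ij: "i < n" "j < n"
  shows "((\<lambda>z. z * resolvent A z $$ (i, j)) \<longlongrightarrow> (if i = j then 1 else 0)) at_infinity"
proof -
  define a where "a = (\<Sum>i<n. \<Sum>k<n. norm (A $$ (i, k)))"
  have a0: "a \<ge> 0" unfolding a_def by (intro sum_nonneg) auto
  define rho where "rho j z = (\<Sum>i<n. norm (resolvent A z $$ (i, j)))" for j z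
  have id: "z * resolvent A z $$ (i, j) =
      (if i = j then 1 else 0) + (\<Sum>k<n. A $$ (i, k) * resolvent A z $$ (k, j))"
    if z: "\<not> eigenvalue A z" and ij: "i < n" "j < n" for z i j
  proof -
    note R = resolvent[OF A z]
    have "((z \<cdot>\<^sub>m 1\<^sub>m n - A) * resolvent A z) $$ (i, j) = (if i = j then 1 else 0)"
      unfolding R using ij by simp
    moreover have "(z \<cdot>\<^sub>m 1\<^sub>m n - A) * resolvent A z = z \<cdot>\<^sub>m resolvent A z - A * resolvent A z"
      using R A by (subst minus_mult_distrib_mat[of _ n n _ _ n])
        (auto simp: mult_smult_assoc_mat[of _ n n _ n])
    ultimately show ?thesis using R A ij
      by (auto simp: scalar_prod_def atLeast0LessThan algebra_simps)
  qed
  have bound: "rho j z \<le> real n / (norm z - real n * a)"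
    if z: "\<not> eigenvalue A z" and j: "j < n" and big: "norm z > real n * a" for z j
  proof -
    have "norm z * norm (resolvent A z $$ (i, j)) \<le> 1 + a * rho j z" if i: "i < n" for i
    proof -
      have "norm z * norm (resolvent A z $$ (i, j)) = norm (z * resolvent A z $$ (i, j))"
        by (simp add: norm_mult)
      also have "\<dots> \<le> norm (if i = j then 1 else 0 :: complex)
          + norm (\<Sum>k<n. A $$ (i, k) * resolvent A z $$ (k, j))"
        unfolding id[OF z i j] by (rule norm_triangle_ineq)
      also have "norm (\<Sum>k<n. A $$ (i, k) * resolvent A z $$ (k, j))
          \<le> (\<Sum>k<n. norm (A $$ (i, k)) * rho j z)"
      proof (intro sum_norm_le)
        fix k assume k: "k \<in> {..<n}"
        have "norm (resolvent A z $$ (k, j)) \<le> rho j z"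
          unfolding rho_def using k by (intro member_le_sum) auto
        then show "norm (A $$ (i, k) * resolvent A z $$ (k, j)) \<le> norm (A $$ (i, k)) * rho j z"
          by (simp add: norm_mult mult_left_mono)
      qed
      also have "\<dots> = (\<Sum>k<n. norm (A $$ (i, k))) * rho j z" by (simp add: sum_distrib_right)
      also have "\<dots> \<le> a * rho j z"
      proof (rule mult_right_mono)
        show "(\<Sum>k<n. norm (A $$ (i, k))) \<le> a" unfolding a_def
          using i by (intro member_le_sum[where f = "\<lambda>i. \<Sum>k<n. norm (A $$ (i, k))"]) (auto intro: sum_nonneg)
        show "0 \<le> rho j z" unfolding rho_def by (intro sum_nonneg) auto
      qed
      finally show ?thesis by (auto split: if_splits)
    qed
    then have "(\<Sum>i<n. norm z * norm (resolvent A z $$ (i, j))) \<le> (\<Sum>i<n. 1 + a * rho j z)"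
      by (intro sum_mono) auto
    then have "norm z * rho j z \<le> real n * (1 + a * rho j z)"
      by (simp add: rho_def sum_distrib_left)
    then have "rho j z * (norm z - real n * a) \<le> real n" by (simp add: algebra_simps)
    then show ?thesis using big by (simp add: pos_le_divide_eq)
  qed
  have lim0: "((\<lambda>z. resolvent A z $$ (i, j)) \<longlongrightarrow> 0) at_infinity" if ij: "i < n" "j < n" for i j
  proof (rule Lim_null_comparison)
    have "eventually (\<lambda>z::complex. norm z > real n * a) at_infinity"
      unfolding eventually_at_infinity by (rule exI[of _ "real n * a + 1"]) auto
    then show "\<forall>\<^sub>F z in at_infinity. norm (resolvent A z $$ (i, j)) \<le> real n / (norm z - real n * a)"
      using eventually_not_eigenvalue(2)[OF A]
    proof eventually_elim
      case (elim z)
      have "norm (resolvent A z $$ (i, j)) \<le> rho j z"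
        unfolding rho_def using ij by (intro member_le_sum) auto
      also have "\<dots> \<le> real n / (norm z - real n * a)" using elim ij by (intro bound) auto
      finally show ?case .
    qed
    have "filterlim (\<lambda>z::complex. - (real n * a) + norm z) at_top at_infinity"
      by (intro filterlim_tendsto_add_at_top[OF tendsto_const filterlim_norm_at_top])
    then show "((\<lambda>z::complex. real n / (norm z - real n * a)) \<longlongrightarrow> 0) at_infinity"
      by (intro tendsto_divide_0[OF tendsto_const] filterlim_at_top_imp_at_infinity) simp
  qed
  have "((\<lambda>z. (if i = j then 1 else 0) + (\<Sum>k<n. A $$ (i, k) * resolvent A z $$ (k, j)))
    \<longlongrightarrow> (if i = j then 1 else 0) + (\<Sum>k<n. A $$ (i, k) * 0)) at_infinity"
    using ij by (intro tendsto_intros lim0) auto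
  moreover have "eventually (\<lambda>z. z * resolvent A z $$ (i, j) =
      (if i = j then 1 else 0) + (\<Sum>k<n. A $$ (i, k) * resolvent A z $$ (k, j))) at_infinity"
    using eventually_not_eigenvalue(2)[OF A] by eventually_elim (use id ij in auto)
  ultimately show ?thesis by (simp add: tendsto_cong)
qed

lemma conjugate_cmat_mult_vec:
  assumes "A \<in> carrier_mat nr nc" "x \<in> carrier_vec nc"
  shows "conjugate (cmat A *\<^sub>v x) = cmat A *\<^sub>v conjugate x"
  using assms by (intro eq_vecI) (auto simp: scalar_prod_def sum_conjugate)

lemma conjugate_minus_vec:
  "v \<in> carrier_vec n \<Longrightarrow> w \<in> carrier_vec n \<Longrightarrow> conjugate (v - w) = conjugate v - conjugate (w :: complex vec)"
  by (intro eq_vecI) auto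

lemma eigenvalue_cnj:
  assumes A: "A \<in> carrier_mat n n" and ev: "eigenvalue (cmat A) z"
  shows "eigenvalue (cmat A) (cnj z)"
proof -
  obtain v where v: "v \<in> carrier_vec n" "v \<noteq> 0\<^sub>v n" "cmat A *\<^sub>v v = z \<cdot>\<^sub>v v"
    using ev A by (auto simp: eigenvalue_def eigenvector_def)
  have "cmat A *\<^sub>v conjugate v = cnj z \<cdot>\<^sub>v conjugate v"
    using conjugate_cmat_mult_vec[OF A v(1)] v(3) conjugate_smult_vec[of z v] by simp
  moreover have "conjugate v \<noteq> 0\<^sub>v n" using v by simp
  ultimately show ?thesis using A v
    by (auto simp: eigenvalue_def eigenvector_def intro!: exI[of _ "conjugate v"])
qed

lemma resolvent_cnj:
  assumes A: "A \<in> carrier_mat n n" and z: "\<not> eigenvalue (cmat A) z" and b: "b \<in> carrier_vec n"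
  shows "resolvent (cmat A) (cnj z) *\<^sub>v conjugate b = conjugate (resolvent (cmat A) z *\<^sub>v b)"
proof (rule resolvent_unique[of _ n])
  have cA: "cmat A \<in> carrier_mat n n" using A by simp
  show "cmat A \<in> carrier_mat n n" by (rule cA)
  show "\<not> eigenvalue (cmat A) (cnj z)" using eigenvalue_cnj[OF A, of "cnj z"] z by auto
  note R = resolvent_solves[OF cA z b]
  show "conjugate (resolvent (cmat A) z *\<^sub>v b) \<in> carrier_vec n" using R by simp
  have "conjugate b = conjugate (z \<cdot>\<^sub>v (resolvent (cmat A) z *\<^sub>v b) - cmat A *\<^sub>v (resolvent (cmat A) z *\<^sub>v b))"
    using R by simp
  also have "\<dots> = conjugate (z \<cdot>\<^sub>v (resolvent (cmat A) z *\<^sub>v b)) - conjugate (cmat A *\<^sub>v (resolvent (cmat A) z *\<^sub>v b))"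
    using R A by (intro conjugate_minus_vec[of _ n]) auto
  finally show "cnj z \<cdot>\<^sub>v conjugate (resolvent (cmat A) z *\<^sub>v b) -
    cmat A *\<^sub>v conjugate (resolvent (cmat A) z *\<^sub>v b) = conjugate b"
    using conjugate_cmat_mult_vec[OF A R(1)] conjugate_smult_vec[of z "resolvent (cmat A) z *\<^sub>v b"] by simp
qed

lemma sesquilinear_sum:
  fixes M :: "complex mat"
  assumes "M \<in> carrier_mat m k" "x \<in> carrier_vec k" "y \<in> carrier_vec m"
  shows "(M *\<^sub>v x) \<bullet>c y = (\<Sum>i<m. \<Sum>j<k. M $$ (i, j) * x $ j * cnj (y $ i))"
  using assms by (auto simp: scalar_prod_def atLeast0LessThan sum_distrib_right)

lemma conjugate_scalar_prod:
  fixes x y :: "complex vec"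
  assumes "x \<in> carrier_vec m" "y \<in> carrier_vec m"
  shows "conjugate x \<bullet> y = cnj (x \<bullet>c y)" "y \<bullet>c x = cnj (x \<bullet>c y)"
  using assms by (auto simp: scalar_prod_def mult.commute)

lemma mat_mult_entry:
  assumes "M \<in> carrier_mat a b" "N \<in> carrier_mat b c" "i < a" "j < c"
  shows "(M * N) $$ (i, j) = (\<Sum>l<b. M $$ (i, l) * N $$ (l, j))"
  using assms by (auto simp: scalar_prod_def atLeast0LessThan)

section \<open>State space formulas and the transfer function with removable singularities filled
  in\<close>

locale state_space =
  fixes n m :: nat and A B C D :: "real mat"
  assumes A [simp]: "A \<in> carrier_mat n n" and B [simp]: "B \<in> carrier_mat n m"
    and C [simp]: "C \<in> carrier_mat m n" and D [simp]: "D \<in> carrier_mat m m"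
begin

abbreviation (input) "ev \<equiv> eigenvalue (cmat A)"
abbreviation (input) "R \<equiv> resolvent (cmat A)"
abbreviation (input) "H \<equiv> state_space_eval A B C D"
abbreviation (input) "T \<equiv> transfer_function A B C D"

lemma cmat_carrier [simp]:
  "cmat A \<in> carrier_mat n n" "cmat B \<in> carrier_mat n m" "cmat C \<in> carrier_mat m n" "cmat D \<in> carrier_mat m m"
  using A B C D by auto

lemma dims [simp]:
  "dim_row A = n" "dim_col A = n" "dim_row B = n" "dim_col B = m"
  "dim_row C = m" "dim_col C = n" "dim_row D = m" "dim_col D = m"
  using carrier_matD[OF A] carrier_matD[OF B] carrier_matD[OF C] carrier_matD[OF D] by auto

lemma H_def: "H z = cmat C * R z * cmat B + cmat D"
  by (simp add: state_space_eval_def resolvent_def)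

lemma H_carrier [simp]: "H z \<in> carrier_mat m m"
  unfolding H_def using B C D by auto

lemma H_apply:
  assumes z: "\<not> ev z" and y: "y \<in> carrier_vec m"
  shows "H z *\<^sub>v y = cmat C *\<^sub>v (R z *\<^sub>v (cmat B *\<^sub>v y)) + cmat D *\<^sub>v y"
proof -
  note R = resolvent(1)[OF cmat_carrier(1) z]
  have "H z *\<^sub>v y = (cmat C * R z * cmat B) *\<^sub>v y + cmat D *\<^sub>v y"
    unfolding H_def using R y by (intro add_mult_distrib_mat_vec[of _ m m]) (auto intro!: mult_carrier_mat)
  also have "(cmat C * R z * cmat B) *\<^sub>v y = (cmat C * R z) *\<^sub>v (cmat B *\<^sub>v y)"
    using R y by (intro assoc_mult_mat_vec[of _ m n _ m]) (auto intro!: mult_carrier_mat)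
  also have "\<dots> = cmat C *\<^sub>v (R z *\<^sub>v (cmat B *\<^sub>v y))"
    using R y by (intro assoc_mult_mat_vec[of _ m n _ n]) (auto intro!: mult_mat_vec_carrier)
  finally show ?thesis .
qed

lemma H_entry:
  assumes z: "\<not> ev z" and ij: "i < m" "j < m"
  shows "H z $$ (i, j) =
    (\<Sum>l<n. \<Sum>k<n. cmat C $$ (i, k) * R z $$ (k, l) * cmat B $$ (l, j)) + cmat D $$ (i, j)"
proof -
  note R = resolvent(1)[OF cmat_carrier(1) z]
  have RC: "(cmat C * R z) $$ (i, l) = (\<Sum>k<n. cmat C $$ (i, k) * R z $$ (k, l))" if "l < n" for l
    by (rule mat_mult_entry[OF cmat_carrier(3) R ij(1) that])
  have CR: "cmat C * R z \<in> carrier_mat m n" using R by (auto intro!: mult_carrier_mat)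
  have "(cmat C * R z * cmat B) $$ (i, j) = (\<Sum>l<n. (cmat C * R z) $$ (i, l) * cmat B $$ (l, j))"
    by (rule mat_mult_entry[OF CR cmat_carrier(2) ij])
  also have "\<dots> = (\<Sum>l<n. \<Sum>k<n. cmat C $$ (i, k) * R z $$ (k, l) * cmat B $$ (l, j))"
    by (intro sum.cong refl, subst RC) (auto simp: sum_distrib_right)
  finally have "(cmat C * R z * cmat B) $$ (i, j) = \<dots>" .
  then show ?thesis unfolding H_def using CR B D ij by simp
qed

lemma finite_ev: "finite {z. ev z}" by (rule finite_eigenvalues[OF cmat_carrier(1)])

lemmas eventually_not_ev = eventually_not_eigenvalue[OF cmat_carrier(1)]

lemma open_not_ev: "open (- {z. ev z})"
  by (intro open_Compl finite_imp_closed finite_ev)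

lemma H_holomorphic:
  assumes ij: "i < m" "j < m"
  shows "(\<lambda>z. H z $$ (i, j)) holomorphic_on - {z. ev z}"
proof (rule holomorphic_transform)
  show "(\<lambda>z. (\<Sum>l<n. \<Sum>k<n. cmat C $$ (i, k) * R z $$ (k, l) * cmat B $$ (l, j)) + cmat D $$ (i, j))
    holomorphic_on - {z. ev z}"
    using resolvent_holomorphic[OF cmat_carrier(1)] by (intro holomorphic_intros) auto
qed (use H_entry ij in auto)

lemma H_meromorphic:
  assumes ij: "i < m" "j < m"
  shows "(\<lambda>z. H z $$ (i, j)) meromorphic_on UNIV"
proof (subst meromorphic_on_cong[OF _ refl])
  show "(\<lambda>z. (\<Sum>l<n. \<Sum>k<n. cmat C $$ (i, k) * R z $$ (k, l) * cmat B $$ (l, j)) + cmat D $$ (i, j))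
    meromorphic_on UNIV"
    using resolvent_meromorphic[OF cmat_carrier(1)] by (intro meromorphic_intros) auto
  show "eventually (\<lambda>z. H z $$ (i, j) = (\<Sum>l<n. \<Sum>k<n. cmat C $$ (i, k) * R z $$ (k, l) * cmat B $$ (l, j))
    + cmat D $$ (i, j)) (at s)" for s
    using eventually_not_ev(1)[of s] by eventually_elim (use H_entry ij in auto)
qed

lemma H_at_infinity:
  assumes ij: "i < m" "j < m"
  shows "\<exists>L. ((\<lambda>z. z * (H z $$ (i, j) - cmat D $$ (i, j))) \<longlongrightarrow> L) at_infinity"
    and "((\<lambda>z. H z $$ (i, j)) \<longlongrightarrow> cmat D $$ (i, j)) at_infinity"
proof -
  let ?L = "(\<Sum>l<n. \<Sum>k<n. cmat C $$ (i, k) * (if k = l then 1 else 0) * cmat B $$ (l, j))"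
  have "((\<lambda>z. \<Sum>l<n. \<Sum>k<n. cmat C $$ (i, k) * (z * R z $$ (k, l)) * cmat B $$ (l, j)) \<longlongrightarrow> ?L) at_infinity"
    using resolvent_at_infinity[OF cmat_carrier(1)] by (intro tendsto_sum tendsto_mult tendsto_const) auto
  moreover have "eventually (\<lambda>z. z * (H z $$ (i, j) - cmat D $$ (i, j)) =
      (\<Sum>l<n. \<Sum>k<n. cmat C $$ (i, k) * (z * R z $$ (k, l)) * cmat B $$ (l, j))) at_infinity"
    using eventually_not_ev(2)
    by eventually_elim (use H_entry ij in \<open>auto simp: sum_distrib_left mult_ac\<close>)
  ultimately have L: "((\<lambda>z. z * (H z $$ (i, j) - cmat D $$ (i, j))) \<longlongrightarrow> ?L) at_infinity"
    by (simp add: tendsto_cong)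
  then show "\<exists>L. ((\<lambda>z. z * (H z $$ (i, j) - cmat D $$ (i, j))) \<longlongrightarrow> L) at_infinity" by blast
  have "((\<lambda>z. inverse z * (z * (H z $$ (i, j) - cmat D $$ (i, j))) + cmat D $$ (i, j)) \<longlongrightarrow>
     0 * ?L + cmat D $$ (i, j)) at_infinity"
    by (intro tendsto_intros tendsto_inverse_0 L)
  moreover have "eventually (\<lambda>z. H z $$ (i, j) =
      inverse z * (z * (H z $$ (i, j) - cmat D $$ (i, j))) + cmat D $$ (i, j)) at_infinity"
  proof -
    have "eventually (\<lambda>z::complex. z \<noteq> 0) at_infinity"
      unfolding eventually_at_infinity by (rule exI[of _ 1]) auto
    then show ?thesis by eventually_elim (simp add: field_simps)
  qed
  ultimately show "((\<lambda>z. H z $$ (i, j)) \<longlongrightarrow> cmat D $$ (i, j)) at_infinity"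
    by (simp add: tendsto_cong)
qed

lemma not_ev_cnj: "\<not> ev (cnj z) \<longleftrightarrow> \<not> ev z"
  using eigenvalue_cnj[OF A, of z] eigenvalue_cnj[OF A, of "cnj z"] by auto

lemma H_cnj:
  assumes z: "\<not> ev z" and y: "y \<in> carrier_vec m"
  shows "H (cnj z) *\<^sub>v conjugate y = conjugate (H z *\<^sub>v y)"
proof -
  have By: "cmat B *\<^sub>v y \<in> carrier_vec n" using y by (auto intro!: mult_mat_vec_carrier)
  have x: "R z *\<^sub>v (cmat B *\<^sub>v y) \<in> carrier_vec n"
    using resolvent_solves(1)[OF cmat_carrier(1) z By] .
  have "conjugate (H z *\<^sub>v y) = conjugate (cmat C *\<^sub>v (R z *\<^sub>v (cmat B *\<^sub>v y))) + conjugate (cmat D *\<^sub>v y)"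
    unfolding H_apply[OF z y] using x y by (intro conjugate_add_vec[of _ m] mult_mat_vec_carrier[of _ m n] mult_mat_vec_carrier[of _ m m]) auto
  also have "conjugate (cmat C *\<^sub>v (R z *\<^sub>v (cmat B *\<^sub>v y))) = cmat C *\<^sub>v (R (cnj z) *\<^sub>v (cmat B *\<^sub>v conjugate y))"
    unfolding conjugate_cmat_mult_vec[OF C x] resolvent_cnj[OF A z By, symmetric]
      conjugate_cmat_mult_vec[OF B y] ..
  also have "conjugate (cmat D *\<^sub>v y) = cmat D *\<^sub>v conjugate y"
    by (rule conjugate_cmat_mult_vec[OF D y])
  finally show ?thesis using H_apply[of "cnj z" "conjugate y"] z y not_ev_cnj by simp
qed

lemma T_carrier [simp]: "T z \<in> carrier_mat m m"
  by (auto simp: transfer_function_def)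

lemma T_entry: "i < m \<Longrightarrow> j < m \<Longrightarrow> T z $$ (i, j) = remove_sings (\<lambda>z. H z $$ (i, j)) z"
  by (auto simp: transfer_function_def)

lemma T_eq_H:
  assumes z: "\<not> ev z" shows "T z = H z"
proof (rule eq_matI)
  fix i j assume "i < dim_row (H z)" "j < dim_col (H z)"
  then have ij: "i < m" "j < m" using carrier_matD[OF H_carrier[of z]] by auto
  have "(\<lambda>z. H z $$ (i, j)) analytic_on {z}"
    unfolding analytic_at using H_holomorphic[OF ij] open_not_ev z by blast
  then show "T z $$ (i, j) = H z $$ (i, j)" unfolding T_entry[OF ij] by simp
qed (use carrier_matD[OF H_carrier[of z]] carrier_matD[OF T_carrier[of z]] in auto)

lemma eventually_T_eq_H: "eventually (\<lambda>z. T z = H z) (at s)" "eventually (\<lambda>z. T z = H z) at_infinity"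
proof -
  show "eventually (\<lambda>z. T z = H z) (at s)"
    using eventually_not_ev(1)[of s] by eventually_elim (simp add: T_eq_H)
  show "eventually (\<lambda>z. T z = H z) at_infinity"
    using eventually_not_ev(2) by eventually_elim (simp add: T_eq_H)
qed

text \<open>An eigenvalue of A can be a removable singularity of an entry. There \<open>H\<close>
  has no meaningful value, while \<open>T\<close> carries the limit; meromorphy leaves a pole as the
  only alternative to a limit.\<close>

lemma T_tendsto:
  assumes ij: "i < m" "j < m" and np: "\<not> is_pole (\<lambda>z. T z $$ (i, j)) s"
  shows "((\<lambda>z. H z $$ (i, j)) \<longlongrightarrow> T s $$ (i, j)) (at s)"
proof -
  have cong: "eventually (\<lambda>z. T z $$ (i, j) = H z $$ (i, j)) (at s)"
    using eventually_T_eq_H(1)[of s] by eventually_elim simp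
  have "(\<lambda>z. H z $$ (i, j)) meromorphic_on {s}"
    using H_meromorphic[OF ij] meromorphic_on_subset by blast
  then have "not_essential (\<lambda>z. H z $$ (i, j)) s" by (simp add: meromorphic_at_iff)
  moreover have "\<not> is_pole (\<lambda>z. H z $$ (i, j)) s"
    using np is_pole_cong[OF cong refl] by simp
  ultimately obtain x where x: "((\<lambda>z. H z $$ (i, j)) \<longlongrightarrow> x) (at s)"
    unfolding not_essential_def by blast
  then have "remove_sings (\<lambda>z. H z $$ (i, j)) s = x" by (rule remove_sings_eqI)
  with x show ?thesis using T_entry[OF ij] by simp
qed

lemma has_pole_T_imp_ev:
  assumes "has_pole m T s" shows "ev s"
proof (rule ccontr)
  assume s: "\<not> ev s"
  obtain i j where ij: "i < m" "j < m" and p: "is_pole (\<lambda>z. T z $$ (i, j)) s"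
    using assms by (auto simp: has_pole_def)
  have "is_pole (\<lambda>z. H z $$ (i, j)) s"
  proof -
    have cong: "eventually (\<lambda>z. T z $$ (i, j) = H z $$ (i, j)) (at s)"
      using eventually_T_eq_H(1)[of s] by eventually_elim simp
    show ?thesis using p is_pole_cong[OF cong refl] by simp
  qed
  moreover have "isCont (\<lambda>z. H z $$ (i, j)) s"
    using H_holomorphic[OF ij] open_not_ev s
    by (metis ComplI continuous_on_eq_continuous_at holomorphic_on_imp_continuous_on mem_Collect_eq)
  ultimately show False
    unfolding is_pole_def isCont_def
    using not_tendsto_and_filterlim_at_infinity[of "at s"] by (simp add: at_neq_bot)
qed

end

section \<open>Controllability and observability of minimal realizations\<close>

text \<open>The controllable subspace, that is the span of the columns of all A^k B, given by its
  closure rules. Rule induction over them does the work usually done with the controllability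
  matrix.\<close>

inductive_set reachable :: "'a :: field mat \<Rightarrow> 'a mat \<Rightarrow> 'a vec set" for A B where
  zero: "0\<^sub>v (dim_row A) \<in> reachable A B"
| col: "j < dim_col B \<Longrightarrow> col B j \<in> reachable A B"
| step: "x \<in> reachable A B \<Longrightarrow> A *\<^sub>v x \<in> reachable A B"
| comb: "x \<in> reachable A B \<Longrightarrow> y \<in> reachable A B \<Longrightarrow> x + c \<cdot>\<^sub>v y \<in> reachable A B"

lemma reachable_carrier:
  assumes "A \<in> carrier_mat n n" "B \<in> carrier_mat n m" "x \<in> reachable A B"
  shows "x \<in> carrier_vec n"
  using assms(3) by induction (use assms(1,2) in \<open>auto intro!: mult_mat_vec_carrier\<close>)

text \<open>Padding with zero rows gives a square matrix whose transpose kills the unit vector of a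
  padded row, so its determinant vanishes and it has a kernel vector.\<close>

lemma wide_mat_kernel:
  fixes T :: "'a :: field mat"
  assumes T: "T \<in> carrier_mat n r" and "n < r"
  shows "\<exists>v \<in> carrier_vec r. v \<noteq> 0\<^sub>v r \<and> T *\<^sub>v v = 0\<^sub>v n"
proof -
  define M where "M = Matrix.mat r r (\<lambda>(i, j). if i < n then T $$ (i, j) else 0)"
  have M: "M \<in> carrier_mat r r" by (simp add: M_def)
  have "M\<^sup>T *\<^sub>v unit_vec r n = 0\<^sub>v r"
    using assms by (intro eq_vecI) (auto simp: M_def)
  moreover have "unit_vec r n \<noteq> (0\<^sub>v r :: 'a vec)" using assms by simp
  ultimately have "det M\<^sup>T = 0"
    using det_0_iff_vec_prod_zero_field[of "M\<^sup>T" r] M by (auto intro!: exI[of _ "unit_vec r n"])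
  then have "det M = 0" using det_transpose[OF M] by simp
  then obtain v where v: "v \<in> carrier_vec r" "v \<noteq> 0\<^sub>v r" "M *\<^sub>v v = 0\<^sub>v r"
    using det_0_iff_vec_prod_zero_field[OF M] by blast
  have "(T *\<^sub>v v) $ i = (M *\<^sub>v v) $ i" if "i < n" for i
    using that assms v(1) by (auto simp: M_def scalar_prod_def)
  then have "T *\<^sub>v v = 0\<^sub>v n" using v assms by (intro eq_vecI) auto
  with v show ?thesis by blast
qed

text \<open>The columns of \<open>T\<close> are a largest independent family in \<open>S\<close>;
  the number of columns is at most n by \<open>wide_mat_kernel\<close>. Maximality makes them span
  \<open>S\<close>. With n columns the matrix is invertible, so \<open>S\<close> is the whole
  space.\<close>

lemma subspace_basis_mat:
  fixes S :: "'a :: field vec set"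
  assumes S: "S \<subseteq> carrier_vec n" "0\<^sub>v n \<in> S" "\<And>x y c. x \<in> S \<Longrightarrow> y \<in> S \<Longrightarrow> x + c \<cdot>\<^sub>v y \<in> S"
  obtains r T where "T \<in> carrier_mat n r" "r \<le> n" "\<And>x. x \<in> S \<Longrightarrow> \<exists>v \<in> carrier_vec r. T *\<^sub>v v = x"
    "\<And>j. j < r \<Longrightarrow> col T j \<in> S" "r = n \<Longrightarrow> S = carrier_vec n"
proof -
  define P where "P r T \<longleftrightarrow> T \<in> carrier_mat n r \<and> (\<forall>j<r. col T j \<in> S) \<and>
    (\<forall>v \<in> carrier_vec r. T *\<^sub>v v = 0\<^sub>v n \<longrightarrow> v = 0\<^sub>v r)" for r T
  have bound: "r \<le> n" if "\<exists>T. P r T" for r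
    using that wide_mat_kernel[of _ n r] unfolding P_def by (meson not_le)
  have "P 0 (0\<^sub>m n 0)" by (auto simp: P_def)
  then have "\<exists>r. (\<exists>T. P r T) \<and> (\<forall>k. (\<exists>T. P k T) \<longrightarrow> k \<le> r)"
    using bound by (intro ex_has_greatest_nat[where f = id, simplified, of _ 0 "Suc n"]) (auto simp: less_Suc_eq_le)
  then obtain r T where PT: "P r T" and max: "\<And>k T. P k T \<Longrightarrow> k \<le> r" by blast
  have T: "T \<in> carrier_mat n r" and colT: "\<And>j. j < r \<Longrightarrow> col T j \<in> S"
    and inj: "\<And>v. v \<in> carrier_vec r \<Longrightarrow> T *\<^sub>v v = 0\<^sub>v n \<Longrightarrow> v = 0\<^sub>v r"
    using PT by (auto simp: P_def)
  have rn: "r \<le> n" using PT bound by blast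
  have span: "\<exists>v \<in> carrier_vec r. T *\<^sub>v v = x" if x: "x \<in> S" for x
  proof (rule ccontr)
    assume no: "\<not> ?thesis"
    have xc: "x \<in> carrier_vec n" using S x by blast
    \<comment> \<open>Appending x as a last column keeps independence: in a relation T' v = 0, a
      nonzero last coefficient would express x through the columns of \<open>T\<close>. This
      contradicts maximality.\<close>
    define T' where "T' = Matrix.mat n (Suc r) (\<lambda>(i, j). if j < r then T $$ (i, j) else x $ i)"
    have T': "T' \<in> carrier_mat n (Suc r)" by (simp add: T'_def)
    have "P (Suc r) T'"
      unfolding P_def
    proof (intro conjI ballI impI allI T')
      fix j assume j: "j < Suc r"
      show "col T' j \<in> S"
      proof (cases "j < r")
        case True
        then have "col T' j = col T j" using T by (intro eq_vecI) (auto simp: T'_def)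
        then show ?thesis using colT True by simp
      next
        case False
        then have "col T' j = x" using xc j by (intro eq_vecI) (auto simp: T'_def)
        then show ?thesis using x by simp
      qed
    next
      fix v assume v: "v \<in> carrier_vec (Suc r)" and z: "T' *\<^sub>v v = 0\<^sub>v n"
      define u where "u = vec r (\<lambda>i. v $ i)"
      have u: "u \<in> carrier_vec r" by (simp add: u_def)
      have e: "(T *\<^sub>v u) $ i + v $ r * x $ i = 0" if i: "i < n" for i
      proof -
        have "(T' *\<^sub>v v) $ i = 0" using z i by simp
        then show ?thesis using i v T by (simp add: T'_def u_def scalar_prod_def mult.commute)
      qed
      have v0: "v $ r = 0"
      proof (rule ccontr)
        assume v0: "v $ r \<noteq> 0"
        have "T *\<^sub>v ((- 1 / v $ r) \<cdot>\<^sub>v u) = x"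
        proof (rule eq_vecI)
          fix i assume "i < dim_vec x"
          then have i: "i < n" using xc by simp
          have "(T *\<^sub>v ((- 1 / v $ r) \<cdot>\<^sub>v u)) $ i = (- 1 / v $ r) * (T *\<^sub>v u) $ i"
            using T u i by (simp add: mult_mat_vec)
          moreover have "x $ i = (- 1 / v $ r) * (T *\<^sub>v u) $ i"
            using e[OF i] v0 by (simp add: field_simps add_eq_0_iff)
          ultimately show "(T *\<^sub>v ((- 1 / v $ r) \<cdot>\<^sub>v u)) $ i = x $ i" by simp
        qed (use T xc in auto)
        then show False using no u by (metis smult_carrier_vec)
      qed
      then have "T *\<^sub>v u = 0\<^sub>v n" using e T by (intro eq_vecI) auto
      then have "u = 0\<^sub>v r" using inj u by blast
      then have "v $ i = 0" if "i < r" for i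
        using that unfolding u_def by (metis index_vec index_zero_vec(1))
      with v0 show "v = 0\<^sub>v (Suc r)" using v by (intro eq_vecI) (auto simp: less_Suc_eq)
    qed
    then show False using max by fastforce
  qed
  have range: "T *\<^sub>v v \<in> S" if v: "v \<in> carrier_vec r" for v
  proof -
    \<comment> \<open>\<open>w k\<close> keeps the first k coordinates of v. Passing from k to k + 1
      adds a multiple of one column, which is exactly the closure rule of \<open>S\<close>.\<close>
    define w where "w k = vec r (\<lambda>j. if j < k then v $ j else 0)" for k
    have "T *\<^sub>v w k \<in> S" if "k \<le> r" for k
      using that
    proof (induction k)
      case 0
      have "w 0 = 0\<^sub>v r" by (auto simp: w_def)
      then have "T *\<^sub>v w 0 = 0\<^sub>v n" using T by auto
      then show ?case using S by simp
    next
      case (Suc k)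
      have "w (Suc k) = w k + v $ k \<cdot>\<^sub>v unit_vec r k"
        using Suc.prems by (intro eq_vecI) (auto simp: w_def less_Suc_eq)
      moreover have "T *\<^sub>v unit_vec r k = col T k"
        using T Suc.prems by (intro eq_vecI) auto
      ultimately have "T *\<^sub>v w (Suc k) = T *\<^sub>v w k + v $ k \<cdot>\<^sub>v col T k"
        using T by (simp add: mult_add_distrib_mat_vec[of _ n r] mult_mat_vec w_def)
      then show ?case using Suc S(3) colT by simp
    qed
    moreover have "w r = v" using v by (auto simp: w_def)
    ultimately show ?thesis by fastforce
  qed
  show ?thesis
  proof (rule that[OF T rn span colT])
    assume r: "r = n"
    have "det T \<noteq> 0" using det_0_iff_vec_prod_zero_field[of T n] T inj r by blast
    note I = inv_mat_det[of T n, OF _ this]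
    have "x \<in> S" if x: "x \<in> carrier_vec n" for x
    proof -
      have "T *\<^sub>v (inv_mat T *\<^sub>v x) = x"
        using assoc_mult_mat_vec[of T n n "inv_mat T" n x] I T r x by simp
      moreover have "inv_mat T *\<^sub>v x \<in> carrier_vec r" using I T r x by auto
      ultimately show ?thesis using range by metis
    qed
    then show "S = carrier_vec n" using S by blast
  qed
qed

lemma mat_factor_through:
  fixes M :: "'a :: comm_ring_1 mat"
  assumes M: "M \<in> carrier_mat n k" and T: "T \<in> carrier_mat n r"
    and ex: "\<And>j. j < k \<Longrightarrow> \<exists>v \<in> carrier_vec r. T *\<^sub>v v = col M j"
  shows "\<exists>N \<in> carrier_mat r k. T * N = M"
proof -
  obtain f where f: "\<And>j. j < k \<Longrightarrow> f j \<in> carrier_vec r \<and> T *\<^sub>v f j = col M j" using ex by metis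
  define N where "N = Matrix.mat r k (\<lambda>(i, j). f j $ i)"
  have N: "N \<in> carrier_mat r k" by (simp add: N_def)
  have "T * N = M"
  proof (rule mat_col_eqI)
    fix j assume "j < dim_col M"
    then have j: "j < k" using M by simp
    have "col N j = f j" using f[OF j] j by (intro eq_vecI) (auto simp: N_def)
    then show "col (T * N) j = col M j" using col_mult2[OF T N j] f[OF j] by simp
  qed (use T N M in auto)
  with N show ?thesis by blast
qed

text \<open>M T = T N passes to inverses. It is used twice: to intertwine the resolvents of a system
  and its reduction, and, with T the identity, as uniqueness of inverses.\<close>

lemma intertwining_inverse:
  fixes M :: "'a :: comm_ring_1 mat"
  assumes M: "M \<in> carrier_mat n n" and N: "N \<in> carrier_mat r r" and T: "T \<in> carrier_mat n r"
    and M': "M' \<in> carrier_mat n n" and N': "N' \<in> carrier_mat r r"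
    and inv: "M' * M = 1\<^sub>m n" "N * N' = 1\<^sub>m r" and MT: "M * T = T * N"
  shows "M' * T = T * N'"
proof -
  have TN: "T * N' \<in> carrier_mat n r" using T N' by simp
  have "M' * T = M' * (T * (N * N'))" unfolding inv using T by simp
  also have "T * (N * N') = M * (T * N')"
    unfolding assoc_mult_mat[OF T N N', symmetric] MT[symmetric] by (rule assoc_mult_mat[OF M T N'])
  also have "M' * (M * (T * N')) = T * N'"
    unfolding assoc_mult_mat[OF M' M TN, symmetric] inv by (rule left_mult_one_mat[OF TN])
  finally show ?thesis .
qed

context state_space begin

text \<open>\<open>T'\<close> intertwines the two state matrices, hence their resolvents off both
  spectra, and there C R B is unchanged. The exceptional points are finitely many, and
  \<open>remove_sings\<close> sees only punctured neighbourhoods.\<close>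

lemma transfer_function_reduced:
  assumes T: "T' \<in> carrier_mat n r" and A': "A' \<in> carrier_mat r r" and B': "B' \<in> carrier_mat r m"
    and AT: "A * T' = T' * A'" and BT: "T' * B' = B"
  shows "transfer_function A' B' (C * T') D = T"
proof -
  interpret red: state_space r m A' B' "C * T'" D
    using A' B' T C by unfold_locales (auto intro!: mult_carrier_mat)
  have cT: "cmat T' \<in> carrier_mat n r" using T by simp
  have cA: "cmat A * cmat T' = cmat T' * cmat A'"
    using of_real_hom.mat_hom_mult[OF A T] of_real_hom.mat_hom_mult[OF T A'] AT by metis
  have cB: "cmat T' * cmat B' = cmat B"
    using of_real_hom.mat_hom_mult[OF T B'] BT by metis
  have eq: "state_space_eval A' B' (C * T') D z = H z" if z: "\<not> ev z" and z': "\<not> eigenvalue (cmat A') z" for z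
  proof -
    note R = resolvent[OF cmat_carrier(1) z] and R' = resolvent[OF red.cmat_carrier(1) z']
    let ?M = "z \<cdot>\<^sub>m 1\<^sub>m n - cmat A" and ?M' = "z \<cdot>\<^sub>m 1\<^sub>m r - cmat A'" and ?R' = "resolvent (cmat A') z"
    have M: "?M \<in> carrier_mat n n" "?M' \<in> carrier_mat r r" using cmat_carrier red.cmat_carrier by auto
    have MT: "?M * cmat T' = cmat T' * ?M'"
      using cA cT M cmat_carrier red.cmat_carrier
      by (simp add: minus_mult_distrib_mat[of _ n n _ _ r] mult_minus_distrib_mat[of _ n r _ r]
        mult_smult_assoc_mat[of _ n n _ r] mult_smult_distrib[of _ n r _ r])
    have RT: "R z * cmat T' = cmat T' * ?R'"
      by (rule intertwining_inverse[OF M cT R(1) R'(1) R(3) R'(2) MT])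
    have "cmat (C * T') * ?R' * cmat B' = cmat C * (cmat T' * ?R') * cmat B'"
      unfolding of_real_hom.mat_hom_mult[OF C T]
      using cT R' cmat_carrier by (simp add: assoc_mult_mat[of _ m n _ r _ r])
    also have "\<dots> = cmat C * (R z * cmat T') * cmat B'" unfolding RT ..
    also have "\<dots> = cmat C * R z * (cmat T' * cmat B')"
      using cT R(1) cmat_carrier red.cmat_carrier
      by (simp add: assoc_mult_mat[of _ m n _ n _ r, symmetric] assoc_mult_mat[of _ m n _ r _ m]
       mult_carrier_mat[of _ m n _ n])
    also have "\<dots> = cmat C * R z * cmat B" unfolding cB ..
    finally show ?thesis unfolding H_def red.H_def by simp
  qed
  have "remove_sings (\<lambda>z. state_space_eval A' B' (C * T') D z $$ (i, j)) s = remove_sings (\<lambda>z. H z $$ (i, j)) s"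
    for i j s
  proof (rule remove_sings_cong[OF _ refl])
    show "eventually (\<lambda>z. state_space_eval A' B' (C * T') D z $$ (i, j) = H z $$ (i, j)) (at s)"
      using eventually_not_ev(1)[of s] red.eventually_not_ev(1)[of s] by eventually_elim (simp add: eq)
  qed
  then show ?thesis by (simp add: transfer_function_def fun_eq_iff)
qed

end

lemma minimal_imp_state_space:
  assumes "minimal_realization m n A B C D G"
  shows "state_space n m A B C D" "G = transfer_function A B C D"
  using assms by (auto simp: minimal_realization_def realization_def state_space_def)

text \<open>Kalman reduction: the reachable subspace is invariant under A and contains the columns
  of B, so restricting the system to it gives a realization of the same G whose dimension is that of
  the subspace. Minimality leaves no room for a proper subspace.\<close>

lemma minimal_reachable:
  assumes min: "minimal_realization m n A B C D G"
  shows "reachable A B = carrier_vec n"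
proof -
  interpret state_space n m A B C D by (rule minimal_imp_state_space(1)[OF min])
  have sub: "reachable A B \<subseteq> carrier_vec n" using reachable_carrier[OF A B] by blast
  have zero: "0\<^sub>v n \<in> reachable A B" using reachable.zero[of A B] by simp
  obtain r T' where T: "T' \<in> carrier_mat n r" "r \<le> n"
    and span: "\<And>x. x \<in> reachable A B \<Longrightarrow> \<exists>v \<in> carrier_vec r. T' *\<^sub>v v = x"
    and inS: "\<And>j. j < r \<Longrightarrow> col T' j \<in> reachable A B"
    and full: "r = n \<Longrightarrow> reachable A B = carrier_vec n"
  proof (rule subspace_basis_mat[OF sub zero reachable.comb])
    fix r T
    assume "T \<in> carrier_mat n r" "r \<le> n" "\<And>x. x \<in> reachable A B \<Longrightarrow> \<exists>v \<in> carrier_vec r. T *\<^sub>v v = x"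
      "\<And>j. j < r \<Longrightarrow> col T j \<in> reachable A B" "r = n \<Longrightarrow> reachable A B = carrier_vec n"
    then show thesis by (rule that)
  qed
  have "\<exists>v \<in> carrier_vec r. T' *\<^sub>v v = col B j" if "j < m" for j
    using span[OF reachable.col[of j B A]] that by simp
  from mat_factor_through[OF B T(1) this]
  obtain B' where B': "B' \<in> carrier_mat r m" "T' * B' = B" by blast
  obtain A' where A': "A' \<in> carrier_mat r r" "T' * A' = A * T'"
  proof -
    have ex: "\<exists>v \<in> carrier_vec r. T' *\<^sub>v v = col (A * T') j" if "j < r" for j
      using span[OF reachable.step[OF inS[OF that]]] col_mult2[OF A T(1) that] by simp
    have "A * T' \<in> carrier_mat n r" by (rule mult_carrier_mat[OF A T(1)])
    from mat_factor_through[OF this T(1) ex] show ?thesis using that by blast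
  qed
  have "transfer_function A' B' (C * T') D = T"
    using transfer_function_reduced[OF T(1) A'(1) B'(1) A'(2)[symmetric] B'(2)] .
  then have "realization m r A' B' (C * T') D G"
    using minimal_imp_state_space(2)[OF min] A' B' T by (auto simp: realization_def intro!: mult_carrier_mat)
  then have "n \<le> r" using min unfolding minimal_realization_def by blast
  then show ?thesis using T(2) full by simp
qed

section \<open>Duality: observability from reachability of the transposed system\<close>

context state_space begin

lemma transpose_state_space: "state_space n m A\<^sup>T C\<^sup>T B\<^sup>T D\<^sup>T"
  by unfold_locales auto

lemma transfer_function_transpose: "transfer_function A\<^sup>T C\<^sup>T B\<^sup>T D\<^sup>T z = (T z)\<^sup>T"
proof (rule eq_matI)
  interpret tr: state_space n m "A\<^sup>T" "C\<^sup>T" "B\<^sup>T" "D\<^sup>T" by (rule transpose_state_space)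
  have ev: "eigenvalue (cmat A\<^sup>T) z \<longleftrightarrow> ev z" for z
    using eigenvalue_root_char_poly[OF cmat_carrier(1)] eigenvalue_root_char_poly[OF tr.cmat_carrier(1)]
      char_poly_transpose_mat[OF cmat_carrier(1)] by (simp add: map_mat_transpose)
  have H: "state_space_eval A\<^sup>T C\<^sup>T B\<^sup>T D\<^sup>T z = (H z)\<^sup>T" if z: "\<not> ev z" for z
  proof -
    note R = resolvent[OF cmat_carrier(1) z]
    have z': "\<not> eigenvalue (cmat A\<^sup>T) z" using z ev by simp
    note R' = resolvent[OF tr.cmat_carrier(1) z']
    let ?M = "z \<cdot>\<^sub>m 1\<^sub>m n - cmat A\<^sup>T"
    have M: "?M \<in> carrier_mat n n" using tr.cmat_carrier by auto
    have "?M = (z \<cdot>\<^sub>m 1\<^sub>m n - cmat A)\<^sup>T" by (intro eq_matI) auto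
    then have "?M * (R z)\<^sup>T = (R z * (z \<cdot>\<^sub>m 1\<^sub>m n - cmat A))\<^sup>T"
      using R(1) M by (subst transpose_mult[of _ n n _ n]) auto
    then have MR: "?M * (R z)\<^sup>T = 1\<^sub>m n" unfolding R by simp
    \<comment> \<open>Uniqueness of the inverse, obtained by intertwining with the identity
      matrix.\<close>
    have "resolvent (cmat A\<^sup>T) z * 1\<^sub>m n = 1\<^sub>m n * (R z)\<^sup>T"
    proof (rule intertwining_inverse[OF M M _ R'(1) _ R'(3) MR])
      show "?M * 1\<^sub>m n = 1\<^sub>m n * ?M" unfolding left_mult_one_mat[OF M] right_mult_one_mat[OF M] ..
    qed (use R in auto)
    moreover have "(R z)\<^sup>T \<in> carrier_mat n n" using R by simp
    ultimately have RT: "resolvent (cmat A\<^sup>T) z = (R z)\<^sup>T"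
      using R'(1) left_mult_one_mat right_mult_one_mat by metis
    have CR: "cmat C * R z \<in> carrier_mat m n" using R cmat_carrier by auto
    have "(H z)\<^sup>T = (cmat C * R z * cmat B)\<^sup>T + (cmat D)\<^sup>T"
      unfolding H_def by (rule transpose_add[OF mult_carrier_mat[OF CR cmat_carrier(2)] cmat_carrier(4)])
    also have "(cmat C * R z * cmat B)\<^sup>T = (cmat B)\<^sup>T * (cmat C * R z)\<^sup>T"
      by (rule transpose_mult[OF CR cmat_carrier(2)])
    also have "(cmat C * R z)\<^sup>T = (R z)\<^sup>T * (cmat C)\<^sup>T"
      by (rule transpose_mult[OF cmat_carrier(3) R(1)])
    also have "(cmat B)\<^sup>T * ((R z)\<^sup>T * (cmat C)\<^sup>T) = (cmat B)\<^sup>T * (R z)\<^sup>T * (cmat C)\<^sup>T"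
      using R by (intro assoc_mult_mat[symmetric, of _ m n _ n _ m]) auto
    finally show ?thesis unfolding tr.H_def RT by (simp add: map_mat_transpose)
  qed
  fix i j assume "i < dim_row ((T z)\<^sup>T)" "j < dim_col ((T z)\<^sup>T)"
  then have ij: "i < m" "j < m" using carrier_matD[OF T_carrier[of z]] by auto
  have "eventually (\<lambda>w. state_space_eval A\<^sup>T C\<^sup>T B\<^sup>T D\<^sup>T w $$ (i, j) = H w $$ (j, i)) (at z)"
    using eventually_not_ev(1)[of z]
    by eventually_elim (use ij carrier_matD[OF H_carrier] in \<open>simp add: H\<close>)
  then show "transfer_function A\<^sup>T C\<^sup>T B\<^sup>T D\<^sup>T z $$ (i, j) = (T z)\<^sup>T $$ (i, j)"
    using ij carrier_matD[OF T_carrier[of z]] by (simp add: tr.T_entry T_entry remove_sings_cong)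
qed (use carrier_matD[OF T_carrier[of z]] in \<open>auto simp: transfer_function_def\<close>)

end

lemma realization_transpose:
  assumes "realization m n A B C D G"
  shows "realization m n A\<^sup>T C\<^sup>T B\<^sup>T D\<^sup>T (\<lambda>z. (G z)\<^sup>T)"
proof -
  have "state_space n m A B C D" using assms by (simp add: realization_def state_space_def)
  then show ?thesis using assms
    by (simp add: realization_def state_space.transfer_function_transpose fun_eq_iff)
qed

lemma minimal_realization_transpose:
  assumes min: "minimal_realization m n A B C D G"
  shows "minimal_realization m n A\<^sup>T C\<^sup>T B\<^sup>T D\<^sup>T (\<lambda>z. (G z)\<^sup>T)"
  unfolding minimal_realization_def
proof (intro conjI allI impI)
  show "realization m n A\<^sup>T C\<^sup>T B\<^sup>T D\<^sup>T (\<lambda>z. (G z)\<^sup>T)"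
    using min by (intro realization_transpose) (simp add: minimal_realization_def)
  fix n' A' B' C' D' assume "realization m n' A' B' C' D' (\<lambda>z. (G z)\<^sup>T)"
  from realization_transpose[OF this] show "n \<le> n'"
    using min unfolding minimal_realization_def by fastforce
qed

text \<open>If C x = 0 and x is an eigenvector, then the real vectors w with w . x = 0 include the
  rows of C and are closed under the transpose of A. By reachability of the transposed system they
  are all real vectors, unit vectors included. The product is bilinear, since w is real and only x
  is complex.\<close>

lemma minimal_observable:
  assumes min: "minimal_realization m n A B C D G"
    and x: "x \<in> carrier_vec n" and Ax: "cmat A *\<^sub>v x = s \<cdot>\<^sub>v x" and Cx: "cmat C *\<^sub>v x = 0\<^sub>v m"
  shows "x = 0\<^sub>v n"
proof -
  interpret state_space n m A B C D by (rule minimal_imp_state_space(1)[OF min])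
  have reach: "reachable A\<^sup>T C\<^sup>T = carrier_vec n"
    by (rule minimal_reachable[OF minimal_realization_transpose[OF min]])
  have zero: "map_vec complex_of_real w \<bullet> x = 0" if "w \<in> reachable A\<^sup>T C\<^sup>T" for w
    using that
  proof (induction w)
    case zero
    then show ?case using x by (simp add: of_real_hom.vec_hom_zero)
  next
    case (col j)
    have "map_vec complex_of_real (col C\<^sup>T j) \<bullet> x = (cmat C *\<^sub>v x) $ j"
      using col x by (simp add: scalar_prod_def)
    then show ?case using Cx col by simp
  next
    case (step w)
    have w: "w \<in> carrier_vec n" using step reach by simp
    have "map_vec complex_of_real (A\<^sup>T *\<^sub>v w) = (cmat A)\<^sup>T *\<^sub>v map_vec complex_of_real w"
      using of_real_hom.mult_mat_vec_hom[of "A\<^sup>T" n n w] w by (simp add: map_mat_transpose)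
    moreover have "((cmat A)\<^sup>T *\<^sub>v map_vec complex_of_real w) \<bullet> x = map_vec complex_of_real w \<bullet> (cmat A *\<^sub>v x)"
      using w x by (intro transpose_vec_mult_scalar[of _ n n]) auto
    ultimately show ?case using step Ax w x by simp
  next
    case (comb v w c)
    have "v \<in> carrier_vec n" "w \<in> carrier_vec n" using comb reach by auto
    then show ?case using comb x
      by (simp add: scalar_prod_def sum.distrib distrib_right sum_distrib_left[symmetric] mult.assoc)
  qed
  show ?thesis
  proof (rule eq_vecI)
    fix i assume "i < dim_vec (0\<^sub>v n :: complex vec)"
    then have i: "i < n" by simp
    have "map_vec complex_of_real (unit_vec n i) = unit_vec n i" by (auto simp: unit_vec_def)
    then have "unit_vec n i \<bullet> x = 0" using zero[of "unit_vec n i"] reach by simp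
    then show "x $ i = 0\<^sub>v n $ i" using i x by simp
  qed (use x in simp)
qed

section \<open>The output of an arbitrary state, written through the transfer function\<close>

context state_space begin

text \<open>The closure lemmas below produce coefficients \<open>b\<close> and \<open>r\<close> that
  are polynomial in z. Only continuity is recorded, because the coefficients enter solely through
  limits at a point.\<close>

definition affine_in_H :: "complex vec \<Rightarrow> bool" where
  "affine_in_H x \<longleftrightarrow> (\<exists>b r. (\<forall>j. continuous_on UNIV (b j)) \<and> (\<forall>i. continuous_on UNIV (r i)) \<and>
     (\<forall>z. \<not> ev z \<longrightarrow> (\<forall>i<m. (cmat C *\<^sub>v (R z *\<^sub>v x)) $ i = (\<Sum>j<m. H z $$ (i, j) * b j z) + r i z)))"

lemma affine_in_H_I:
  assumes "\<And>j. continuous_on UNIV (b j)" "\<And>i. continuous_on UNIV (r i)"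
    "\<And>z i. \<not> ev z \<Longrightarrow> i < m \<Longrightarrow> (cmat C *\<^sub>v (R z *\<^sub>v x)) $ i = (\<Sum>j<m. H z $$ (i, j) * b j z) + r i z"
  shows "affine_in_H x"
  unfolding affine_in_H_def using assms by blast

lemma affine_in_H_col:
  assumes j: "j < m" shows "affine_in_H (col (cmat B) j)"
proof (rule affine_in_H_I)
  show "continuous_on UNIV (\<lambda>z::complex. if k = j then 1 else 0 :: complex)" for k by simp
  show "continuous_on UNIV (\<lambda>z::complex. - cmat D $$ (i, j))" for i by simp
  fix z i assume z: "\<not> ev z" and i: "i < m"
  have u: "unit_vec m j \<in> carrier_vec m" by simp
  have c: "M *\<^sub>v unit_vec m j = col M j" if "M \<in> carrier_mat k m" for M :: "complex mat" and k
    using that j by (intro eq_vecI) auto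
  have "col (H z) j = cmat C *\<^sub>v (R z *\<^sub>v (col (cmat B) j)) + col (cmat D) j"
    using H_apply[OF z u] c[OF H_carrier] c[OF cmat_carrier(2)] c[OF cmat_carrier(4)] by simp
  then have "col (H z) j $ i = (cmat C *\<^sub>v (R z *\<^sub>v (col (cmat B) j)) + col (cmat D) j) $ i" by simp
  then have "H z $$ (i, j) = (cmat C *\<^sub>v (R z *\<^sub>v (col (cmat B) j))) $ i + cmat D $$ (i, j)"
    using i j carrier_matD[OF H_carrier[of z]] by simp
  then show "(cmat C *\<^sub>v (R z *\<^sub>v col (cmat B) j)) $ i =
      (\<Sum>k<m. H z $$ (i, k) * (if k = j then 1 else 0)) + - cmat D $$ (i, j)"
    using j by (simp add: if_distrib[of "\<lambda>c. _ * c"] sum.delta cong: if_cong)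
qed

text \<open>The resolvent identity R(z) A x = z R(z) x - x: one more factor A multiplies both
  coefficients by z and subtracts the constant C x from the remainder.\<close>

lemma affine_in_H_step:
  assumes x: "x \<in> carrier_vec n" and "affine_in_H x" shows "affine_in_H (cmat A *\<^sub>v x)"
proof -
  obtain b r where b: "\<And>j. continuous_on UNIV (b j)" "\<And>i. continuous_on UNIV (r i)"
    "\<And>z i. \<not> ev z \<Longrightarrow> i < m \<Longrightarrow> (cmat C *\<^sub>v (R z *\<^sub>v x)) $ i = (\<Sum>j<m. H z $$ (i, j) * b j z) + r i z"
    using assms(2) unfolding affine_in_H_def by blast
  show ?thesis
  proof (rule affine_in_H_I)
    show "continuous_on UNIV (\<lambda>z. z * b j z)" for j by (intro continuous_intros b)
    show "continuous_on UNIV (\<lambda>z. z * r i z - (cmat C *\<^sub>v x) $ i)" for i by (intro continuous_intros b)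
    fix z i assume z: "\<not> ev z" and i: "i < m"
    note R = resolvent_solves[OF cmat_carrier(1) z x]
    have Ax: "cmat A *\<^sub>v (R z *\<^sub>v x) \<in> carrier_vec n" using R by (auto intro!: mult_mat_vec_carrier[of _ n n])
    have "R z *\<^sub>v (cmat A *\<^sub>v x) = z \<cdot>\<^sub>v (R z *\<^sub>v x) - x"
    proof (rule resolvent_unique[OF cmat_carrier(1) z])
      show "z \<cdot>\<^sub>v (R z *\<^sub>v x) - x \<in> carrier_vec n" using R x by auto
      have e: "z \<cdot>\<^sub>v (R z *\<^sub>v x) - x = cmat A *\<^sub>v (R z *\<^sub>v x)"
      proof (rule eq_vecI)
        fix i assume i: "i < dim_vec (cmat A *\<^sub>v (R z *\<^sub>v x))"
        have "(z \<cdot>\<^sub>v (R z *\<^sub>v x) - cmat A *\<^sub>v (R z *\<^sub>v x)) $ i = x $ i" using R by simp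
        then show "(z \<cdot>\<^sub>v (R z *\<^sub>v x) - x) $ i = (cmat A *\<^sub>v (R z *\<^sub>v x)) $ i"
          using i R(1) x Ax by (simp del: index_mult_mat_vec) (metis add_diff_cancel_left' diff_add_cancel)
      qed (use x in simp)
      have "cmat A *\<^sub>v (z \<cdot>\<^sub>v (R z *\<^sub>v x) - x) = z \<cdot>\<^sub>v (cmat A *\<^sub>v (R z *\<^sub>v x)) - cmat A *\<^sub>v x"
        using R x by (subst mult_minus_distrib_mat_vec[of _ n n]) (auto simp: mult_mat_vec[of _ n n])
      then show "z \<cdot>\<^sub>v (z \<cdot>\<^sub>v (R z *\<^sub>v x) - x) - cmat A *\<^sub>v (z \<cdot>\<^sub>v (R z *\<^sub>v x) - x) = cmat A *\<^sub>v x"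
        unfolding e using Ax x by (intro eq_vecI) auto
    qed
    then have "cmat C *\<^sub>v (R z *\<^sub>v (cmat A *\<^sub>v x)) = z \<cdot>\<^sub>v (cmat C *\<^sub>v (R z *\<^sub>v x)) - cmat C *\<^sub>v x"
      using R x by (simp add: mult_minus_distrib_mat_vec[of _ m n] mult_mat_vec[of _ m n])
    then have "(cmat C *\<^sub>v (R z *\<^sub>v (cmat A *\<^sub>v x))) $ i = z * (cmat C *\<^sub>v (R z *\<^sub>v x)) $ i - (cmat C *\<^sub>v x) $ i"
      using i by (simp del: index_mult_mat_vec)
    then show "(cmat C *\<^sub>v (R z *\<^sub>v (cmat A *\<^sub>v x))) $ i =
      (\<Sum>j<m. H z $$ (i, j) * (z * b j z)) + (z * r i z - (cmat C *\<^sub>v x) $ i)"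
      unfolding b(3)[OF z i] by (simp add: algebra_simps sum_distrib_left del: index_mult_mat_vec)
  qed
qed

lemma affine_in_H_comb:
  assumes x: "x \<in> carrier_vec n" "y \<in> carrier_vec n" and "affine_in_H x" "affine_in_H y"
  shows "affine_in_H (x + c \<cdot>\<^sub>v y)"
proof -
  obtain b r where b: "\<And>j. continuous_on UNIV (b j)" "\<And>i. continuous_on UNIV (r i)"
    "\<And>z i. \<not> ev z \<Longrightarrow> i < m \<Longrightarrow> (cmat C *\<^sub>v (R z *\<^sub>v x)) $ i = (\<Sum>j<m. H z $$ (i, j) * b j z) + r i z"
    using assms(3) unfolding affine_in_H_def by blast
  obtain b' r' where b': "\<And>j. continuous_on UNIV (b' j)" "\<And>i. continuous_on UNIV (r' i)"
    "\<And>z i. \<not> ev z \<Longrightarrow> i < m \<Longrightarrow> (cmat C *\<^sub>v (R z *\<^sub>v y)) $ i = (\<Sum>j<m. H z $$ (i, j) * b' j z) + r' i z"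
    using assms(4) unfolding affine_in_H_def by blast
  show ?thesis
  proof (rule affine_in_H_I)
    show "continuous_on UNIV (\<lambda>z. b j z + c * b' j z)" for j by (intro continuous_intros b b')
    show "continuous_on UNIV (\<lambda>z. r i z + c * r' i z)" for i by (intro continuous_intros b b')
    fix z i assume z: "\<not> ev z" and i: "i < m"
    note R = resolvent(1)[OF cmat_carrier(1) z]
    have "cmat C *\<^sub>v (R z *\<^sub>v (x + c \<cdot>\<^sub>v y)) = cmat C *\<^sub>v (R z *\<^sub>v x) + c \<cdot>\<^sub>v (cmat C *\<^sub>v (R z *\<^sub>v y))"
      using R x by (simp add: mult_add_distrib_mat_vec[of _ n n] mult_add_distrib_mat_vec[of _ m n]
        mult_mat_vec[of _ m n] mult_mat_vec[of _ n n] mult_mat_vec_carrier[of _ n n])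
    then show "(cmat C *\<^sub>v (R z *\<^sub>v (x + c \<cdot>\<^sub>v y))) $ i =
      (\<Sum>j<m. H z $$ (i, j) * (b j z + c * b' j z)) + (r i z + c * r' i z)"
      using i b(3)[OF z i] b'(3)[OF z i]
      by (simp add: algebra_simps sum.distrib sum_distrib_left del: index_mult_mat_vec)
  qed
qed

lemma affine_in_H_zero: "affine_in_H (0\<^sub>v n)"
proof (rule affine_in_H_I[of "\<lambda>_ _. 0" "\<lambda>_ _. 0"])
  fix z i assume "\<not> ev z" "i < m"
  then show "(cmat C *\<^sub>v (R z *\<^sub>v 0\<^sub>v n)) $ i = (\<Sum>j<m. H z $$ (i, j) * 0) + 0"
    using resolvent(1)[OF cmat_carrier(1), of z] by (simp add: scalar_prod_def)
qed auto

lemma affine_in_H_reachable: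
  assumes x: "x \<in> reachable A B" shows "affine_in_H (map_vec complex_of_real x)"
  using x
proof induction
  case zero
  then show ?case using affine_in_H_zero by (simp add: of_real_hom.vec_hom_zero)
next
  case (col j)
  have "map_vec complex_of_real (col B j) = col (cmat B) j" using col by (intro eq_vecI) auto
  then show ?case using affine_in_H_col col by simp
next
  case (step x)
  have x: "x \<in> carrier_vec n" using reachable_carrier[OF A B step(1)] .
  show ?case using affine_in_H_step[OF _ step(2)] x by (simp add: of_real_hom.mult_mat_vec_hom[OF A x])
next
  case (comb x y c)
  have x: "x \<in> carrier_vec n" "y \<in> carrier_vec n" using reachable_carrier[OF A B] comb by auto
  have "map_vec complex_of_real (x + c \<cdot>\<^sub>v y) =
    map_vec complex_of_real x + complex_of_real c \<cdot>\<^sub>v map_vec complex_of_real y"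
    using x by (intro eq_vecI) auto
  then show ?case using affine_in_H_comb[OF _ _ comb(3,4)] x by simp
qed

end

locale minimal_state_space = state_space +
  fixes G
  assumes minimal: "minimal_realization m n A B C D G"
begin

lemma G_eq: "G = T" by (rule minimal_imp_state_space(2)[OF minimal])

lemma affine_in_H:
  assumes x: "x \<in> carrier_vec n" shows "affine_in_H x"
proof -
  have "map_vec Re x \<in> reachable A B" "map_vec Im x \<in> reachable A B"
    using minimal_reachable[OF minimal] x by auto
  then have "affine_in_H (map_vec complex_of_real (map_vec Re x) + \<i> \<cdot>\<^sub>v map_vec complex_of_real (map_vec Im x))"
    using x by (intro affine_in_H_comb affine_in_H_reachable) auto
  moreover have "map_vec complex_of_real (map_vec Re x) + \<i> \<cdot>\<^sub>v map_vec complex_of_real (map_vec Im x) = x"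
    using x by (intro eq_vecI) (auto simp: complex_eq[symmetric])
  ultimately show ?thesis by simp
qed

lemma C_resolvent:
  assumes x: "x \<in> carrier_vec n"
  obtains b r where "\<And>j s. (b j \<longlongrightarrow> b j s) (at s)" "\<And>i s. (r i \<longlongrightarrow> r i s) (at s)"
    "\<And>z i. \<not> ev z \<Longrightarrow> i < m \<Longrightarrow> (cmat C *\<^sub>v (R z *\<^sub>v x)) $ i = (\<Sum>j<m. H z $$ (i, j) * b j z) + r i z"
proof -
  obtain b r where b: "\<And>j. continuous_on UNIV (b j)" "\<And>i. continuous_on UNIV (r i)"
    "\<And>z i. \<not> ev z \<Longrightarrow> i < m \<Longrightarrow> (cmat C *\<^sub>v (R z *\<^sub>v x)) $ i = (\<Sum>j<m. H z $$ (i, j) * b j z) + r i z"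
    using affine_in_H[OF x] unfolding affine_in_H_def by blast
  have "(b j \<longlongrightarrow> b j s) (at s)" "(r i \<longlongrightarrow> r i s) (at s)" for i j s
    using b(1)[of j] b(2)[of i] by (auto simp: continuous_on_def)
  with b(3) show ?thesis using that by blast
qed

lemma observable:
  assumes "x \<in> carrier_vec n" "cmat A *\<^sub>v x = s \<cdot>\<^sub>v x" "cmat C *\<^sub>v x = 0\<^sub>v m"
  shows "x = 0\<^sub>v n"
  using minimal_observable[OF minimal assms] .

text \<open>On an eigenvector x at s the resolvent is explicit, so C R(z) x = C x / (z - s). If
  \<open>G\<close> had no pole at s, \<open>C_resolvent\<close> would keep this bounded near s. Then
  C x = 0, against observability.\<close>

lemma ev_imp_pole:
  assumes s: "ev s" shows "has_pole m G s"
proof (rule ccontr)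
  assume np: "\<not> has_pole m G s"
  obtain x where x: "x \<in> carrier_vec n" "x \<noteq> 0\<^sub>v n" "cmat A *\<^sub>v x = s \<cdot>\<^sub>v x"
    using s by (auto simp: eigenvalue_def eigenvector_def)
  obtain b r where b: "\<And>j s. (b j \<longlongrightarrow> b j s) (at s)" "\<And>i s. (r i \<longlongrightarrow> r i s) (at s)"
    "\<And>z i. \<not> ev z \<Longrightarrow> i < m \<Longrightarrow> (cmat C *\<^sub>v (R z *\<^sub>v x)) $ i = (\<Sum>j<m. H z $$ (i, j) * b j z) + r i z"
    using C_resolvent[OF x(1)] by blast
  have "(cmat C *\<^sub>v x) $ i = 0" if i: "i < m" for i
  proof -
    have "((\<lambda>z. (z - s) * ((\<Sum>j<m. H z $$ (i, j) * b j z) + r i z)) \<longlongrightarrow>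
      (s - s) * ((\<Sum>j<m. T s $$ (i, j) * b j s) + r i s)) (at s)"
      using np i by (intro tendsto_intros T_tendsto b) (auto simp: has_pole_def G_eq)
    moreover have "eventually (\<lambda>z. (z - s) * ((\<Sum>j<m. H z $$ (i, j) * b j z) + r i z) = (cmat C *\<^sub>v x) $ i) (at s)"
    proof -
      have "eventually (\<lambda>z. z \<noteq> s) (at s)" by (simp add: eventually_at_filter)
      with eventually_not_ev(1)[of s] show ?thesis
      proof eventually_elim
        case (elim z)
        have "R z *\<^sub>v x = (1 / (z - s)) \<cdot>\<^sub>v x"
        proof (rule resolvent_unique[OF cmat_carrier(1) elim(1)])
          have "cmat A *\<^sub>v ((1 / (z - s)) \<cdot>\<^sub>v x) = (1 / (z - s)) \<cdot>\<^sub>v (s \<cdot>\<^sub>v x)"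
            using x by (simp add: mult_mat_vec[of _ n n])
          then show "z \<cdot>\<^sub>v ((1 / (z - s)) \<cdot>\<^sub>v x) - cmat A *\<^sub>v ((1 / (z - s)) \<cdot>\<^sub>v x) = x"
            using x elim
            by (intro eq_vecI) (auto simp: diff_divide_distrib[symmetric] left_diff_distrib[symmetric])
        qed (use x in auto)
        then have "cmat C *\<^sub>v (R z *\<^sub>v x) = (1 / (z - s)) \<cdot>\<^sub>v (cmat C *\<^sub>v x)"
          using x by (simp add: mult_mat_vec[of _ m n])
        then have "(cmat C *\<^sub>v (R z *\<^sub>v x)) $ i = (1 / (z - s)) * (cmat C *\<^sub>v x) $ i"
          using i by (simp del: index_mult_mat_vec)
        then show ?case using b(3)[OF elim(1) i] elim(2) by (simp add: field_simps)
      qed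
    qed
    ultimately have "((\<lambda>z. (cmat C *\<^sub>v x) $ i) \<longlongrightarrow> 0) (at s)" by (simp add: tendsto_cong)
    then show ?thesis by (simp add: tendsto_const_iff)
  qed
  then have "cmat C *\<^sub>v x = 0\<^sub>v m" by (intro eq_vecI) auto
  then show False using observable x by blast
qed

end

section \<open>Quadratic forms of negative imaginary functions\<close>

text \<open>This is v^* M v, since \<open>\<bullet>c\<close> conjugates its second argument.\<close>

definition qform :: "complex mat \<Rightarrow> complex vec \<Rightarrow> complex" where
  "qform M v = (M *\<^sub>v v) \<bullet>c v"

lemma qform_sum:
  assumes "M \<in> carrier_mat m m" "v \<in> carrier_vec m"
  shows "qform M v = (\<Sum>i<m. \<Sum>j<m. M $$ (i, j) * v $ j * cnj (v $ i))"
  unfolding qform_def using sesquilinear_sum[OF assms assms(2)] .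

lemma mat_adjoint_entry:
  assumes "M \<in> carrier_mat r c"
  shows "mat_adjoint M \<in> carrier_mat c r"
    "i < c \<Longrightarrow> j < r \<Longrightarrow> mat_adjoint M $$ (i, j) = cnj (M $$ (j, i))"
  using assms by (auto simp: mat_adjoint_def mat_of_rows_index)

lemma hermitian_entry:
  assumes "hermitian_mat M" "M \<in> carrier_mat m m" "i < m" "j < m"
  shows "M $$ (j, i) = cnj (M $$ (i, j))"
  using assms mat_adjoint_entry(2)[OF assms(2), of j i] by (simp add: hermitian_mat_def)

lemma qform_adjoint:
  assumes M: "M \<in> carrier_mat m m" and v: "v \<in> carrier_vec m"
  shows "qform (mat_adjoint M) v = cnj (qform M v)"
proof -
  have "qform (mat_adjoint M) v = (\<Sum>i<m. \<Sum>j<m. cnj (M $$ (j, i)) * v $ j * cnj (v $ i))"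
    unfolding qform_sum[OF mat_adjoint_entry(1)[OF M] v]
    by (intro sum.cong refl) (simp add: mat_adjoint_entry(2)[OF M])
  also have "\<dots> = (\<Sum>j<m. \<Sum>i<m. cnj (M $$ (j, i)) * v $ j * cnj (v $ i))"
    by (rule sum.swap)
  also have "\<dots> = cnj (qform M v)"
    unfolding qform_sum[OF M v] by (simp add: mult_ac)
  finally show ?thesis .
qed

lemma hermitian_qform_real:
  assumes "hermitian_mat M" "M \<in> carrier_mat m m" "v \<in> carrier_vec m"
  shows "Im (qform M v) = 0" "qform M v = of_real (Re (qform M v))"
proof -
  show "Im (qform M v) = 0"
    using qform_adjoint[OF assms(2,3)] assms(1) unfolding hermitian_mat_def
    by (metis complex_cnj_cancel_iff cnj.simps(2) equal_neg_zero)
  then show "qform M v = of_real (Re (qform M v))" by (simp add: complex_eq_iff)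
qed

lemma qform_imag_herm:
  assumes M: "M \<in> carrier_mat m m" and v: "v \<in> carrier_vec m"
  shows "imag_herm M \<in> carrier_mat m m" "Re (qform (imag_herm M) v) = - 2 * Im (qform M v)"
proof -
  note a = mat_adjoint_entry(1)[OF M]
  show c: "imag_herm M \<in> carrier_mat m m" unfolding imag_herm_def by (intro smult_carrier_mat minus_carrier_mat a)
  have "qform (imag_herm M) v = \<i> * (qform M v - qform (mat_adjoint M) v)"
    unfolding qform_sum[OF c v] qform_sum[OF M v] qform_sum[OF a v]
    using M a v by (simp add: imag_herm_def sum_subtractf[symmetric] sum_distrib_left algebra_simps)
  then show "Re (qform (imag_herm M) v) = - 2 * Im (qform M v)"
    by (simp add: qform_adjoint[OF M v])
qed

lemma pos_semidef_qform:
  assumes "pos_semidef M" "M \<in> carrier_mat m m" "v \<in> carrier_vec m"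
  shows "hermitian_mat M" "Re (qform M v) \<ge> 0"
  using assms by (auto simp: pos_semidef_def qform_def)

text \<open>The weight \<open>c\<close> is the factor that cancels a pole, such as z - p or
  z^2.\<close>

lemma tendsto_qform:
  assumes M: "\<And>z. M z \<in> carrier_mat m m" and L: "L \<in> carrier_mat m m" and v: "v \<in> carrier_vec m"
    and lim: "\<And>i j. i < m \<Longrightarrow> j < m \<Longrightarrow> ((\<lambda>z. c z * M z $$ (i, j)) \<longlongrightarrow> L $$ (i, j)) F"
  shows "((\<lambda>z. c z * qform (M z) v) \<longlongrightarrow> qform L v) F"
proof -
  have "((\<lambda>z. \<Sum>i<m. \<Sum>j<m. c z * M z $$ (i, j) * v $ j * cnj (v $ i)) \<longlongrightarrow>
    (\<Sum>i<m. \<Sum>j<m. L $$ (i, j) * v $ j * cnj (v $ i))) F"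
    by (intro tendsto_sum tendsto_mult tendsto_const lim) auto
  then show ?thesis
    unfolding qform_sum[OF M v] qform_sum[OF L v] by (simp add: sum_distrib_left mult_ac)
qed

lemma filterlim_imag_axis:
  "filterlim (\<lambda>w::real. \<i> * complex_of_real w) (at (\<i> * complex_of_real a)) (at a)"
  unfolding filterlim_at
proof
  show "((\<lambda>w::real. \<i> * complex_of_real w) \<longlongrightarrow> \<i> * complex_of_real a) (at a)" by (intro tendsto_intros)
  show "\<forall>\<^sub>F x in at a. \<i> * complex_of_real x \<in> UNIV \<and> \<i> * complex_of_real x \<noteq> \<i> * complex_of_real a"
    by (auto simp: eventually_at_filter)
qed

lemma filterlim_cnj_at: "filterlim cnj (at (cnj p)) (at p)"
  unfolding filterlim_at
proof
  show "(cnj \<longlongrightarrow> cnj p) (at p)" by (intro tendsto_intros)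
  show "\<forall>\<^sub>F x in at p. cnj x \<in> UNIV \<and> cnj x \<noteq> cnj p" by (auto simp: eventually_at_filter)
qed

section \<open>Stable negative imaginary systems and their value at the origin\<close>

context state_space begin

lemma qform_H_cnj:
  assumes z: "\<not> ev z" and y: "y \<in> carrier_vec m"
  shows "qform (H (cnj z)) y = cnj (qform (H z) (conjugate y))"
proof -
  have y': "conjugate y \<in> carrier_vec m" using y by simp
  have Hy: "H z *\<^sub>v conjugate y \<in> carrier_vec m" using y' by (auto intro!: mult_mat_vec_carrier[of _ m m])
  have "qform (H (cnj z)) y = conjugate (H z *\<^sub>v conjugate y) \<bullet> conjugate y"
    using H_cnj[OF z y'] y by (simp add: qform_def)
  also have "\<dots> = cnj ((H z *\<^sub>v conjugate y) \<bullet>c conjugate y)"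
    by (rule conjugate_scalar_prod(1)[OF Hy y'])
  finally show ?thesis by (simp add: qform_def)
qed

lemma qform_H_holomorphic:
  assumes y: "y \<in> carrier_vec m"
  shows "(\<lambda>z. qform (H z) y) holomorphic_on - {z. ev z}"
  unfolding qform_sum[OF H_carrier y] by (intro holomorphic_intros H_holomorphic) auto

lemma isCont_qform_H:
  assumes y: "y \<in> carrier_vec m" and z: "\<not> ev z"
  shows "isCont (\<lambda>z. qform (H z) y) z"
  using qform_H_holomorphic[OF y] open_not_ev z
  by (metis ComplI continuous_on_eq_continuous_at holomorphic_on_imp_continuous_on mem_Collect_eq)

text \<open>Applied to the controller and to the closed loop. On the axis the real part of (H(0) -
  H(i w)) / (i w) is - Im H(i w) / w in terms of quadratic forms, provided that the form of H(0) is
  real; this is why the first conclusion comes before the second. At 0 the quotient has residue 0,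
  and at infinity it vanishes.\<close>

lemma stable_negative_imaginary:
  assumes stable: "\<And>z. Re z \<ge> 0 \<Longrightarrow> \<not> ev z"
    and axis: "\<And>w u. w > 0 \<Longrightarrow> u \<in> carrier_vec m \<Longrightarrow> Im (qform (H (\<i> * of_real w)) u) \<le> 0"
    and u: "u \<in> carrier_vec m"
  shows "Im (qform (H 0) u) = 0"
    "Re s > 0 \<Longrightarrow> Re ((qform (H 0) u - qform (H s) u) / s) \<ge> 0"
proof -
  have le: "Im (qform (H 0) v) \<le> 0" if v: "v \<in> carrier_vec m" for v
  proof -
    have "((\<lambda>w. Im (qform (H (\<i> * of_real w)) v)) \<longlongrightarrow> Im (qform (H (\<i> * of_real 0)) v)) (at 0)"
      using isCont_qform_H[OF v stable[of 0]]
      by (intro tendsto_intros filterlim_compose[OF _ filterlim_imag_axis]) (simp add: isCont_def)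
    then have "((\<lambda>w. Im (qform (H (\<i> * of_real w)) v)) \<longlongrightarrow> Im (qform (H 0) v)) (at_right 0)"
      by (simp add: filterlim_at_split)
    moreover have "eventually (\<lambda>w. Im (qform (H (\<i> * of_real w)) v) \<le> 0) (at_right (0::real))"
      unfolding eventually_at_filter by (intro always_eventually) (auto intro: axis v)
    ultimately show ?thesis by (intro tendsto_upperbound[where F = "at_right (0::real)"]) auto
  qed
  \<comment> \<open>The limit from above the origin gives Im \<le> 0 for every vector. Conjugation
    symmetry at 0 exchanges u with its conjugate and flips the sign, so both imaginary parts
    vanish.\<close>
  have "qform (H 0) u = cnj (qform (H 0) (conjugate u))"
    using qform_H_cnj[OF stable[of 0] u] by simp
  then have "Im (qform (H 0) u) = - Im (qform (H 0) (conjugate u))" by (metis cnj.simps(2))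
  then show im0: "Im (qform (H 0) u) = 0" using le[OF u] le[of "conjugate u"] u by simp
  define f where "f z = (qform (H 0) u - qform (H z) u) / z" for z
  have "Re (f s) \<ge> 0" if s: "Re s > 0"
  proof (rule half_plane_Re_nonneg[OF _ _ _ _ _ _ s])
    let ?P = "insert 0 {z. ev z}"
    show "finite ?P" using finite_ev by simp
    show "Re p \<le> 0" if "p \<in> ?P" for p using that stable[of p] by force
    show "f holomorphic_on - ?P"
      unfolding f_def by (intro holomorphic_intros holomorphic_on_subset[OF qform_H_holomorphic[OF u]]) auto
    show "Re (f (\<i> * of_real w)) \<ge> 0" if w: "\<i> * of_real w \<notin> ?P" for w :: real
    proof -
      have Re: "Re (f (\<i> * of_real w)) = - Im (qform (H (\<i> * of_real w)) u) / w"
        unfolding f_def using im0 w by (simp add: Re_divide power2_eq_square field_simps)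
      consider "w > 0" | "w < 0" using w by fastforce
      then show ?thesis
      proof cases
        case 1 then show ?thesis using axis[OF 1 u] Re by (simp add: divide_nonpos_pos)
      next
        case 2
        have "qform (H (\<i> * of_real w)) u = cnj (qform (H (\<i> * of_real (- w))) (conjugate u))"
          using qform_H_cnj[OF _ u, of "\<i> * of_real (- w)"] stable[of "\<i> * of_real (- w)"] by simp
        moreover have "Im (qform (H (\<i> * of_real (- w))) (conjugate u)) \<le> 0"
          using 2 u by (intro axis) auto
        ultimately show ?thesis using 2 Re by (simp add: divide_nonpos_neg del: of_real_minus)
      qed
    qed
    show "\<exists>k\<ge>0. ((\<lambda>s. (s - p) * f s) \<longlongrightarrow> of_real k) (at p)" if "p \<in> ?P" "Re p = 0" for p
    proof -
      have p: "p = 0" using that stable[of p] by auto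
      have "((\<lambda>z. qform (H 0) u - qform (H z) u) \<longlongrightarrow> qform (H 0) u - qform (H 0) u) (at 0)"
        using isCont_qform_H[OF u stable[of 0]] by (intro tendsto_intros) (simp add: isCont_def)
      moreover have "eventually (\<lambda>z. (z - 0) * f z = qform (H 0) u - qform (H z) u) (at 0)"
        by (auto simp: f_def eventually_at_filter)
      ultimately show ?thesis unfolding p by (intro exI[of _ 0]) (simp add: tendsto_cong)
    qed
    have "((\<lambda>z. 1 * qform (H z) u) \<longlongrightarrow> qform (cmat D) u) at_infinity"
      using H_at_infinity(2) u by (intro tendsto_qform) auto
    then show "(f \<longlongrightarrow> 0) at_infinity"
      unfolding f_def divide_inverse
      using tendsto_mult[OF tendsto_diff[OF tendsto_const] tendsto_inverse_0] by fastforce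
  qed
  then show "Re s > 0 \<Longrightarrow> Re ((qform (H 0) u - qform (H s) u) / s) \<ge> 0" by (simp add: f_def)
qed

end

section \<open>The relation between input and output at a possible pole\<close>

context minimal_state_space begin

lemma has_pole_iff_ev: "has_pole m G s \<longleftrightarrow> ev s"
  using ev_imp_pole has_pole_T_imp_ev G_eq by blast

lemma mat_tendsto_G:
  assumes "mat_tendsto m (\<lambda>s. c s \<cdot>\<^sub>m G s) K F" "F = at p \<or> F = at_infinity"
  shows "K \<in> carrier_mat m m" "i < m \<Longrightarrow> j < m \<Longrightarrow> ((\<lambda>s. c s * H s $$ (i, j)) \<longlongrightarrow> K $$ (i, j)) F"
proof -
  show "K \<in> carrier_mat m m" using assms(1) by (simp add: mat_tendsto_def)
  assume ij: "i < m" "j < m"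
  have cong: "eventually (\<lambda>s. (c s \<cdot>\<^sub>m G s) $$ (i, j) = c s * H s $$ (i, j)) F"
  proof -
    have "eventually (\<lambda>s. T s = H s) F" using assms(2) eventually_T_eq_H by blast
    then show ?thesis
      by eventually_elim (use ij carrier_matD[OF H_carrier] in \<open>simp add: G_eq\<close>)
  qed
  then show "((\<lambda>s. c s * H s $$ (i, j)) \<longlongrightarrow> K $$ (i, j)) F"
    using assms(1) ij unfolding mat_tendsto_def tendsto_cong[OF cong, symmetric] by blast
qed

text \<open>The state equation at s is read as one at z with the extra input (z - s) x. Thus s
  itself may be an eigenvalue of A, and \<open>H\<close> is evaluated only at the regular point
  z.\<close>

lemma output_eq:
  assumes D0: "D = 0\<^sub>m m m" and x: "x \<in> carrier_vec n" and y: "y \<in> carrier_vec m"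
    and eq: "s \<cdot>\<^sub>v x - cmat A *\<^sub>v x = cmat B *\<^sub>v y" and z: "\<not> ev z"
  shows "cmat C *\<^sub>v x = H z *\<^sub>v y + (z - s) \<cdot>\<^sub>v (cmat C *\<^sub>v (R z *\<^sub>v x))"
proof -
  note R = resolvent(1)[OF cmat_carrier(1) z]
  have By: "cmat B *\<^sub>v y \<in> carrier_vec n" using y by (auto intro!: mult_mat_vec_carrier[of _ n m])
  have "R z *\<^sub>v (cmat B *\<^sub>v y + (z - s) \<cdot>\<^sub>v x) = x"
  proof (rule resolvent_unique[OF cmat_carrier(1) z x])
    have "cmat A *\<^sub>v x \<in> carrier_vec n" using x by (auto intro!: mult_mat_vec_carrier[of _ n n])
    then show "z \<cdot>\<^sub>v x - cmat A *\<^sub>v x = cmat B *\<^sub>v y + (z - s) \<cdot>\<^sub>v x"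
      unfolding eq[symmetric] using x by (intro eq_vecI) (auto simp: algebra_simps)
  qed
  then have "cmat C *\<^sub>v x = cmat C *\<^sub>v (R z *\<^sub>v (cmat B *\<^sub>v y + (z - s) \<cdot>\<^sub>v x))" by simp
  also have "\<dots> = cmat C *\<^sub>v (R z *\<^sub>v (cmat B *\<^sub>v y)) + (z - s) \<cdot>\<^sub>v (cmat C *\<^sub>v (R z *\<^sub>v x))"
    using R x By by (simp add: mult_add_distrib_mat_vec[of _ n n] mult_add_distrib_mat_vec[of _ m n]
        mult_mat_vec[of _ m n] mult_mat_vec[of _ n n] mult_mat_vec_carrier[of _ n n])
  also have "cmat C *\<^sub>v (R z *\<^sub>v (cmat B *\<^sub>v y)) = H z *\<^sub>v y"
  proof -
    have "cmat D *\<^sub>v y = 0\<^sub>v m" using y unfolding D0 by (intro eq_vecI) (auto simp: scalar_prod_def)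
    moreover have "cmat C *\<^sub>v (R z *\<^sub>v (cmat B *\<^sub>v y)) \<in> carrier_vec m"
      using R By by (auto intro!: mult_mat_vec_carrier[of _ m n] mult_mat_vec_carrier[of _ n n])
    ultimately show ?thesis using H_apply[OF z y] by simp
  qed
  finally show ?thesis .
qed

lemma output_entry:
  fixes x y :: "complex vec"
  assumes D0: "D = 0\<^sub>m m m" and x: "x \<in> carrier_vec n" and y: "y \<in> carrier_vec m"
    and eq: "s \<cdot>\<^sub>v x - cmat A *\<^sub>v x = cmat B *\<^sub>v y"
  obtains b r where "\<And>j s. (b j \<longlongrightarrow> b j s) (at s)" "\<And>i s. (r i \<longlongrightarrow> r i s) (at s)"
    "\<And>z i. \<not> ev z \<Longrightarrow> i < m \<Longrightarrow> (cmat C *\<^sub>v x) $ i =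
      (\<Sum>j<m. H z $$ (i, j) * y $ j) + (z - s) * ((\<Sum>j<m. H z $$ (i, j) * b j z) + r i z)"
proof -
  obtain b r where b: "\<And>j s. (b j \<longlongrightarrow> b j s) (at s)" "\<And>i s. (r i \<longlongrightarrow> r i s) (at s)"
    and e: "\<And>z i. \<not> ev z \<Longrightarrow> i < m \<Longrightarrow> (cmat C *\<^sub>v (R z *\<^sub>v x)) $ i = (\<Sum>j<m. H z $$ (i, j) * b j z) + r i z"
    using C_resolvent[OF x] by blast
  have "(cmat C *\<^sub>v x) $ i =
      (\<Sum>j<m. H z $$ (i, j) * y $ j) + (z - s) * ((\<Sum>j<m. H z $$ (i, j) * b j z) + r i z)"
    if z: "\<not> ev z" and i: "i < m" for z i
  proof -
    have "(H z *\<^sub>v y) $ i = (\<Sum>j<m. H z $$ (i, j) * y $ j)"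
      using i y carrier_matD[OF H_carrier[of z]] by (simp add: scalar_prod_def atLeast0LessThan)
    then show ?thesis
      unfolding output_eq[OF D0 x y eq z] e[OF z i, symmetric]
      using i carrier_matD[OF H_carrier[of z]] by (simp del: index_mult_mat_vec)
  qed
  with b show ?thesis using that by blast
qed

text \<open>An input that admits a bounded state at s must be annihilated by the leading coefficient
  of the pole. After multiplication by (z - s)^k the correction term still carries a factor z - s,
  and \<open>C_resolvent\<close> ensures that what it multiplies converges.\<close>

lemma input_in_kernel:
  fixes x y :: "complex vec"
  assumes D0: "D = 0\<^sub>m m m" and x: "x \<in> carrier_vec n" and y: "y \<in> carrier_vec m"
    and eq: "s \<cdot>\<^sub>v x - cmat A *\<^sub>v x = cmat B *\<^sub>v y" and k: "k > 0" and i: "i < m"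
    and lim: "\<And>j. j < m \<Longrightarrow> ((\<lambda>z. (z - s) ^ k * H z $$ (i, j)) \<longlongrightarrow> L j) (at s)"
  shows "(\<Sum>j<m. L j * y $ j) = 0"
proof -
  obtain b r where b: "\<And>j s. (b j \<longlongrightarrow> b j s) (at s)" "\<And>i s. (r i \<longlongrightarrow> r i s) (at s)"
    and e: "\<And>z i. \<not> ev z \<Longrightarrow> i < m \<Longrightarrow> (cmat C *\<^sub>v x) $ i =
      (\<Sum>j<m. H z $$ (i, j) * y $ j) + (z - s) * ((\<Sum>j<m. H z $$ (i, j) * b j z) + r i z)"
    using output_entry[OF D0 x y eq] by blast
  let ?g = "\<lambda>z. (z - s) ^ k"
  have "((\<lambda>z. (\<Sum>j<m. (?g z * H z $$ (i, j)) * y $ j) +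
      (z - s) * ((\<Sum>j<m. (?g z * H z $$ (i, j)) * b j z) + ?g z * r i z)) \<longlongrightarrow>
      (\<Sum>j<m. L j * y $ j) + (s - s) * ((\<Sum>j<m. L j * b j s) + (s - s) ^ k * r i s)) (at s)"
    by (intro tendsto_intros b lim) auto
  moreover have "eventually (\<lambda>z. (\<Sum>j<m. (?g z * H z $$ (i, j)) * y $ j) +
      (z - s) * ((\<Sum>j<m. (?g z * H z $$ (i, j)) * b j z) + ?g z * r i z) = ?g z * (cmat C *\<^sub>v x) $ i) (at s)"
    using eventually_not_ev(1)[of s]
  proof eventually_elim
    case (elim z)
    show ?case unfolding e[OF elim i] by (simp add: algebra_simps sum_distrib_left)
  qed
  ultimately have "((\<lambda>z. ?g z * (cmat C *\<^sub>v x) $ i) \<longlongrightarrow> (\<Sum>j<m. L j * y $ j)) (at s)"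
    by (simp add: tendsto_cong)
  moreover have "((\<lambda>z. ?g z * (cmat C *\<^sub>v x) $ i) \<longlongrightarrow> (s - s) ^ k * (cmat C *\<^sub>v x) $ i) (at s)"
    by (intro tendsto_intros)
  ultimately show ?thesis using k tendsto_unique[OF at_neq_bot] by fastforce
qed

text \<open>The point \<open>s\<close> may be a pole of \<open>G\<close>: the pole contributes nothing to the limit because the
  residue matrix \<open>L\<close> is skew-Hermitian.\<close>

lemma qform_tendsto_output:
  fixes x y :: "complex vec"
  assumes D0: "D = 0\<^sub>m m m" and x: "x \<in> carrier_vec n" and y: "y \<in> carrier_vec m"
    and eq: "s \<cdot>\<^sub>v x - cmat A *\<^sub>v x = cmat B *\<^sub>v y"
    and lim: "\<And>i j. i < m \<Longrightarrow> j < m \<Longrightarrow> ((\<lambda>z. (z - s) * H z $$ (i, j)) \<longlongrightarrow> L i j) (at s)"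
    and skew: "\<And>i j. i < m \<Longrightarrow> j < m \<Longrightarrow> L i j = - cnj (L j i)"
  shows "((\<lambda>z. qform (H z) y) \<longlongrightarrow> (cmat C *\<^sub>v x) \<bullet>c y) (at s)"
proof -
  obtain b r where b: "\<And>j s. (b j \<longlongrightarrow> b j s) (at s)" "\<And>i s. (r i \<longlongrightarrow> r i s) (at s)"
    and e: "\<And>z i. \<not> ev z \<Longrightarrow> i < m \<Longrightarrow> (cmat C *\<^sub>v x) $ i =
      (\<Sum>j<m. H z $$ (i, j) * y $ j) + (z - s) * ((\<Sum>j<m. H z $$ (i, j) * b j z) + r i z)"
    using output_entry[OF D0 x y eq] by blast
  have ker: "(\<Sum>j<m. L i j * y $ j) = 0" if "i < m" for i
    using input_in_kernel[OF D0 x y eq, of 1 i "L i"] lim that by simp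
  \<comment> \<open>The correction term tends to L b(s), which need not vanish. Since L is
    skew-Hermitian, L y = 0 also gives y^* L = 0, so pairing with y removes it.\<close>
  have coker: "(\<Sum>i<m. cnj (y $ i) * L i j) = 0" if j: "j < m" for j
  proof -
    have "(\<Sum>i<m. cnj (y $ i) * L i j) = (\<Sum>i<m. - cnj (L j i * y $ i))"
    proof (rule sum.cong[OF refl])
      fix i assume "i \<in> {..<m}"
      then have "L i j = - cnj (L j i)" by (intro skew j) simp
      then show "cnj (y $ i) * L i j = - cnj (L j i * y $ i)" by simp
    qed
    also have "\<dots> = - cnj (\<Sum>i<m. L j i * y $ i)" by (simp add: sum_negf)
    finally show ?thesis using ker[OF j] by simp
  qed
  have "((\<lambda>z. (\<Sum>i<m. cnj (y $ i) * (cmat C *\<^sub>v x) $ i) -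
      (\<Sum>i<m. cnj (y $ i) * ((\<Sum>j<m. (z - s) * H z $$ (i, j) * b j z) + (z - s) * r i z))) \<longlongrightarrow>
    (\<Sum>i<m. cnj (y $ i) * (cmat C *\<^sub>v x) $ i) -
      (\<Sum>i<m. cnj (y $ i) * ((\<Sum>j<m. L i j * b j s) + (s - s) * r i s))) (at s)"
    by (intro tendsto_intros b lim) auto
  moreover have "(\<Sum>i<m. cnj (y $ i) * ((\<Sum>j<m. L i j * b j s) + (s - s) * r i s)) = 0"
  proof -
    have "(\<Sum>i<m. cnj (y $ i) * ((\<Sum>j<m. L i j * b j s) + (s - s) * r i s)) =
      (\<Sum>i<m. \<Sum>j<m. cnj (y $ i) * L i j * b j s)" by (simp add: sum_distrib_left mult.assoc)
    also have "\<dots> = (\<Sum>j<m. \<Sum>i<m. cnj (y $ i) * L i j * b j s)" by (rule sum.swap)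
    also have "\<dots> = (\<Sum>j<m. (\<Sum>i<m. cnj (y $ i) * L i j) * b j s)" by (simp add: sum_distrib_right)
    also have "\<dots> = 0" using coker by simp
    finally show ?thesis .
  qed
  moreover have "(\<Sum>i<m. cnj (y $ i) * (cmat C *\<^sub>v x) $ i) = (cmat C *\<^sub>v x) \<bullet>c y"
    using y by (simp add: scalar_prod_def[of "cmat C *\<^sub>v x"] atLeast0LessThan mult.commute del: index_mult_mat_vec)
  moreover have "eventually (\<lambda>z. (\<Sum>i<m. cnj (y $ i) * (cmat C *\<^sub>v x) $ i) -
      (\<Sum>i<m. cnj (y $ i) * ((\<Sum>j<m. (z - s) * H z $$ (i, j) * b j z) + (z - s) * r i z)) = qform (H z) y) (at s)"
    using eventually_not_ev(1)[of s]
  proof eventually_elim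
    case (elim z)
    have "cnj (y $ i) * (cmat C *\<^sub>v x) $ i - cnj (y $ i) * ((\<Sum>j<m. (z - s) * H z $$ (i, j) * b j z) + (z - s) * r i z)
      = (\<Sum>j<m. H z $$ (i, j) * y $ j * cnj (y $ i))" if i: "i < m" for i
      unfolding e[OF elim i] by (simp add: algebra_simps sum_distrib_left)
    then show ?case
      unfolding qform_sum[OF H_carrier y] sum_subtractf[symmetric] by (intro sum.cong refl) auto
  qed
  ultimately show ?thesis by (simp add: tendsto_cong)
qed

end

section \<open>Sign conditions for a strictly proper negative imaginary plant\<close>

locale negative_imaginary_system = minimal_state_space +
  assumes ni: "negative_imaginary m G" and D0: "D = 0\<^sub>m m m"
begin

lemma ev_Re: "ev z \<Longrightarrow> Re z \<le> 0"
  using ni has_pole_iff_ev[of z] by (force simp: negative_imaginary_def)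

text \<open>Regular points are included with K = 0, so later arguments need not ask whether i w is a
  pole. The factor - i undoes the factor j in the definition of K.\<close>

lemma residue_pos_semidef:
  assumes w: "w > 0"
  obtains K where "K \<in> carrier_mat m m" "pos_semidef K"
    "\<And>i j. i < m \<Longrightarrow> j < m \<Longrightarrow> ((\<lambda>z. (z - \<i> * of_real w) * H z $$ (i, j)) \<longlongrightarrow> - \<i> * K $$ (i, j)) (at (\<i> * of_real w))"
proof (cases "ev (\<i> * of_real w)")
  case True
  then obtain K where K: "mat_tendsto m (\<lambda>s. ((s - \<i> * of_real w) * \<i>) \<cdot>\<^sub>m G s) K (at (\<i> * of_real w))" "pos_semidef K"
    using ni w has_pole_iff_ev unfolding negative_imaginary_def by blast
  note lim = mat_tendsto_G[OF K(1), of "\<i> * of_real w", simplified]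
  show ?thesis
  proof (rule that[OF lim(1) K(2)])
    fix i j assume ij: "i < m" "j < m"
    have "((\<lambda>z. - \<i> * ((z - \<i> * of_real w) * \<i> * H z $$ (i, j))) \<longlongrightarrow> - \<i> * K $$ (i, j)) (at (\<i> * of_real w))"
      by (intro tendsto_intros lim(2) ij)
    then show "((\<lambda>z. (z - \<i> * of_real w) * H z $$ (i, j)) \<longlongrightarrow> - \<i> * K $$ (i, j)) (at (\<i> * of_real w))"
      by (simp add: algebra_simps)
  qed
next
  case False
  show ?thesis
  proof (rule that[of "0\<^sub>m m m"])
    have "hermitian_mat (0\<^sub>m m m)"
      using mat_adjoint_entry[of "0\<^sub>m m m" m m] unfolding hermitian_mat_def by (intro eq_matI) auto
    then show "pos_semidef (0\<^sub>m m m)" by (auto simp: pos_semidef_def scalar_prod_def)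
    fix i j assume ij: "i < m" "j < m"
    have "isCont (\<lambda>z. H z $$ (i, j)) (\<i> * of_real w)"
      using H_holomorphic[OF ij] open_not_ev False
      by (metis ComplI continuous_on_eq_continuous_at holomorphic_on_imp_continuous_on mem_Collect_eq)
    then have "((\<lambda>z. (z - \<i> * of_real w) * H z $$ (i, j)) \<longlongrightarrow>
      (\<i> * of_real w - \<i> * of_real w) * H (\<i> * of_real w) $$ (i, j)) (at (\<i> * of_real w))"
      by (intro tendsto_intros) (simp add: isCont_def)
    then show "((\<lambda>z. (z - \<i> * of_real w) * H z $$ (i, j)) \<longlongrightarrow> - \<i> * 0\<^sub>m m m $$ (i, j)) (at (\<i> * of_real w))"
      using ij by simp
  qed simp
qed

lemma Im_qform_H:
  assumes w: "w > 0" "\<not> ev (\<i> * of_real w)" and y: "y \<in> carrier_vec m"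
  shows "Im (qform (H (\<i> * of_real w)) y) \<le> 0"
proof -
  have "pos_semidef (imag_herm (G (\<i> * of_real w)))"
    using ni w has_pole_iff_ev unfolding negative_imaginary_def by blast
  then have "pos_semidef (imag_herm (H (\<i> * of_real w)))" using w by (simp add: G_eq T_eq_H)
  from pos_semidef_qform(2)[OF this qform_imag_herm(1)[OF H_carrier y] y]
  show ?thesis using qform_imag_herm(2)[OF H_carrier y] by simp
qed

text \<open>Extends \<open>Im_qform_H\<close> to axis poles: the pairing of output and input is the
  limit of y^* H(z) y along the axis, where the sign is known at nearby regular points. Here - i K
  is skew-Hermitian because K is Hermitian.\<close>

lemma Im_output:
  assumes w: "w > 0" and x: "x \<in> carrier_vec n" and y: "y \<in> carrier_vec m"
    and eq: "(\<i> * of_real w) \<cdot>\<^sub>v x - cmat A *\<^sub>v x = cmat B *\<^sub>v y"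
  shows "Im ((cmat C *\<^sub>v x) \<bullet>c y) \<le> 0"
proof -
  obtain K where K: "K \<in> carrier_mat m m" "pos_semidef K"
    and lim: "\<And>i j. i < m \<Longrightarrow> j < m \<Longrightarrow> ((\<lambda>z. (z - \<i> * of_real w) * H z $$ (i, j)) \<longlongrightarrow> - \<i> * K $$ (i, j)) (at (\<i> * of_real w))"
    using residue_pos_semidef[OF w] by blast
  have "- \<i> * K $$ (i, j) = - cnj (- \<i> * K $$ (j, i))" if "i < m" "j < m" for i j
    using hermitian_entry[OF pos_semidef_qform(1)[OF K(2,1) y] K(1), of i j] that by simp
  from qform_tendsto_output[OF D0 x y eq lim this]
  have "((\<lambda>v. Im (qform (H (\<i> * of_real v)) y)) \<longlongrightarrow> Im ((cmat C *\<^sub>v x) \<bullet>c y)) (at w)"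
    by (intro tendsto_intros filterlim_compose[OF _ filterlim_imag_axis])
  moreover have "eventually (\<lambda>v. Im (qform (H (\<i> * of_real v)) y) \<le> 0) (at w)"
  proof -
    have "eventually (\<lambda>v. \<not> ev (\<i> * of_real v)) (at w)"
      using filterlim_iff[THEN iffD1, OF filterlim_imag_axis] eventually_not_ev(1) by blast
    moreover have "eventually (\<lambda>v. v > 0) (at w)"
      using w order_tendstoD(1)[OF tendsto_ident_at] by blast
    ultimately show ?thesis by eventually_elim (use Im_qform_H y in auto)
  qed
  ultimately show ?thesis by (intro tendsto_upperbound[where F = "at w"]) auto
qed

text \<open>Positive realness of s G(s). At a pole i w with w > 0 the residue is (i w)(- i K) = w K,
  at 0 it is the limit of s^2 G(s), and at - i w it follows by conjugation; each gives a nonnegative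
  quadratic form. With D = 0 the product s G(s) has a finite limit at infinity.\<close>

lemma Re_s_qform_H:
  assumes s: "Re s > 0" and y: "y \<in> carrier_vec m"
  shows "Re (s * qform (H s) y) \<ge> 0"
proof -
  let ?f = "\<lambda>s. s * qform (H s) y"
  obtain L0 where L0: "\<And>i j. i < m \<Longrightarrow> j < m \<Longrightarrow> ((\<lambda>z. z * (H z $$ (i, j) - cmat D $$ (i, j))) \<longlongrightarrow> L0 i j) at_infinity"
    using H_at_infinity(1) by metis
  define L where "L = qform (Matrix.mat m m (\<lambda>(i, j). L0 i j)) y"
  \<comment> \<open>Stated for every vector because poles on the lower half axis use it with the
    conjugate of y.\<close>
  have upper: "\<exists>k\<ge>0. ((\<lambda>s. (s - \<i> * of_real w) * (s * qform (H s) v)) \<longlongrightarrow> of_real k) (at (\<i> * of_real w))"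
    if w: "w > 0" and v: "v \<in> carrier_vec m" for w v
  proof -
    obtain K where K: "K \<in> carrier_mat m m" "pos_semidef K"
      and lim: "\<And>i j. i < m \<Longrightarrow> j < m \<Longrightarrow> ((\<lambda>z. (z - \<i> * of_real w) * H z $$ (i, j)) \<longlongrightarrow> - \<i> * K $$ (i, j)) (at (\<i> * of_real w))"
      using residue_pos_semidef[OF w] by blast
    have "((\<lambda>z. \<i> * (z - \<i> * of_real w) * qform (H z) v) \<longlongrightarrow> qform K v) (at (\<i> * of_real w))"
    proof (rule tendsto_qform[OF H_carrier K(1) v])
      fix i j assume "i < m" "j < m"
      from tendsto_mult[OF tendsto_const[of \<i>] lim[OF this]]
      show "((\<lambda>z. \<i> * (z - \<i> * of_real w) * H z $$ (i, j)) \<longlongrightarrow> K $$ (i, j)) (at (\<i> * of_real w))"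
        by (simp add: mult.assoc)
    qed
    then have "((\<lambda>z. (- \<i> * z) * (\<i> * (z - \<i> * of_real w) * qform (H z) v)) \<longlongrightarrow>
      (- \<i> * (\<i> * of_real w)) * qform K v) (at (\<i> * of_real w))"
      by (intro tendsto_intros)
    moreover have "(- \<i> * (\<i> * of_real w)) * qform K v = of_real (w * Re (qform K v))"
      using hermitian_qform_real(2)[OF pos_semidef_qform(1)[OF K(2,1) v] K(1) v] by simp
    moreover have "(- \<i> * z) * (\<i> * (z - \<i> * of_real w) * qform (H z) v) = (z - \<i> * of_real w) * (z * qform (H z) v)" for z
      by (simp add: algebra_simps)
    ultimately show ?thesis
      using pos_semidef_qform(2)[OF K(2,1) v] w by (intro exI[of _ "w * Re (qform K v)"]) simp
  qed
  show ?thesis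
  proof (rule half_plane_Re_nonneg[of "{z. ev z}" ?f L, OF finite_ev _ _ _ _ _ s])
    show "Re p \<le> 0" if "p \<in> {z. ev z}" for p using that ev_Re by simp
    show "?f holomorphic_on - {z. ev z}" by (intro holomorphic_intros qform_H_holomorphic y)
    show "Re (?f (\<i> * of_real w)) \<ge> 0" if w: "\<i> * of_real w \<notin> {z. ev z}" for w :: real
    proof -
      have Re: "Re (?f (\<i> * of_real w)) = - (w * Im (qform (H (\<i> * of_real w)) y))" by simp
      consider "w = 0" | "w > 0" | "w < 0" by linarith
      then show ?thesis
      proof cases
        case 2 then show ?thesis unfolding Re using Im_qform_H[OF 2 _ y] w by (simp add: mult_nonneg_nonpos)
      next
        case 3
        have nev: "\<not> ev (\<i> * of_real (- w))" using w not_ev_cnj[of "\<i> * of_real w"] by simp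
        have "qform (H (\<i> * of_real w)) y = cnj (qform (H (\<i> * of_real (- w))) (conjugate y))"
          using qform_H_cnj[OF nev y] by simp
        moreover have "Im (qform (H (\<i> * of_real (- w))) (conjugate y)) \<le> 0"
          using 3 y nev by (intro Im_qform_H) auto
        ultimately show ?thesis unfolding Re using 3 by (simp add: mult_nonpos_nonpos del: of_real_minus)
      qed simp
    qed
    show "\<exists>k\<ge>0. ((\<lambda>s. (s - p) * ?f s) \<longlongrightarrow> of_real k) (at p)" if p: "p \<in> {z. ev z}" "Re p = 0" for p
    proof -
      have peq: "p = \<i> * of_real (Im p)" using p by (simp add: complex_eq_iff)
      consider "Im p > 0" | "Im p = 0" | "Im p < 0" by linarith
      then show ?thesis
      proof cases
        case 1 then show ?thesis using upper[OF 1 y] peq by simp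
      next
        case 2
        then have p0: "p = 0" using peq by simp
        then have "has_pole m G 0" using p has_pole_iff_ev by simp
        then obtain M where M: "mat_tendsto m (\<lambda>s. s ^ 2 \<cdot>\<^sub>m G s) M (at 0)" "pos_semidef M"
          using ni unfolding negative_imaginary_def by blast
        note lim = mat_tendsto_G[OF M(1), of 0, simplified]
        have "((\<lambda>s. s ^ 2 * qform (H s) y) \<longlongrightarrow> qform M y) (at 0)"
          by (rule tendsto_qform[OF H_carrier lim(1) y lim(2)])
        then have "((\<lambda>s. (s - p) * ?f s) \<longlongrightarrow> of_real (Re (qform M y))) (at p)"
          unfolding p0 hermitian_qform_real(2)[OF pos_semidef_qform(1)[OF M(2) lim(1) y] lim(1) y, symmetric]
          by (simp add: power2_eq_square mult.assoc)
        then show ?thesis using pos_semidef_qform(2)[OF M(2) lim(1) y] by blast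
      next
        case 3
        have "conjugate y \<in> carrier_vec m" using y by simp
        then obtain k where k: "k \<ge> 0" "((\<lambda>s. (s - \<i> * of_real (- Im p)) * (s * qform (H s) (conjugate y)))
          \<longlongrightarrow> of_real k) (at (\<i> * of_real (- Im p)))"
          using upper[of "- Im p"] 3 by auto
        have cp: "\<i> * of_real (- Im p) = cnj p" using p by (simp add: complex_eq_iff)
        \<comment> \<open>Reflecting s to its conjugate moves the pole p to the upper half axis; the
          residue there is real, so conjugation leaves it unchanged.\<close>
        have "((\<lambda>s. cnj ((cnj s - cnj p) * (cnj s * qform (H (cnj s)) (conjugate y)))) \<longlongrightarrow> cnj (of_real k)) (at p)"
          using k(2) unfolding cp by (intro tendsto_intros filterlim_compose[OF _ filterlim_cnj_at])
        moreover have "eventually (\<lambda>s. cnj ((cnj s - cnj p) * (cnj s * qform (H (cnj s)) (conjugate y))) = (s - p) * ?f s) (at p)"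
          using eventually_not_ev(1)[of p]
        proof eventually_elim
          case (elim s)
          show ?case using qform_H_cnj[OF elim, of "conjugate y"] y by simp
        qed
        ultimately have "((\<lambda>s. (s - p) * ?f s) \<longlongrightarrow> cnj (of_real k)) (at p)"
          by (rule Lim_transform_eventually)
        then show ?thesis using k(1) by (intro exI[of _ k]) simp
      qed
    qed
    show "(?f \<longlongrightarrow> L) at_infinity"
      unfolding L_def
    proof (rule tendsto_qform[OF H_carrier _ y])
      fix i j assume ij: "i < m" "j < m"
      show "((\<lambda>z. z * H z $$ (i, j)) \<longlongrightarrow> Matrix.mat m m (\<lambda>(i, j). L0 i j) $$ (i, j)) at_infinity"
        using L0[OF ij] ij by (simp add: D0)
    qed simp
  qed
qed

end

section \<open>Linear algebra of Hermitian forms\<close>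

lemma invertible_mat_kernel:
  fixes M :: "'a :: field mat"
  assumes inv: "invertible_mat M" and M: "M \<in> carrier_mat m m" and v: "v \<in> carrier_vec m" and Mv: "M *\<^sub>v v = 0\<^sub>v m"
  shows "v = 0\<^sub>v m"
proof -
  obtain N where N: "M * N = 1\<^sub>m (dim_row M)" "N * M = 1\<^sub>m (dim_row N)"
    using inv by (auto simp: invertible_mat_def inverts_mat_def)
  have "dim_col (M * N) = m" "dim_col (N * M) = dim_row N" unfolding N using M by auto
  then have Nc: "N \<in> carrier_mat m m" using M by auto
  have "v = (N * M) *\<^sub>v v" unfolding N using Nc v by simp
  also have "\<dots> = N *\<^sub>v (M *\<^sub>v v)" by (rule assoc_mult_mat_vec[OF Nc M v])
  also have "\<dots> = 0\<^sub>v m" unfolding Mv using Nc by auto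
  finally show ?thesis .
qed

lemma inner_add_distrib:
  fixes x y z :: "complex vec"
  assumes "x \<in> carrier_vec m" "y \<in> carrier_vec m" "z \<in> carrier_vec m"
  shows "x \<bullet>c (y + z) = x \<bullet>c y + x \<bullet>c z"
  using assms by (simp add: conjugate_add_vec[of _ m] scalar_prod_add_distrib[of _ m])

lemma qform_add_smult:
  fixes x y :: "complex vec"
  assumes M: "M \<in> carrier_mat m m" and x: "x \<in> carrier_vec m" and y: "y \<in> carrier_vec m"
  shows "qform M (x + c \<cdot>\<^sub>v y) =
    qform M x + c * ((M *\<^sub>v y) \<bullet>c x) + cnj c * ((M *\<^sub>v x) \<bullet>c y) + c * cnj c * qform M y"
proof -
  have xy: "x + c \<cdot>\<^sub>v y \<in> carrier_vec m" using x y by simp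
  have "qform M (x + c \<cdot>\<^sub>v y) =
     (\<Sum>i<m. \<Sum>j<m. M $$ (i, j) * x $ j * cnj (x $ i) + c * (M $$ (i, j) * y $ j * cnj (x $ i)) +
       cnj c * (M $$ (i, j) * x $ j * cnj (y $ i)) + c * cnj c * (M $$ (i, j) * y $ j * cnj (y $ i)))"
    unfolding qform_sum[OF M xy] using x y by (intro sum.cong refl) (simp add: algebra_simps)
  then show ?thesis
    unfolding qform_sum[OF M x] qform_sum[OF M y] sesquilinear_sum[OF M y x] sesquilinear_sum[OF M x y]
    by (simp add: sum.distrib sum_distrib_left)
qed

text \<open>Polarization on unit vectors: the coefficients 1 and i isolate the imaginary and the
  real part of the Hermitian symmetry of an off-diagonal pair.\<close>

lemma hermitian_if_qform_real:
  assumes M: "M \<in> carrier_mat m m" and real: "\<And>v. v \<in> carrier_vec m \<Longrightarrow> Im (qform M v) = 0"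
  shows "hermitian_mat M"
  unfolding hermitian_mat_def
proof (rule eq_matI)
  fix i j assume "i < dim_row M" "j < dim_col M"
  then have ij: "i < m" "j < m" using M by auto
  let ?x = "unit_vec m j :: complex vec" and ?y = "unit_vec m i :: complex vec"
  have c: "(M *\<^sub>v unit_vec m l) \<bullet>c unit_vec m k = M $$ (k, l)" if "k < m" "l < m" for k l
  proof -
    have "conjugate (unit_vec m k) = (unit_vec m k :: complex vec)" by (intro eq_vecI) (auto simp: unit_vec_def)
    then show ?thesis using that M by simp
  qed
  have x: "?x \<in> carrier_vec m" "?y \<in> carrier_vec m" by auto
  have "Im (qform M (?x + b \<cdot>\<^sub>v ?y)) = 0" for b by (rule real) simp
  then have eq: "Im (b * M $$ (j, i) + cnj b * M $$ (i, j)) = 0" for b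
    unfolding qform_add_smult[OF M x] c[OF ij] c[OF ij(2,1)] using real[OF x(1)] real[OF x(2)]
    by simp
  show "mat_adjoint M $$ (i, j) = M $$ (i, j)"
    using eq[of 1] eq[of \<i>] mat_adjoint_entry(2)[OF M ij] by (simp add: complex_eq_iff)
qed (use mat_adjoint_entry(1)[OF M] M in auto)

text \<open>A vector where the form reaches its upper bound 0 is a critical point: moving from w in
  the direction M w changes the form to first order by 2 t |M w|^2, which would make it positive
  unless M w = 0.\<close>

lemma neg_semidef_kernel:
  assumes M: "M \<in> carrier_mat m m" and herm: "hermitian_mat M"
    and le: "\<And>v. v \<in> carrier_vec m \<Longrightarrow> Re (qform M v) \<le> 0"
    and w: "w \<in> carrier_vec m" and z: "Re (qform M w) \<ge> 0"
  shows "M *\<^sub>v w = 0\<^sub>v m"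
proof (rule ccontr)
  assume nz: "M *\<^sub>v w \<noteq> 0\<^sub>v m"
  define v where "v = M *\<^sub>v w"
  have v: "v \<in> carrier_vec m" using M w by (auto simp: v_def)
  define a where "a = v \<bullet>c v"
  have "a > 0" unfolding a_def using nz v conjugate_square_greater_0_vec[of v m] by (simp add: v_def)
  then have a: "Re a > 0" "Im a = 0" by (auto simp: less_complex_def)
  have "(M *\<^sub>v v) \<bullet>c w = cnj (v \<bullet>c v)"
  proof -
    have "(M *\<^sub>v v) \<bullet>c w = (\<Sum>i<m. \<Sum>j<m. M $$ (i, j) * v $ j * cnj (w $ i))"
      by (rule sesquilinear_sum[OF M v w])
    also have "\<dots> = (\<Sum>i<m. \<Sum>j<m. cnj (M $$ (j, i) * w $ i * cnj (v $ j)))"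
      by (intro sum.cong refl) (simp add: hermitian_entry[OF herm M, of _ _, symmetric] mult_ac)
    also have "\<dots> = (\<Sum>j<m. \<Sum>i<m. cnj (M $$ (j, i) * w $ i * cnj (v $ j)))" by (rule sum.swap)
    also have "\<dots> = cnj ((M *\<^sub>v w) \<bullet>c v)" unfolding sesquilinear_sum[OF M w v] by simp
    finally show ?thesis by (simp add: v_def)
  qed
  then have Mvw: "(M *\<^sub>v v) \<bullet>c w = cnj a" "(M *\<^sub>v w) \<bullet>c v = a" by (auto simp: a_def v_def)
  \<comment> \<open>With this step size t |v^* M v| is at most |v|^2, so the quadratic term cannot
    cancel the linear term; the added 1 keeps the denominator positive.\<close>
  define t where "t = Re a / (\<bar>Re (qform M v)\<bar> + 1)"
  have t: "t > 0" using a by (simp add: t_def)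
  have "Re (qform M (w + of_real t \<cdot>\<^sub>v v)) \<le> 0" using w v by (intro le) simp
  then have "Re (qform M w) + 2 * t * Re a + t * t * Re (qform M v) \<le> 0"
    unfolding qform_add_smult[OF M w v] Mvw by simp
  then have "t * (2 * Re a + t * Re (qform M v)) \<le> 0" using z by (simp add: algebra_simps)
  then have "2 * Re a + t * Re (qform M v) \<le> 0" using t by (simp add: mult_le_0_iff)
  moreover have "t * Re (qform M v) \<ge> - Re a"
  proof -
    have "t * \<bar>Re (qform M v)\<bar> \<le> t * (\<bar>Re (qform M v)\<bar> + 1)" using t by simp
    also have "\<dots> = Re a" by (simp add: t_def)
    finally have "t * \<bar>Re (qform M v)\<bar> \<le> Re a" .
    moreover have "t * Re (qform M v) \<ge> - (t * \<bar>Re (qform M v)\<bar>)"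
      using t by (metis abs_ge_minus_self abs_mult abs_of_pos minus_le_iff)
    ultimately show ?thesis by linarith
  qed
  ultimately show False using a by linarith
qed

section \<open>Behaviour at infinity and leading coefficients at the origin\<close>

context minimal_state_space begin

lemma strictly_proper_imp_D0:
  assumes "strictly_proper m G" shows "D = 0\<^sub>m m m"
proof (rule eq_matI)
  fix i j assume "i < dim_row (0\<^sub>m m m :: real mat)" "j < dim_col (0\<^sub>m m m :: real mat)"
  then have ij: "i < m" "j < m" by auto
  have "((\<lambda>s. G s $$ (i, j)) \<longlongrightarrow> 0) at_infinity"
    using assms ij by (auto simp: strictly_proper_def mat_tendsto_def)
  moreover have "eventually (\<lambda>s. G s $$ (i, j) = H s $$ (i, j)) at_infinity"
    using eventually_T_eq_H(2) by eventually_elim (simp add: G_eq)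
  ultimately have "((\<lambda>s. H s $$ (i, j)) \<longlongrightarrow> 0) at_infinity" by (simp add: tendsto_cong)
  with H_at_infinity(2)[OF ij] have "cmat D $$ (i, j) = 0"
    using tendsto_unique[OF trivial_limit_at_infinity] by blast
  then show "D $$ (i, j) = 0\<^sub>m m m $$ (i, j)" using ij by simp
qed auto

lemma mat_lim_at:
  assumes "\<And>i j. i < m \<Longrightarrow> j < m \<Longrightarrow> ((\<lambda>s. F s $$ (i, j)) \<longlongrightarrow> L i j) (at p)"
  shows "mat_lim m F (at p) = Matrix.mat m m (\<lambda>(i, j). L i j)"
  using assms by (intro eq_matI) (auto simp: mat_lim_def intro!: tendsto_Lim)

end

context negative_imaginary_system begin

text \<open>\<open>G2\<close> is defined by \<open>Lim\<close>, so existence of the limit comes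
  first: at a pole it is part of the negative imaginary property, otherwise the limit is 0.\<close>

lemma G2_limit:
  assumes ij: "i < m" "j < m"
  shows "((\<lambda>s. s ^ 2 * H s $$ (i, j)) \<longlongrightarrow> G2 m G $$ (i, j)) (at 0)"
proof -
  have ex: "\<exists>l. ((\<lambda>s. s ^ 2 * H s $$ (i, j)) \<longlongrightarrow> l) (at 0)" if ij: "i < m" "j < m" for i j
  proof (cases "has_pole m G 0")
    case True
    then obtain M where M: "mat_tendsto m (\<lambda>s. s ^ 2 \<cdot>\<^sub>m G s) M (at 0)"
      using ni unfolding negative_imaginary_def by blast
    show ?thesis using mat_tendsto_G(2)[OF M, of 0] ij by auto
  next
    case False
    then have "((\<lambda>s. s ^ 2 * H s $$ (i, j)) \<longlongrightarrow> 0 ^ 2 * T 0 $$ (i, j)) (at 0)"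
      using ij by (intro tendsto_intros T_tendsto) (auto simp: has_pole_def G_eq)
    then show ?thesis by blast
  qed
  then obtain L where L: "\<And>i j. i < m \<Longrightarrow> j < m \<Longrightarrow> ((\<lambda>s. s ^ 2 * H s $$ (i, j)) \<longlongrightarrow> L i j) (at 0)"
    by metis
  have "((\<lambda>s. (s ^ 2 \<cdot>\<^sub>m G s) $$ (i, j)) \<longlongrightarrow> L i j) (at 0)" if ij: "i < m" "j < m" for i j
  proof (rule Lim_transform_eventually[OF L[OF ij]])
    show "eventually (\<lambda>s. s ^ 2 * H s $$ (i, j) = (s ^ 2 \<cdot>\<^sub>m G s) $$ (i, j)) (at 0)"
      using eventually_T_eq_H(1)[of 0]
      by eventually_elim (use ij carrier_matD[OF H_carrier] in \<open>simp add: G_eq\<close>)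
  qed
  then have "G2 m G = Matrix.mat m m (\<lambda>(i, j). L i j)" unfolding G2_def by (rule mat_lim_at)
  then show ?thesis using L ij by simp
qed

text \<open>With \<open>G2\<close> zero, z times z H(z) tends to 0, so z H(z) has a removable
  singularity at 0 by Riemann's theorem and the limit defining \<open>G1\<close> exists.\<close>

lemma G1_limit:
  assumes G2: "G2 m G = 0\<^sub>m m m" and ij: "i < m" "j < m"
  shows "((\<lambda>s. s * H s $$ (i, j)) \<longlongrightarrow> G1 m G $$ (i, j)) (at 0)"
proof -
  have ex: "\<exists>l. ((\<lambda>s. s * H s $$ (i, j)) \<longlongrightarrow> l) (at 0)" if ij: "i < m" "j < m" for i j
  proof -
    define S where "S = - ({z. ev z} - {0})"
    have S: "open S" "0 \<in> S"
      unfolding S_def using finite_ev by (auto simp only: intro!: open_Compl finite_imp_closed finite_Diff)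
    have "(\<exists>g. g holomorphic_on S \<and> (\<forall>z\<in>S - {0}. g z = z * H z $$ (i, j))) \<longleftrightarrow>
      ((\<lambda>z. (z - 0) * (z * H z $$ (i, j))) \<longlongrightarrow> 0) (at 0)"
    proof (rule holomorphic_on_extend_lim)
      show "(\<lambda>z. z * H z $$ (i, j)) holomorphic_on S - {0}"
        by (intro holomorphic_intros holomorphic_on_subset[OF H_holomorphic[OF ij]]) (auto simp: S_def)
      show "0 \<in> interior S" using S by (simp add: interior_open)
    qed
    moreover have "((\<lambda>z. (z - 0) * (z * H z $$ (i, j))) \<longlongrightarrow> 0) (at 0)"
      using G2_limit[OF ij] ij by (simp add: G2 power2_eq_square mult.assoc)
    ultimately obtain g where g: "g holomorphic_on S" "\<And>z. z \<in> S - {0} \<Longrightarrow> g z = z * H z $$ (i, j)" by blast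
    have "isCont g 0" using g S by (metis continuous_on_eq_continuous_at holomorphic_on_imp_continuous_on)
    then have gl: "(g \<longlongrightarrow> g 0) (at 0)" by (simp add: isCont_def)
    have "eventually (\<lambda>z. z \<in> S - {0}) (at 0)" by (rule eventually_at_in_open[OF S])
    then have "eventually (\<lambda>z. g z = z * H z $$ (i, j)) (at 0)" by eventually_elim (rule g)
    from Lim_transform_eventually[OF gl this] show ?thesis by blast
  qed
  then obtain L where L: "\<And>i j. i < m \<Longrightarrow> j < m \<Longrightarrow> ((\<lambda>s. s * H s $$ (i, j)) \<longlongrightarrow> L i j) (at 0)"
    by metis
  have "((\<lambda>s. (s \<cdot>\<^sub>m (G s - (1 / s ^ 2) \<cdot>\<^sub>m G2 m G)) $$ (i, j)) \<longlongrightarrow> L i j) (at 0)" if ij: "i < m" "j < m" for i j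
  proof (rule Lim_transform_eventually[OF L[OF ij]])
    show "eventually (\<lambda>s. s * H s $$ (i, j) = (s \<cdot>\<^sub>m (G s - (1 / s ^ 2) \<cdot>\<^sub>m G2 m G)) $$ (i, j)) (at 0)"
      using eventually_T_eq_H(1)[of 0]
      by eventually_elim (use ij carrier_matD[OF H_carrier] in \<open>simp add: G_eq[symmetric] G2\<close>)
  qed
  then have "G1 m G = Matrix.mat m m (\<lambda>(i, j). L i j)" unfolding G1_def by (rule mat_lim_at)
  then show ?thesis using L ij by simp
qed

end

locale free_body_system = negative_imaginary_system +
  assumes free_body: "(G2 m G = 0\<^sub>m m m \<and> invertible_mat (G1 m G)) \<or> (G1 m G = 0\<^sub>m m m \<and> pos_def (G2 m G))"
begin

text \<open>The leading coefficient at the origin is \<open>G1\<close> in one case and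
  \<open>G2\<close> in the other, with k = 1 and k = 2, and it has trivial kernel either way. The
  lemma excludes the closed-loop eigenvalue 0 and also identifies the closed-loop gain at 0.\<close>

lemma equilibrium_input:
  assumes x: "x \<in> carrier_vec n" and y: "y \<in> carrier_vec m"
    and eq: "0 \<cdot>\<^sub>v x - cmat A *\<^sub>v x = cmat B *\<^sub>v y"
  shows "y = 0\<^sub>v m"
proof -
  have ker: "M *\<^sub>v y = 0\<^sub>v m" if M: "M \<in> carrier_mat m m" and k: "k > 0"
    and lim: "\<And>i j. i < m \<Longrightarrow> j < m \<Longrightarrow> ((\<lambda>s. (s - 0) ^ k * H s $$ (i, j)) \<longlongrightarrow> M $$ (i, j)) (at 0)" for M k
  proof (rule eq_vecI)
    fix i assume "i < dim_vec (0\<^sub>v m :: complex vec)"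
    then have i: "i < m" by simp
    have "(\<Sum>j<m. M $$ (i, j) * y $ j) = 0"
      by (rule input_in_kernel[OF D0 x y eq k i lim[OF i]])
    then show "(M *\<^sub>v y) $ i = 0\<^sub>v m $ i"
      using i M y by (simp add: scalar_prod_def atLeast0LessThan)
  qed (use M in simp)
  from free_body show ?thesis
  proof
    assume h: "G2 m G = 0\<^sub>m m m \<and> invertible_mat (G1 m G)"
    have c: "G1 m G \<in> carrier_mat m m" by (simp add: G1_def mat_lim_def)
    have "G1 m G *\<^sub>v y = 0\<^sub>v m" using ker[OF c, of 1] G1_limit h by simp
    then show ?thesis using invertible_mat_kernel[OF _ c y] h by blast
  next
    assume h: "G1 m G = 0\<^sub>m m m \<and> pos_def (G2 m G)"
    have c: "G2 m G \<in> carrier_mat m m" by (simp add: G2_def mat_lim_def)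
    have "G2 m G *\<^sub>v y = 0\<^sub>v m" using ker[OF c, of 2] G2_limit by simp
    then have "Re ((G2 m G *\<^sub>v y) \<bullet>c y) = 0" using y by simp
    then show ?thesis using h c y unfolding pos_def_def by force
  qed
qed

end

section \<open>The closed loop\<close>

lemma mult_mat_uminus_vec:
  fixes M :: "'a :: comm_ring_1 mat"
  assumes "M \<in> carrier_mat k m" "v \<in> carrier_vec m"
  shows "M *\<^sub>v (- v) = - (M *\<^sub>v v)"
  using assms by (intro eq_vecI) (auto simp: scalar_prod_def sum_negf)

locale feedback =
  plant: free_body_system n m A B C D G + controller: minimal_state_space n' m A' B' C' D' G'
  for n m A B C D G n' A' B' C' D' G' +
  assumes sni: "strictly_negative_imaginary m G'"
begin

abbreviation (input) "H' \<equiv> state_space_eval A' B' C' D'"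

abbreviation (input) "Acl \<equiv> closed_loop_mat A B C D A' B' C' D'"

text \<open>Minimality turns the absence of poles of \<open>G'\<close> in the closed right half
  plane into stability of the state matrix A'.\<close>

lemma not_ev_controller: "Re z \<ge> 0 \<Longrightarrow> \<not> eigenvalue (cmat A') z"
  using sni controller.has_pole_iff_ev[of z] by (auto simp: strictly_negative_imaginary_def)

lemma controller_at_0: "G' 0 = H' 0"
  using controller.G_eq controller.T_eq_H[OF not_ev_controller[of 0]] by simp

lemma Im_controller:
  assumes w: "w > 0" and u: "u \<in> carrier_vec m"
  shows "Im (qform (H' (\<i> * of_real w)) u) \<le> 0"
    "u \<noteq> 0\<^sub>v m \<Longrightarrow> Im (qform (H' (\<i> * of_real w)) u) < 0"
proof -
  have "pos_def (imag_herm (G' (\<i> * of_real w)))"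
    using sni w by (simp add: strictly_negative_imaginary_def)
  moreover have "G' (\<i> * of_real w) = H' (\<i> * of_real w)"
    using controller.G_eq controller.T_eq_H[OF not_ev_controller[of "\<i> * of_real w"]] by simp
  ultimately have pd: "pos_def (imag_herm (H' (\<i> * of_real w)))" by simp
  note q = qform_imag_herm[OF controller.H_carrier u]
  show strict: "Im (qform (H' (\<i> * of_real w)) u) < 0" if "u \<noteq> 0\<^sub>v m"
  proof -
    have "Re (qform (imag_herm (H' (\<i> * of_real w))) u) > 0"
      using pd that u carrier_matD(1)[OF q(1)] unfolding pos_def_def qform_def by metis
    then show ?thesis using q(2) by simp
  qed
  show "Im (qform (H' (\<i> * of_real w)) u) \<le> 0"
  proof (cases "u = 0\<^sub>v m")
    case True
    then have "qform (H' (\<i> * of_real w)) u = 0" unfolding qform_sum[OF controller.H_carrier u] by simp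
    then show ?thesis by simp
  qed (use strict in force)
qed

lemma controller_0:
  assumes u: "u \<in> carrier_vec m"
  shows "Im (qform (H' 0) u) = 0"
    "Re s > 0 \<Longrightarrow> Re ((qform (H' 0) u - qform (H' s) u) / s) \<ge> 0"
proof -
  show "Im (qform (H' 0) u) = 0"
    by (rule controller.stable_negative_imaginary(1)) (use not_ev_controller Im_controller(1) u in auto)
  show "Re s > 0 \<Longrightarrow> Re ((qform (H' 0) u - qform (H' s) u) / s) \<ge> 0"
    by (rule controller.stable_negative_imaginary(2)) (use not_ev_controller Im_controller(1) u in auto)
qed

lemma closed_loop_eq:
  "Acl = four_block_mat (A + B * D' * C) (B * C') (B' * C) A'"
proof -
  note D0 = plant.D0
  have one: "1\<^sub>m m - D * D' = 1\<^sub>m m" unfolding D0 by (intro eq_matI) (auto simp: scalar_prod_def)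
  have E: "inv_mat (1\<^sub>m m) = (1\<^sub>m m :: real mat)"
    using inv_mat_det[of "1\<^sub>m m :: real mat" m] left_mult_one_mat by fastforce
  have D'C: "D' \<in> carrier_mat m m" "C \<in> carrier_mat m n" "C' \<in> carrier_mat m n'" "B \<in> carrier_mat n m"
    "B' \<in> carrier_mat n' m" "A' \<in> carrier_mat n' n'" by simp_all
  have BD: "B * D' \<in> carrier_mat n m" by (rule mult_carrier_mat[OF D'C(4,1)])
  have e1: "B * D' * 1\<^sub>m m = B * D'" by (rule right_mult_one_mat[OF BD])
  have e2: "B' * 1\<^sub>m m = B'" by (rule right_mult_one_mat[OF D'C(5)])
  have z1: "B * D' * D * C' = 0\<^sub>m n n'"
    unfolding D0 right_mult_zero_mat[OF BD] by (rule left_mult_zero_mat[OF D'C(3)])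
  have z2: "B' * D * C' = 0\<^sub>m n' n'"
    unfolding D0 right_mult_zero_mat[OF D'C(5)] by (rule left_mult_zero_mat[OF D'C(3)])
  have BC: "B * C' \<in> carrier_mat n n'" by (rule mult_carrier_mat[OF D'C(4,3)])
  show ?thesis
    unfolding closed_loop_mat_def Let_def plant.dims one E e1 e2 z1 z2
      right_add_zero_mat[OF BC] right_add_zero_mat[OF D'C(6)] ..
qed

lemma closed_loop_carrier: "Acl \<in> carrier_mat (n + n') (n + n')"
  unfolding closed_loop_eq
  by (intro four_block_carrier_mat add_carrier_mat mult_carrier_mat[of _ n m] mult_carrier_mat[of _ n m])
    simp_all

lemma internally_stable_iff: "internally_stable A B C D A' B' C' D' \<longleftrightarrow> hurwitz Acl"
proof -
  have "1\<^sub>m m - D * D' = 1\<^sub>m m" unfolding plant.D0 by (intro eq_matI) (auto simp: scalar_prod_def)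
  moreover have "invertible_mat (1\<^sub>m m :: real mat)"
    by (auto simp: invertible_mat_def inverts_mat_def intro!: exI[of _ "1\<^sub>m m"])
  ultimately show ?thesis by (simp add: internally_stable_def)
qed

lemma closed_loop_mult:
  assumes x: "x \<in> carrier_vec n" and x': "x' \<in> carrier_vec n'"
  shows "cmat Acl *\<^sub>v (x @\<^sub>v x') =
    (cmat A *\<^sub>v x + cmat B *\<^sub>v (cmat C' *\<^sub>v x' + cmat D' *\<^sub>v (cmat C *\<^sub>v x))) @\<^sub>v
    (cmat B' *\<^sub>v (cmat C *\<^sub>v x) + cmat A' *\<^sub>v x')"
proof -
  note cs = plant.cmat_carrier controller.cmat_carrier
  have c: "A + B * D' * C \<in> carrier_mat n n" "B * C' \<in> carrier_mat n n'" "B' * C \<in> carrier_mat n' n"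
    "B * D' \<in> carrier_mat n m" "B * D' * C \<in> carrier_mat n n"
    by (auto intro!: add_carrier_mat mult_carrier_mat[of _ n m] mult_carrier_mat[of _ n' m])
  have u: "cmat C *\<^sub>v x \<in> carrier_vec m" "cmat C' *\<^sub>v x' \<in> carrier_vec m"
    by (rule mult_mat_vec_carrier[OF cs(3) x], rule mult_mat_vec_carrier[OF cs(7) x'])
  have Du: "cmat D' *\<^sub>v (cmat C *\<^sub>v x) \<in> carrier_vec m" by (rule mult_mat_vec_carrier[OF cs(8) u(1)])
  have BC: "cmat (B * C') *\<^sub>v x' = cmat B *\<^sub>v (cmat C' *\<^sub>v x')"
    unfolding of_real_hom.mat_hom_mult[OF plant.B controller.C]
    by (rule assoc_mult_mat_vec[OF cs(2,7) x'])
  have B'C: "cmat (B' * C) *\<^sub>v x = cmat B' *\<^sub>v (cmat C *\<^sub>v x)"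
    unfolding of_real_hom.mat_hom_mult[OF controller.B plant.C]
    by (rule assoc_mult_mat_vec[OF cs(6,3) x])
  have BDC: "cmat (B * D' * C) *\<^sub>v x = cmat B *\<^sub>v (cmat D' *\<^sub>v (cmat C *\<^sub>v x))"
    unfolding of_real_hom.mat_hom_mult[OF c(4) plant.C] of_real_hom.mat_hom_mult[OF plant.B controller.D]
    using assoc_mult_mat_vec[OF mult_carrier_mat[OF cs(2,8)] cs(3) x] assoc_mult_mat_vec[OF cs(2,8) u(1)] by simp
  have "cmat (A + B * D' * C) = cmat A + cmat (B * D' * C)"
    using c(5) by (intro eq_matI) auto
  then have ABDC: "cmat (A + B * D' * C) *\<^sub>v x = cmat A *\<^sub>v x + cmat B *\<^sub>v (cmat D' *\<^sub>v (cmat C *\<^sub>v x))"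
    using add_mult_distrib_mat_vec[OF cs(1), of "cmat (B * D' * C)" x] c(5) x BDC by simp
  have vs: "cmat A *\<^sub>v x \<in> carrier_vec n" "cmat B *\<^sub>v (cmat C' *\<^sub>v x') \<in> carrier_vec n"
    "cmat B *\<^sub>v (cmat D' *\<^sub>v (cmat C *\<^sub>v x)) \<in> carrier_vec n"
    using mult_mat_vec_carrier[OF cs(1) x] mult_mat_vec_carrier[OF cs(2) u(2)] mult_mat_vec_carrier[OF cs(2) Du] by auto
  have "cmat Acl = four_block_mat (cmat (A + B * D' * C)) (cmat (B * C')) (cmat (B' * C)) (cmat A')"
    unfolding closed_loop_eq by (rule map_four_block_mat[OF c(1,2,3) controller.A])
  then have "cmat Acl *\<^sub>v (x @\<^sub>v x') = (cmat (A + B * D' * C) *\<^sub>v x + cmat (B * C') *\<^sub>v x') @\<^sub>v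
     (cmat (B' * C) *\<^sub>v x + cmat A' *\<^sub>v x')"
    using four_block_mat_mult_vec[of "cmat (A + B * D' * C)" n n "cmat (B * C')" n' "cmat (B' * C)" n' "cmat A'" x x']
      c cs x x' by simp
  also have "cmat (A + B * D' * C) *\<^sub>v x + cmat (B * C') *\<^sub>v x' =
     cmat A *\<^sub>v x + cmat B *\<^sub>v (cmat C' *\<^sub>v x' + cmat D' *\<^sub>v (cmat C *\<^sub>v x))"
    unfolding ABDC BC mult_add_distrib_mat_vec[OF cs(2) u(2) Du]
    using vs by (intro eq_vecI) (auto simp: add_ac simp del: index_mult_mat_vec)
  finally show ?thesis unfolding B'C .
qed

lemma controller_output:
  assumes x': "x' \<in> carrier_vec n'" and u: "u \<in> carrier_vec m" and s: "Re s \<ge> 0"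
    and eq: "s \<cdot>\<^sub>v x' - cmat A' *\<^sub>v x' = cmat B' *\<^sub>v u"
  shows "cmat C' *\<^sub>v x' + cmat D' *\<^sub>v u = H' s *\<^sub>v u"
  unfolding controller.H_apply[OF not_ev_controller[OF s] u]
    resolvent_unique[OF controller.cmat_carrier(1) not_ev_controller[OF s] x' eq] ..

text \<open>The controller state is eliminated, which is legitimate because A' is stable, while the
  plant stays in state form because s may be an eigenvalue of A. Taking v = 0 gives eigenvectors,
  and general v gives the closed-loop response.\<close>

lemma closed_loop_resolvent_eq:
  assumes x: "x \<in> carrier_vec n" and x': "x' \<in> carrier_vec n'" and v: "v \<in> carrier_vec m" and s: "Re s \<ge> 0"
    and eq: "s \<cdot>\<^sub>v (x @\<^sub>v x') - cmat Acl *\<^sub>v (x @\<^sub>v x') = (cmat B *\<^sub>v v) @\<^sub>v 0\<^sub>v n'"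
  shows "s \<cdot>\<^sub>v x - cmat A *\<^sub>v x = cmat B *\<^sub>v (H' s *\<^sub>v (cmat C *\<^sub>v x) + v)"
    "s \<cdot>\<^sub>v x' - cmat A' *\<^sub>v x' = cmat B' *\<^sub>v (cmat C *\<^sub>v x)"
proof -
  note cs = plant.cmat_carrier controller.cmat_carrier
  define u where "u = cmat C *\<^sub>v x"
  have u: "u \<in> carrier_vec m" unfolding u_def by (rule mult_mat_vec_carrier[OF cs(3) x])
  define y where "y = cmat C' *\<^sub>v x' + cmat D' *\<^sub>v u"
  have y: "y \<in> carrier_vec m" unfolding y_def
    by (rule add_carrier_vec[OF mult_mat_vec_carrier[OF cs(7) x'] mult_mat_vec_carrier[OF cs(8) u]])
  have By: "cmat B *\<^sub>v y \<in> carrier_vec n" "cmat B *\<^sub>v v \<in> carrier_vec n" "cmat A *\<^sub>v x \<in> carrier_vec n"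
    "cmat B' *\<^sub>v u \<in> carrier_vec n'" "cmat A' *\<^sub>v x' \<in> carrier_vec n'"
    using mult_mat_vec_carrier[OF cs(2) y] mult_mat_vec_carrier[OF cs(2) v] mult_mat_vec_carrier[OF cs(1) x]
      mult_mat_vec_carrier[OF cs(6) u] mult_mat_vec_carrier[OF cs(5) x'] by auto
  have "s \<cdot>\<^sub>v (x @\<^sub>v x') - cmat Acl *\<^sub>v (x @\<^sub>v x') =
    (s \<cdot>\<^sub>v x - (cmat A *\<^sub>v x + cmat B *\<^sub>v y)) @\<^sub>v (s \<cdot>\<^sub>v x' - (cmat B' *\<^sub>v u + cmat A' *\<^sub>v x'))"
    unfolding closed_loop_mult[OF x x'] u_def[symmetric] y_def[symmetric]
    using x x' By by (intro eq_vecI) (auto simp del: index_mult_mat_vec)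
  then have "s \<cdot>\<^sub>v x - (cmat A *\<^sub>v x + cmat B *\<^sub>v y) = cmat B *\<^sub>v v \<and>
    s \<cdot>\<^sub>v x' - (cmat B' *\<^sub>v u + cmat A' *\<^sub>v x') = 0\<^sub>v n'"
    using eq x By append_vec_eq[of "s \<cdot>\<^sub>v x - (cmat A *\<^sub>v x + cmat B *\<^sub>v y)" n "cmat B *\<^sub>v v"] by simp
  then have e: "s \<cdot>\<^sub>v x - (cmat A *\<^sub>v x + cmat B *\<^sub>v y) = cmat B *\<^sub>v v"
    "s \<cdot>\<^sub>v x' - (cmat B' *\<^sub>v u + cmat A' *\<^sub>v x') = 0\<^sub>v n'" by auto
  have rearr: "a - c = d + e'" if "a - (c + d) = e'" "a \<in> carrier_vec k" "c \<in> carrier_vec k" "d \<in> carrier_vec k"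
    for a c d e' :: "complex vec" and k
    unfolding that(1)[symmetric] using that(2-) by (intro eq_vecI) auto
  show 2: "s \<cdot>\<^sub>v x' - cmat A' *\<^sub>v x' = cmat B' *\<^sub>v (cmat C *\<^sub>v x)"
  proof -
    have "s \<cdot>\<^sub>v x' - (cmat A' *\<^sub>v x' + cmat B' *\<^sub>v u) = 0\<^sub>v n'"
      using e(2) comm_add_vec[OF By(4,5)] by simp
    from rearr[OF this _ By(5,4)] show ?thesis using x' By(4) by (simp add: u_def)
  qed
  have yH: "y = H' s *\<^sub>v u" unfolding y_def
    by (rule controller_output[OF x' u s 2[folded u_def]])
  have "s \<cdot>\<^sub>v x - cmat A *\<^sub>v x = cmat B *\<^sub>v y + cmat B *\<^sub>v v"
    by (rule rearr[OF e(1) _ By(3,1)]) (use x in simp)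
  also have "\<dots> = cmat B *\<^sub>v (y + v)" by (rule mult_add_distrib_mat_vec[OF cs(2) y v, symmetric])
  finally show "s \<cdot>\<^sub>v x - cmat A *\<^sub>v x = cmat B *\<^sub>v (H' s *\<^sub>v (cmat C *\<^sub>v x) + v)"
    unfolding yH u_def .
qed

text \<open>Restricted to Im s \<ge> 0, so that axis points have w \<ge> 0; the closed-loop matrix
  is real, hence conjugation covers the rest.\<close>

lemma closed_loop_no_eigenvalue:
  assumes neg: "neg_def (H' 0)" and s: "Re s \<ge> 0" "Im s \<ge> 0"
  shows "\<not> eigenvalue (cmat Acl) s"
proof
  assume "eigenvalue (cmat Acl) s"
  then obtain xi where xi: "xi \<in> carrier_vec (n + n')" "xi \<noteq> 0\<^sub>v (n + n')" "cmat Acl *\<^sub>v xi = s \<cdot>\<^sub>v xi"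
    using closed_loop_carrier by (auto simp: eigenvalue_def eigenvector_def)
  define x x' where "x = vec_first xi n" and "x' = vec_last xi n'"
  have x: "x \<in> carrier_vec n" "x' \<in> carrier_vec n'" and xx: "xi = x @\<^sub>v x'"
    using xi(1) by (auto simp: x_def x'_def)
  note cs = plant.cmat_carrier controller.cmat_carrier
  have B0: "cmat B *\<^sub>v 0\<^sub>v m = 0\<^sub>v n" using cs(2) by auto
  have "s \<cdot>\<^sub>v (x @\<^sub>v x') - cmat Acl *\<^sub>v (x @\<^sub>v x') = (cmat B *\<^sub>v 0\<^sub>v m) @\<^sub>v 0\<^sub>v n'"
    unfolding xx[symmetric] xi(3) B0 using xi(1) by (intro eq_vecI) auto
  note e = closed_loop_resolvent_eq[OF x zero_carrier_vec s(1) this]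
  define u where "u = cmat C *\<^sub>v x"
  define y where "y = H' s *\<^sub>v u"
  have u: "u \<in> carrier_vec m" unfolding u_def by (rule mult_mat_vec_carrier[OF cs(3) x(1)])
  have y: "y \<in> carrier_vec m" unfolding y_def by (rule mult_mat_vec_carrier[OF controller.H_carrier u])
  have ex: "s \<cdot>\<^sub>v x - cmat A *\<^sub>v x = cmat B *\<^sub>v y"
    using e(1) y by (simp add: y_def u_def)
  have ex': "s \<cdot>\<^sub>v x' - cmat A' *\<^sub>v x' = cmat B' *\<^sub>v u" using e(2) by (simp add: u_def)
  \<comment> \<open>If u = 0, then also y = 0, so x is zero or an eigenvector of A killed by C;
    observability gives x = 0. The controller then has no input, and stability of A' makes its state
    vanish too.\<close>
  have u0: "u \<noteq> 0\<^sub>v m"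
  proof
    assume u0: "u = 0\<^sub>v m"
    have "y = 0\<^sub>v m" unfolding y_def u0
      using carrier_matD[OF controller.H_carrier[of s]] by (intro eq_vecI) (auto simp: scalar_prod_def)
    then have z: "s \<cdot>\<^sub>v x - cmat A *\<^sub>v x = 0\<^sub>v n" using ex B0 by simp
    have "s * x $ i - (cmat A *\<^sub>v x) $ i = 0" if i: "i < n" for i
    proof -
      have "s * x $ i - (cmat A *\<^sub>v x) $ i = (s \<cdot>\<^sub>v x - cmat A *\<^sub>v x) $ i"
        using i x(1) by (simp del: index_mult_mat_vec)
      then show ?thesis unfolding z using i by simp
    qed
    then have "cmat A *\<^sub>v x = s \<cdot>\<^sub>v x" using x by (intro eq_vecI) (auto simp del: index_mult_mat_vec)
    from plant.observable[OF x(1) this] have x0: "x = 0\<^sub>v n" using u0 by (simp add: u_def)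
    have "cmat B' *\<^sub>v u = 0\<^sub>v n'" unfolding u0 using cs(6) by auto
    then have "resolvent (cmat A') s *\<^sub>v 0\<^sub>v n' = x'"
      using resolvent_unique[OF cs(5) not_ev_controller[OF s(1)] x(2)] ex' by simp
    moreover have "resolvent (cmat A') s *\<^sub>v 0\<^sub>v n' = 0\<^sub>v n'"
      using resolvent(1)[OF cs(5) not_ev_controller[OF s(1)]] by auto
    ultimately have "xi = 0\<^sub>v (n + n')" unfolding xx x0 by auto
    then show False using xi(2) by simp
  qed
  define a where "a = qform (H' 0) u"
  define p where "p = u \<bullet>c y"
  have a: "Re a < 0" "Im a = 0"
    using neg u u0 carrier_matD(1)[OF controller.H_carrier[of 0]] controller_0(1)[OF u]
    by (auto simp: neg_def_def a_def qform_def)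
  have qu: "qform (H' s) u = cnj p"
    unfolding qform_def y_def[symmetric] p_def by (rule conjugate_scalar_prod(2)[OF u y])
  consider "Re s > 0" | "Re s = 0" "Im s > 0" | "s = 0" using s by (force simp: complex_eq_iff)
  then show False
  proof cases
    case 1
    then have ns: "\<not> eigenvalue (cmat A) s" using plant.ev_Re by force
    have "u = plant.H s *\<^sub>v y"
      using plant.output_eq[OF plant.D0 x(1) y ex ns] carrier_matD(1)[OF plant.H_carrier[of s]]
      unfolding u_def[symmetric]
      by (intro eq_vecI) (auto simp del: index_mult_mat_vec simp: u_def)
    then have "qform (plant.H s) y = p" by (simp add: qform_def p_def)
    then have 1: "Re (s * p) \<ge> 0" using plant.Re_s_qform_H[OF 1 y] by simp
    have 2: "Re ((a - cnj p) / s) \<ge> 0"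
      using controller_0(2)[OF u, of s] \<open>Re s > 0\<close> unfolding a_def qu by simp
    \<comment> \<open>Clearing the denominator produces Re (cnj p * cnj s) = Re (s * p), the very
      quantity that the plant bounds from below.\<close>
    have "(a - cnj p) / s = ((a - cnj p) * cnj s) / of_real ((cmod s)\<^sup>2)"
      by (subst complex_div_cnj) simp
    then have "Re ((a - cnj p) / s) = Re ((a - cnj p) * cnj s) / (cmod s)\<^sup>2" by (simp add: Re_divide_of_real)
    with 2 have "Re ((a - cnj p) * cnj s) \<ge> 0" using \<open>Re s > 0\<close> by (auto simp: zero_le_divide_iff)
    moreover have "Re ((a - cnj p) * cnj s) = Re a * Re s - Re (s * p)" using a by (simp add: algebra_simps)
    moreover have "Re a * Re s < 0" using a \<open>Re s > 0\<close> by (simp add: mult_neg_pos)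
    ultimately show False using 1 by linarith
  next
    case 2
    then have seq: "s = \<i> * of_real (Im s)" by (simp add: complex_eq_iff)
    have "Im p \<le> 0"
      \<comment> \<open>Here i w may be a pole of \<open>G\<close>, so the state equation is used
        instead of evaluating \<open>H\<close>.\<close>
      using plant.Im_output[OF 2(2) x(1) y] ex seq unfolding p_def u_def by simp
    moreover have "Im (qform (H' s) u) < 0" using Im_controller(2)[OF 2(2) u u0] seq by simp
    ultimately show False using qu by simp
  next
    case 3
    have "y = 0\<^sub>v m" using plant.equilibrium_input[OF x(1) y] ex 3 by simp
    then have "p = 0" using u by (simp add: p_def)
    then show False using qu a 3 by (simp add: a_def)
  qed
qed

lemma hurwitz_if_neg_def:
  assumes neg: "neg_def (H' 0)" shows "hurwitz Acl"
  unfolding hurwitz_def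
proof (intro allI impI)
  fix z assume ev: "eigenvalue (cmat Acl) z"
  show "Re z < 0"
  proof (rule ccontr)
    assume "\<not> Re z < 0"
    then show False
      using closed_loop_no_eigenvalue[OF neg, of z] closed_loop_no_eigenvalue[OF neg, of "cnj z"]
        ev eigenvalue_cnj[OF closed_loop_carrier ev] by (cases "Im z \<ge> 0") auto
  qed
qed

text \<open>\<open>(Acl, Bcl, Ccl, 0)\<close> realizes \<open>(I - G G')\<^sup>-\<^sup>1 G\<close>: the input is added to the output of the controller.\<close>

definition Bcl :: "real mat" where
  "Bcl = Matrix.mat (n + n') m (\<lambda>(i, j). if i < n then B $$ (i, j) else 0)"

definition Ccl :: "real mat" where
  "Ccl = Matrix.mat m (n + n') (\<lambda>(i, j). if j < n then C $$ (i, j) else 0)"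

sublocale cl: state_space "n + n'" m Acl Bcl Ccl "0\<^sub>m m m"
  by unfold_locales (auto simp: Bcl_def Ccl_def closed_loop_carrier)

lemma Bcl_mult: "v \<in> carrier_vec m \<Longrightarrow> cmat Bcl *\<^sub>v v = (cmat B *\<^sub>v v) @\<^sub>v 0\<^sub>v n'"
  by (intro eq_vecI) (auto simp: Bcl_def scalar_prod_def)

lemma Ccl_mult:
  assumes "x \<in> carrier_vec n" "x' \<in> carrier_vec n'"
  shows "cmat Ccl *\<^sub>v (x @\<^sub>v x') = cmat C *\<^sub>v x"
proof (rule eq_vecI)
  fix i assume "i < dim_vec (cmat C *\<^sub>v x)"
  then have i: "i < m" by simp
  have "(cmat Ccl *\<^sub>v (x @\<^sub>v x')) $ i =
    (\<Sum>j\<in>{0..<n + n'}. if j < n then complex_of_real (C $$ (i, j)) * x $ j else 0)"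
    using i assms by (auto simp: Ccl_def scalar_prod_def intro!: sum.cong)
  also have "\<dots> = (\<Sum>j\<in>{0..<n}. complex_of_real (C $$ (i, j)) * x $ j)"
    by (rule sum.mono_neutral_cong_right) auto
  finally show "(cmat Ccl *\<^sub>v (x @\<^sub>v x')) $ i = (cmat C *\<^sub>v x) $ i"
    using i assms by (simp add: scalar_prod_def)
qed (simp add: Ccl_def)

text \<open>The relation K = G (G' K + I) in state form: the plant, driven by G' K v + v, produces
  the output K v. It remains usable where \<open>G\<close> has a pole, in particular at s =
  0.\<close>

lemma closed_loop_response:
  assumes s: "Re s \<ge> 0" "\<not> eigenvalue (cmat Acl) s" and v: "v \<in> carrier_vec m"
  obtains x where "x \<in> carrier_vec n" "cmat C *\<^sub>v x = cl.H s *\<^sub>v v"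
    "s \<cdot>\<^sub>v x - cmat A *\<^sub>v x = cmat B *\<^sub>v (H' s *\<^sub>v (cl.H s *\<^sub>v v) + v)"
proof -
  have Bv: "cmat Bcl *\<^sub>v v \<in> carrier_vec (n + n')" by (rule mult_mat_vec_carrier[OF cl.cmat_carrier(2) v])
  define xi where "xi = cl.R s *\<^sub>v (cmat Bcl *\<^sub>v v)"
  note xi = resolvent_solves[OF cl.cmat_carrier(1) s(2) Bv, folded xi_def]
  define x x' where "x = vec_first xi n" and "x' = vec_last xi n'"
  have x: "x \<in> carrier_vec n" "x' \<in> carrier_vec n'" and xx: "xi = x @\<^sub>v x'"
    using xi(1) by (auto simp: x_def x'_def)
  have eq: "s \<cdot>\<^sub>v (x @\<^sub>v x') - cmat Acl *\<^sub>v (x @\<^sub>v x') = (cmat B *\<^sub>v v) @\<^sub>v 0\<^sub>v n'"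
    using xi(2) unfolding xx Bcl_mult[OF v] .
  have Cx: "cmat C *\<^sub>v x \<in> carrier_vec m" by (rule mult_mat_vec_carrier[OF plant.cmat_carrier(3) x(1)])
  have "cmat (0\<^sub>m m m) *\<^sub>v v = 0\<^sub>v m" using v by (intro eq_vecI) (auto simp: scalar_prod_def)
  then have H: "cl.H s *\<^sub>v v = cmat C *\<^sub>v x"
    unfolding cl.H_apply[OF s(2) v] xi_def[symmetric] xx Ccl_mult[OF x] using Cx by simp
  show ?thesis
    using that[OF x(1) H[symmetric]] closed_loop_resolvent_eq(1)[OF x v s(1) eq] H by simp
qed

lemma neg_def_if_hurwitz:
  assumes hw: "hurwitz Acl" shows "neg_def (H' 0)"
proof -
  have stable: "\<not> eigenvalue (cmat Acl) z" if "Re z \<ge> 0" for z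
    using hw that by (force simp: hurwitz_def)
  have Hv: "cl.H s *\<^sub>v v \<in> carrier_vec m" if "v \<in> carrier_vec m" for v s
    by (rule mult_mat_vec_carrier[OF cl.H_carrier that])
  have H'v: "H' s *\<^sub>v v \<in> carrier_vec m" if "v \<in> carrier_vec m" for v s
    by (rule mult_mat_vec_carrier[OF controller.H_carrier that])
  \<comment> \<open>With u = K v and y = G' u, the form v^* K v is the plant pairing of u with y + v
    minus the pairing of u with y. The first has Im \<le> 0 and the second Im \<ge> 0.\<close>
  have axis: "Im (qform (cl.H (\<i> * of_real w)) v) \<le> 0" if w: "w > 0" and v: "v \<in> carrier_vec m" for w v
  proof -
    define s where "s = \<i> * complex_of_real w"
    define u where "u = cl.H s *\<^sub>v v"
    define y where "y = H' s *\<^sub>v u"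
    have s: "Re s \<ge> 0" by (simp add: s_def)
    obtain x where x: "x \<in> carrier_vec n" "cmat C *\<^sub>v x = u" "s \<cdot>\<^sub>v x - cmat A *\<^sub>v x = cmat B *\<^sub>v (y + v)"
      using closed_loop_response[OF s stable[OF s] v] unfolding u_def y_def by blast
    have u: "u \<in> carrier_vec m" unfolding u_def by (rule Hv[OF v])
    have y: "y \<in> carrier_vec m" unfolding y_def by (rule H'v[OF u])
    have "Im (u \<bullet>c (y + v)) \<le> 0"
      using plant.Im_output[OF w x(1) add_carrier_vec[OF y v]] x(2,3) by (simp add: s_def)
    moreover have "u \<bullet>c (y + v) = u \<bullet>c y + u \<bullet>c v" by (rule inner_add_distrib[OF u y v])
    moreover have "qform (H' s) u = cnj (u \<bullet>c y)"
      unfolding qform_def y_def[symmetric] by (rule conjugate_scalar_prod(2)[OF u y])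
    moreover have "Im (qform (H' s) u) \<le> 0" unfolding s_def by (rule Im_controller(1)[OF w u])
    ultimately show ?thesis unfolding qform_def s_def[symmetric] u_def[symmetric] by simp
  qed
  note cl0 = cl.stable_negative_imaginary[OF stable axis]
  \<comment> \<open>Along the positive real axis the form of K(t) stays below that of K(0) and tends
    to 0.\<close>
  have K0: "Re (qform (cl.H 0) v) \<ge> 0" if v: "v \<in> carrier_vec m" for v
  proof -
    have "((\<lambda>z. 1 * qform (cl.H z) v) \<longlongrightarrow> qform (cmat (0\<^sub>m m m)) v) at_infinity"
      using cl.H_at_infinity(2) v by (intro tendsto_qform) auto
    moreover have "qform (cmat (0\<^sub>m m m)) v = 0"
      using v by (subst qform_sum[of _ m]) auto
    ultimately have lim: "((\<lambda>z. qform (cl.H z) v) \<longlongrightarrow> 0) at_infinity" by simp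
    have "filterlim complex_of_real at_infinity at_top"
      by (rule filterlim_norm_at_top_imp_at_infinity) (simp add: filterlim_abs_real)
    then have "((\<lambda>t. Re (qform (cl.H (complex_of_real t)) v)) \<longlongrightarrow> Re 0) at_top"
      by (intro tendsto_intros filterlim_compose[OF lim])
    moreover have "eventually (\<lambda>t. Re (qform (cl.H (complex_of_real t)) v) \<le> Re (qform (cl.H 0) v)) at_top"
      using eventually_gt_at_top[of 0]
    proof eventually_elim
      case (elim t)
      have "Re ((qform (cl.H 0) v - qform (cl.H (complex_of_real t)) v) / complex_of_real t) \<ge> 0"
        using elim by (intro cl0(2) v) auto
      then show ?case using elim by (simp add: Re_divide_of_real zero_le_divide_iff)
    qed
    ultimately show ?thesis by (intro tendsto_upperbound[where F = "at_top :: real filter", of _ "Re 0", simplified]) auto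
  qed
  have inv: "H' 0 *\<^sub>v (cl.H 0 *\<^sub>v v) = - v" if v: "v \<in> carrier_vec m" for v
  proof -
    have u: "cl.H 0 *\<^sub>v v \<in> carrier_vec m" by (rule Hv[OF v])
    obtain x where x: "x \<in> carrier_vec n"
      "0 \<cdot>\<^sub>v x - cmat A *\<^sub>v x = cmat B *\<^sub>v (H' 0 *\<^sub>v (cl.H 0 *\<^sub>v v) + v)"
      using closed_loop_response[of 0, OF _ stable v] by auto
    have "H' 0 *\<^sub>v (cl.H 0 *\<^sub>v v) + v = 0\<^sub>v m"
      by (rule plant.equilibrium_input[OF x(1) add_carrier_vec[OF H'v[OF u] v] x(2)])
    then have "(H' 0 *\<^sub>v (cl.H 0 *\<^sub>v v)) $ i + v $ i = 0" if "i < m" for i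
      using that v by (metis carrier_vecD index_add_vec(1) index_zero_vec(1))
    then show ?thesis using v H'v[OF u] carrier_matD(1)[OF controller.H_carrier[of 0]]
      by (intro eq_vecI) (auto simp: eq_neg_iff_add_eq_0 simp del: index_mult_mat_vec)
  qed
  let ?M = "H' 0" and ?K = "cl.H 0"
  have c: "?M \<in> carrier_mat m m" "?K \<in> carrier_mat m m" "- ?K \<in> carrier_mat m m"
    using controller.H_carrier cl.H_carrier by auto
  have MK: "?M * (- ?K) = 1\<^sub>m m"
  proof (rule mat_col_eqI)
    fix j assume "j < dim_col (1\<^sub>m m :: complex mat)"
    then have j: "j < m" by simp
    have e: "unit_vec m j \<in> carrier_vec m" by simp
    have ce: "N *\<^sub>v unit_vec m j = col N j" if "N \<in> carrier_mat m m" for N :: "complex mat"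
      using that j by (intro eq_vecI) auto
    have "(- ?K) *\<^sub>v unit_vec m j = - (?K *\<^sub>v unit_vec m j)" using carrier_matD(2)[OF c(2)] by (intro uminus_mult_mat_vec) simp
    then have "col (?M * (- ?K)) j = ?M *\<^sub>v (- (?K *\<^sub>v unit_vec m j))"
      using col_mult2[OF c(1,3) j] ce[OF c(3)] by simp
    also have "\<dots> = - (?M *\<^sub>v (?K *\<^sub>v unit_vec m j))"
      by (rule mult_mat_uminus_vec[OF c(1) Hv[OF e]])
    also have "\<dots> = col (1\<^sub>m m) j" using inv[OF e] j by simp
    finally show "col (?M * (- ?K)) j = col (1\<^sub>m m) j" .
  qed (use carrier_matD[OF c(1)] carrier_matD[OF c(2)] in auto)
  \<comment> \<open>For square matrices a right inverse is a left inverse. This makes every w a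
    value K(0) v, which transfers the sign of K(0) to \<open>G'(0)\<close>.\<close>
  have KM: "(- ?K) * ?M = 1\<^sub>m m" by (rule mat_mult_left_right_inverse[OF c(1,3) MK])
  have surj: "w = ?K *\<^sub>v (- (?M *\<^sub>v w))" if w: "w \<in> carrier_vec m" for w
  proof -
    have Mw: "?M *\<^sub>v w \<in> carrier_vec m" by (rule H'v[OF w])
    have "w = ((- ?K) * ?M) *\<^sub>v w" unfolding KM using w by simp
    also have "\<dots> = (- ?K) *\<^sub>v (?M *\<^sub>v w)" by (rule assoc_mult_mat_vec[OF c(3,1) w])
    also have "\<dots> = - (?K *\<^sub>v (?M *\<^sub>v w))"
      by (rule uminus_mult_mat_vec) (simp only: carrier_vecD[OF Mw] carrier_matD(2)[OF c(2)])
    also have "\<dots> = ?K *\<^sub>v (- (?M *\<^sub>v w))"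
      by (rule mult_mat_uminus_vec[OF c(2) Mw, symmetric])
    finally show ?thesis .
  qed
  have herm: "hermitian_mat ?M"
    by (rule hermitian_if_qform_real[OF c(1) controller_0(1)])
  \<comment> \<open>Congruence by the inverse: with v = - M w one has w = K v, and v^* K v equals
    minus the conjugate of w^* M w.\<close>
  have le: "Re (qform ?M w) \<le> 0" if w: "w \<in> carrier_vec m" for w
  proof -
    define v where "v = - (?M *\<^sub>v w)"
    have Mw: "?M *\<^sub>v w \<in> carrier_vec m" by (rule H'v[OF w])
    have v: "v \<in> carrier_vec m" using Mw by (simp add: v_def)
    have "qform ?K v = w \<bullet>c v" using surj[OF w] by (simp add: qform_def v_def)
    also have "\<dots> = - (w \<bullet>c (?M *\<^sub>v w))"
      using w Mw by (simp add: v_def scalar_prod_def sum_negf)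
    also have "w \<bullet>c (?M *\<^sub>v w) = cnj (qform ?M w)"
      unfolding qform_def by (rule conjugate_scalar_prod(2)[OF Mw w])
    finally show ?thesis using K0[OF v] by simp
  qed
  show ?thesis
    unfolding neg_def_def
  proof (intro conjI herm ballI impI)
    fix w :: "complex vec" assume "w \<in> carrier_vec (dim_row ?M)" "w \<noteq> 0\<^sub>v (dim_row ?M)"
    then have w: "w \<in> carrier_vec m" "w \<noteq> 0\<^sub>v m" using c(1) by auto
    show "Re ((?M *\<^sub>v w) \<bullet>c w) < 0"
    proof (rule ccontr)
      assume "\<not> Re ((?M *\<^sub>v w) \<bullet>c w) < 0"
      \<comment> \<open>Semidefiniteness is upgraded to definiteness: a vector where the form is not
        negative lies in the kernel of M, which is trivial because M is invertible.\<close>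
      then have "?M *\<^sub>v w = 0\<^sub>v m"
        by (intro neg_semidef_kernel[OF c(1) herm le w(1)]) (auto simp: qform_def)
      then have "w = ?K *\<^sub>v (- 0\<^sub>v m)" using surj[OF w(1)] by simp
      also have "\<dots> = 0\<^sub>v m"
        using carrier_matD[OF c(2)] by (intro eq_vecI) (auto simp: scalar_prod_def)
      finally show False using w by simp
    qed
  qed
qed

end

theorem corollary2:
  fixes m n n' :: nat
    and G G' :: "complex \<Rightarrow> complex mat"
    and A B C D A' B' C' D' :: "real mat"
  assumes "minimal_realization m n A B C D G"
    and "minimal_realization m n' A' B' C' D' G'"
    and "strictly_negative_imaginary m G'"
    and "strictly_proper m G"
    and "negative_imaginary m G"
    and "(G2 m G = 0\<^sub>m m m \<and> invertible_mat (G1 m G)) \<or> (G1 m G = 0\<^sub>m m m \<and> pos_def (G2 m G))"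
  shows "internally_stable A B C D A' B' C' D' \<longleftrightarrow> neg_def (G' 0)"
proof -
  interpret p: minimal_state_space n m A B C D G
    by (intro minimal_state_space.intro minimal_state_space_axioms.intro minimal_imp_state_space(1)[OF assms(1)] assms(1))
  interpret c: minimal_state_space n' m A' B' C' D' G'
    by (intro minimal_state_space.intro minimal_state_space_axioms.intro minimal_imp_state_space(1)[OF assms(2)] assms(2))
  interpret feedback n m A B C D G n' A' B' C' D' G'
    using assms p.strictly_proper_imp_D0[OF assms(4)] by unfold_locales auto
  show ?thesis
    unfolding internally_stable_iff controller_at_0
    using hurwitz_if_neg_def neg_def_if_hurwitz by blast
qed

end
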